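(* For $i=1,2$ let $\mathbb{K}_i\in\mathcal{K}$, let $\eta_i:\mathbb{K}_i\to\mathbb{K}_i$ be a continuous map which is analytic on the interior of $\mathbb{K}_i$, and let $\mathcal{A}_i$ be a topological conjugacy algebra for $(\mathbb{K}_i,\eta_i)$. If the algebras $\mathcal{A}_1(A(\mathbb{K}_1))$ and $\mathcal{A}_2(A(\mathbb{K}_2))$ are isomorphic (as algebras), then either (1) $\eta_1$ and $\eta_2$ are analytically conjugate, i.e. there exists a homeomorphism $\gamma_s:\mathbb{K}_1\to\mathbb{K}_2$ which is analytic in the interior and satisfies $\gamma_s\circ\eta_1=\eta_2\circ\gamma_s$; or (2) $\mathbb{K}_1$ and $\mathbb{K}_2$ are simply connected, $\eta_1$ and $\eta_2$ are homeomorphisms with a unique fixed point in the interior, and $\eta_2$ is analytically conjugate to $\eta_1^{-1}$, i.e. there exists a homeomorphism $\gamma_s:\mathbb{K}_1\to\mathbb{K}_2$ which is analytic in the interior and satisfies $\gamma_s\circ\eta_1^{-1}=\eta_2\circ\gamma_s$.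
   Context: $\mathcal{K}$ is the class of subsets of $\mathbb{C}$ of the form $\mathbb{K}=\overline{G}$, where $G$ is a bounded Cauchy domain, i.e. a bounded connected open set in $\mathbb{C}$ whose boundary is the union of finitely many disjoint Jordan curves. $A(\mathbb{K})$ is the algebra of functions continuous on $\mathbb{K}$ and analytic on its interior. Isomorphisms of algebras are bijective complex algebra homomorphisms; no continuity is assumed. Topological conjugacy algebra: let $\mathcal{X}$ be compact Hausdorff and $\eta:\mathcal{X}\to\mathcal{X}$ continuous. The skew polynomial algebra $P(\mathcal{X},\eta)$ consists of all polynomials $\sum_n f_nU^n$, $f_n\in C(\mathcal{X})$, with multiplication determined by $Uf=(f\circ\eta)U$. A topological conjugacy algebra for $(\mathcal{X},\eta)$ is a complex Banach algebra $\mathcal{A}$ such that: (1) $P(\mathcal{X},\eta)$ is contained in $\mathcal{A}$ as a dense subalgebra and the constant function $1$ is the identity of $\mathcal{A}$; (2) $C(\mathcal{X})\subseteq\mathcal{A}$ is closed and there is an algebra homomorphism $E_0:\mathcal{A}\to C(\mathcal{X})$ with $E_0(f)=f$ for all $f\in C(\mathcal{X})$ and $\ker E_0=\mathcal{A}U$; (3) $U$ is not a right divisor of $0$ (i.e. $aU=0$ implies $a=0$); (4) $\limsup_n(\|E_n\|\,\|U^n\|)^{1/n}\le 1$, where the coefficient maps $E_n:\mathcal{A}\to C(\mathcal{X})$ (automatically bounded) are defined inductively: each $a\in\mathcal{A}$ can be written uniquely as $a=E_0(a)+bU$ with $b\in\mathcal{A}$, and $E_{n+1}(a)=E_n(b)$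 for $n\ge 0$. If $\mathcal{S}\subseteq C(\mathcal{X})$ is a uniform algebra with $f\circ\eta\in\mathcal{S}$ for all $f\in\mathcal{S}$, then $\mathcal{A}(\mathcal{S})$ denotes the norm closed subalgebra of $\mathcal{A}$ generated by all polynomials $\sum_n f_nU^n$ with $f_n\in\mathcal{S}$ for all $n\ge0$. Here $\mathcal{X}=\mathbb{K}_i$, $\mathcal{S}=A(\mathbb{K}_i)$. *)

theory Defs
  imports "HOL-Complex_Analysis.Complex_Analysis"
begin

text \<open>A unital complex Banach algebra. The norm of the unit is not required to be one.\<close>

class complex_banach_algebra = real_normed_algebra + ring_1 + banach +
  fixes scaleC :: "complex \<Rightarrow> 'a \<Rightarrow> 'a" (infixr \<open>*\<^sub>C\<close> 75)
  assumes scaleC_add_right: "c *\<^sub>C (x + y) = c *\<^sub>C x + c *\<^sub>C y"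
    and scaleC_add_left: "(c + d) *\<^sub>C x = c *\<^sub>C x + d *\<^sub>C x"
    and scaleC_scaleC: "c *\<^sub>C d *\<^sub>C x = (c * d) *\<^sub>C x"
    and scaleC_of_real: "complex_of_real r *\<^sub>C x = r *\<^sub>R x"
    and mult_scaleC_left: "(c *\<^sub>C x) * y = c *\<^sub>C (x * y)"
    and mult_scaleC_right: "x * (c *\<^sub>C y) = c *\<^sub>C (x * y)"
    and norm_scaleC: "norm (c *\<^sub>C x) = cmod c * norm x"

definition complex_subalgebra :: "'a::complex_banach_algebra set \<Rightarrow> bool" where
  "complex_subalgebra B \<longleftrightarrow>
     0 \<in> B \<and> (\<forall>x\<in>B. \<forall>y\<in>B. x + y \<in> B) \<and> (\<forall>c. \<forall>x\<in>B. c *\<^sub>C x \<in> B) \<and> (\<forall>x\<in>B. \<forall>y\<in>B. x * y \<in> B)"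

definition complex_algebra_hom_on ::
    "'a::complex_banach_algebra set \<Rightarrow> ('a \<Rightarrow> 'b::complex_banach_algebra) \<Rightarrow> bool" where
  "complex_algebra_hom_on B \<Phi> \<longleftrightarrow>
     (\<forall>x\<in>B. \<forall>y\<in>B. \<Phi> (x + y) = \<Phi> x + \<Phi> y) \<and>
     (\<forall>c. \<forall>x\<in>B. \<Phi> (c *\<^sub>C x) = c *\<^sub>C \<Phi> x) \<and>
     (\<forall>x\<in>B. \<forall>y\<in>B. \<Phi> (x * y) = \<Phi> x * \<Phi> y)"

definition algebras_isomorphic ::
    "'a::complex_banach_algebra set \<Rightarrow> 'b::complex_banach_algebra set \<Rightarrow> bool" where
  "algebras_isomorphic A B \<longleftrightarrow> (\<exists>\<Phi>. bij_betw \<Phi> A B \<and> complex_algebra_hom_on A \<Phi>)"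

text \<open>
  The elements of \<open>C(X)\<close> are represented by functions on the whole type that are continuous on
  \<open>X\<close>; two of them represent the same element iff they agree on \<open>X\<close>. The skew polynomial
  \<open>\<Sum>n. f\<^sub>n U\<^sup>n\<close> is represented by its coefficient sequence \<open>n \<mapsto> f\<^sub>n\<close>.
\<close>

definition skew_polys :: "'x::t2_space set \<Rightarrow> (nat \<Rightarrow> 'x \<Rightarrow> complex) set" where
  "skew_polys X = {p. (\<forall>n. continuous_on X (p n)) \<and> (\<exists>N. \<forall>n>N. \<forall>x\<in>X. p n x = 0)}"

text \<open>
  The relation \<open>U f = (f \<circ> \<eta>) U\<close> gives
  \<open>(f U\<^sup>i) (g U\<^sup>j) = f (g \<circ> \<eta>\<^sup>i) U\<^bsup>i + j\<^esup>\<close>, hence the following product.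
\<close>

definition skew_mult ::
    "('x \<Rightarrow> 'x) \<Rightarrow> (nat \<Rightarrow> 'x \<Rightarrow> complex) \<Rightarrow> (nat \<Rightarrow> 'x \<Rightarrow> complex) \<Rightarrow> (nat \<Rightarrow> 'x \<Rightarrow> complex)" where
  "skew_mult \<eta> p q = (\<lambda>n x. \<Sum>i\<le>n. p i x * q (n - i) ((\<eta> ^^ i) x))"

definition skew_monom :: "('x \<Rightarrow> complex) \<Rightarrow> nat \<Rightarrow> (nat \<Rightarrow> 'x \<Rightarrow> complex)" where
  "skew_monom f k = (\<lambda>n x. if n = k then f x else 0)"

text \<open>
  Here \<open>\<iota>\<close> is the inclusion of the skew polynomials \<open>P(X, \<eta>)\<close> into the Banach algebra.
\<close>

definition tca_U :: "((nat \<Rightarrow> 'x \<Rightarrow> complex) \<Rightarrow> 'a) \<Rightarrow> 'a" where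
  "tca_U \<iota> = \<iota> (skew_monom (\<lambda>_. 1) 1)"

definition tca_fun :: "((nat \<Rightarrow> 'x \<Rightarrow> complex) \<Rightarrow> 'a) \<Rightarrow> ('x \<Rightarrow> complex) \<Rightarrow> 'a" where
  "tca_fun \<iota> f = \<iota> (skew_monom f 0)"

text \<open>
  The coefficient maps are regarded as maps from the algebra into its subalgebra \<open>C(X)\<close>.
  The element \<open>b\<close> below is well defined in a topological conjugacy algebra because
  \<open>a - E\<^sub>0 a\<close> lies in the kernel of \<open>E\<^sub>0\<close>, which consists of the left multiples of \<open>U\<close>, and \<open>U\<close>
  is not a right divisor of zero.
\<close>

primrec coeff_map :: "('a \<Rightarrow> 'a) \<Rightarrow> 'a::complex_banach_algebra \<Rightarrow> nat \<Rightarrow> 'a \<Rightarrow> 'a" where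
  "coeff_map E0 U 0 = E0"
| "coeff_map E0 U (Suc n) = (\<lambda>a. coeff_map E0 U n (THE b. a = E0 a + b * U))"

text \<open>
  The coefficient maps are automatically bounded, so that \<^const>\<open>onorm\<close> is their operator norm.
  It is taken with respect to the norm that \<open>C(X)\<close> inherits from the algebra; as \<open>C(X)\<close> is
  closed, that norm is equivalent to the supremum norm, and the limes superior is the same for both.
\<close>

locale topological_conjugacy_algebra =
  fixes X :: "'x::t2_space set"
    and \<eta> :: "'x \<Rightarrow> 'x"
    and \<iota> :: "(nat \<Rightarrow> 'x \<Rightarrow> complex) \<Rightarrow> 'a::complex_banach_algebra"
    and E0 :: "'a \<Rightarrow> 'a"
  assumes compact_X: "compact X"
    and cont_\<eta>: "continuous_on X \<eta>"
    and \<eta>_into: "\<eta> \<in> X \<rightarrow> X"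
    and \<iota>_eq_iff: "\<And>p q. p \<in> skew_polys X \<Longrightarrow> q \<in> skew_polys X \<Longrightarrow>
          \<iota> p = \<iota> q \<longleftrightarrow> (\<forall>n. \<forall>x\<in>X. p n x = q n x)"
    and \<iota>_add: "\<And>p q. p \<in> skew_polys X \<Longrightarrow> q \<in> skew_polys X \<Longrightarrow>
          \<iota> (\<lambda>n x. p n x + q n x) = \<iota> p + \<iota> q"
    and \<iota>_scale: "\<And>c p. p \<in> skew_polys X \<Longrightarrow> \<iota> (\<lambda>n x. c * p n x) = c *\<^sub>C \<iota> p"
    and \<iota>_mult: "\<And>p q. p \<in> skew_polys X \<Longrightarrow> q \<in> skew_polys X \<Longrightarrow>
          \<iota> (skew_mult \<eta> p q) = \<iota> p * \<iota> q"
    and \<iota>_one: "tca_fun \<iota> (\<lambda>_. 1) = 1"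
    and \<iota>_dense: "closure (\<iota> ` skew_polys X) = UNIV"
    and closed_CX: "closed (tca_fun \<iota> ` {f. continuous_on X f})"
    and E0_hom: "complex_algebra_hom_on UNIV E0"
    and E0_range: "range E0 \<subseteq> tca_fun \<iota> ` {f. continuous_on X f}"
    and E0_id: "\<And>f. continuous_on X f \<Longrightarrow> E0 (tca_fun \<iota> f) = tca_fun \<iota> f"
    and E0_kernel: "{a. E0 a = 0} = range (\<lambda>a. a * tca_U \<iota>)"
    and U_not_right_zero_divisor: "\<And>a. a * tca_U \<iota> = 0 \<Longrightarrow> a = 0"
    and growth: "limsup (\<lambda>n. ereal (root n
          (onorm (coeff_map E0 (tca_U \<iota>) n) * norm (tca_U \<iota> ^ n)))) \<le> 1"

definition tca_subalgebra ::
    "'x::t2_space set \<Rightarrow> ((nat \<Rightarrow> 'x \<Rightarrow> complex) \<Rightarrow> 'a::complex_banach_algebra) \<Rightarrow>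
     ('x \<Rightarrow> complex) set \<Rightarrow> 'a set" where
  "tca_subalgebra X \<iota> S =
     (\<lambda>B. closed B \<and> complex_subalgebra B) hull (\<iota> ` {p \<in> skew_polys X. \<forall>n. p n \<in> S})"

definition jordan_curve :: "complex set \<Rightarrow> bool" where
  "jordan_curve C \<longleftrightarrow> (\<exists>g. simple_path g \<and> pathfinish g = pathstart g \<and> path_image g = C)"

definition bounded_cauchy_domain :: "complex set \<Rightarrow> bool" where
  "bounded_cauchy_domain G \<longleftrightarrow>
     G \<noteq> {} \<and> bounded G \<and> open G \<and> connected G \<and>
     (\<exists>\<J>. finite \<J> \<and> (\<forall>C\<in>\<J>. jordan_curve C) \<and> pairwise disjnt \<J> \<and> frontier G = \<Union>\<J>)"

definition class_K :: "complex set set" where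
  "class_K = closure ` {G. bounded_cauchy_domain G}"

definition A_alg :: "complex set \<Rightarrow> (complex \<Rightarrow> complex) set" where
  "A_alg K = {f. continuous_on K f \<and> f holomorphic_on interior K}"

definition analytically_conjugate ::
    "complex set \<Rightarrow> (complex \<Rightarrow> complex) \<Rightarrow> complex set \<Rightarrow> (complex \<Rightarrow> complex) \<Rightarrow> bool" where
  "analytically_conjugate K1 \<eta>1 K2 \<eta>2 \<longleftrightarrow>
     (\<exists>\<gamma> \<gamma>'. homeomorphism K1 K2 \<gamma> \<gamma>' \<and> \<gamma> holomorphic_on interior K1 \<and>
        (\<forall>z\<in>K1. \<gamma> (\<eta>1 z) = \<eta>2 (\<gamma> z)))"

end

theory Submission
  imports Defs
begin

text \<open>
  A character of \<open>\<A>(A(K))\<close> is determined by its values \<open>x\<close> on the coordinate function and \<open>z\<close> on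
  \<open>U\<close>. Here \<open>x \<in> K\<close>, because every character of \<open>A(K)\<close> is an evaluation, and \<open>z \<noteq> 0\<close> forces
  \<open>\<eta> x = x\<close>. Conversely \<open>(x, 0)\<close> always occurs, and over a fixed point \<open>x\<close> the power series
  \<open>\<Sum>n. E\<^sub>n(a)(x) z\<^sup>n\<close> is a character for \<open>\<bar>z\<bar>\<close> below \<open>r = inf\<^sub>n \<parallel>U\<^sup>n\<parallel>\<^bsup>1/n\<^esup>\<close>, whereas no
  character has \<open>\<bar>z\<bar> > r\<close>. An isomorphism induces a bijection \<open>F = (\<gamma>, \<mu>)\<close> of the character spaces,
  analytic in \<open>x\<close> and in \<open>z\<close>.

  If \<open>F\<close> and its inverse preserve the zero sections, then \<open>\<gamma>\<close> is a homeomorphism and applying \<open>E\<^sub>1\<close>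
  to the image of \<open>U f = (f \<circ> \<eta>) U\<close> shows that it is a conjugacy. Otherwise, unless both maps are the
  identity, the zero section of each side is carried into the disc over a single fixed point of the
  other side; this identifies both \<open>K\<^sub>i\<close> with discs, and as \<open>f \<mapsto> E\<^sub>1(\<Phi> f)\<close> is then a point
  derivation, the same relation shows that \<open>\<eta>\<^sub>1\<close> and \<open>\<eta>\<^sub>2\<close> become rotations inverse to one
  another. If both maps are the identity, then \<open>F\<close> is a biholomorphic map of \<open>K\<^sub>2\<^sup>\<circ> \<times> D\<^sub>2\<close> onto
  \<open>K\<^sub>1\<^sup>\<circ> \<times> D\<^sub>1\<close>. Over a boundary point of \<open>K\<^sub>2\<close> one of \<open>\<gamma>\<close>, \<open>\<mu>\<close> does not depend on \<open>z\<close>, and by the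
  maximum principle one of them does not depend on \<open>z\<close> at all: either \<open>\<gamma>\<close> is the desired map, or
  \<open>F\<close> interchanges the two factors and both \<open>K\<^sub>i\<close> are discs.
\<close>

section \<open>Closed graphs and characters of Banach algebras\<close>

text \<open>Baire's theorem makes the closure of some sublevel set \<open>A n\<close> contain a
  ball. Differences and scaling then approximate every vector by vectors whose images have
  controlled norm. Successive corrections give a series for \<open>x\<close> whose images converge
  absolutely, and the closed graph identifies their sum with \<open>T x\<close>.\<close>

lemma closed_graph_theorem:
  fixes T :: "'a::banach \<Rightarrow> 'b::banach"
  assumes lin: "linear T"
    and graph: "\<And>X x y. X \<longlonglongrightarrow> x \<Longrightarrow> (\<lambda>n. T (X n)) \<longlonglongrightarrow> y \<Longrightarrow> T x = y"
  shows "bounded_linear T"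
proof -
  interpret linear T by fact
  define A where "A n = {x. norm (T x) \<le> real n}" for n :: nat
  have "\<exists>n. interior (closure (A n)) \<noteq> {}"
  proof (rule ccontr)
    assume "\<not> ?thesis"
    then have int: "interior (closure (A n)) = {}" for n
      by blast
    have "Met_TC.mtopology interior_of \<Union> (range (\<lambda>n. closure (A n))) = {}"
    proof (rule Met_TC.metric_Baire_category_alt)
      show "Met_TC.mcomplete TYPE('a)"
        by (simp only: mcomplete_iff_complete complete_UNIV)
      show "countable (range (\<lambda>n. closure (A n)))"
        by simp
      fix S assume "S \<in> range (\<lambda>n. closure (A n))"
      then obtain n where "S = closure (A n)"
        by blast
      then show "closedin Met_TC.mtopology S \<and> Met_TC.mtopology interior_of S = {}"
        by (simp only: mtopology_is_euclidean closed_closedin[symmetric] closed_closure euclidean_interior_of int)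
    qed
    then have "interior (\<Union> (range (\<lambda>n. closure (A n)))) = {}"
      by (simp only: mtopology_is_euclidean euclidean_interior_of)
    moreover have "\<Union> (range (\<lambda>n. closure (A n))) = UNIV"
    proof -
      have "x \<in> A (nat \<lceil>norm (T x)\<rceil>)" for x
        by (auto simp: A_def)
      then show ?thesis
        using closure_subset by blast
    qed
    ultimately show False
      by simp
  qed
  then obtain n a where "a \<in> interior (closure (A n))"
    by auto
  then obtain e where "e > 0" and e: "ball a e \<subseteq> closure (A n)"
    by (meson mem_interior)
  \<comment> \<open>Points of \<open>A n\<close> close to \<open>a + v\<close> and to
    \<open>a\<close> differ by almost \<open>v\<close>; the difference costs a factor two in the
    bound.\<close>
  have near0: "\<exists>u. norm (T u) \<le> 2 * real n \<and> norm (v - u) < d" if "norm v < e" "d > 0" for v d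
  proof -
    have "a \<in> closure (A n)" "a + v \<in> closure (A n)"
      using e that(1) \<open>e > 0\<close> by (auto simp: subset_iff dist_norm)
    then obtain p q where p: "p \<in> A n" "dist p a < d/2" and q: "q \<in> A n" "dist q (a + v) < d/2"
      by (meson closure_approachable half_gt_zero \<open>d > 0\<close>)
    have "norm (T (q - p)) \<le> norm (T q) + norm (T p)"
      by (simp add: diff norm_triangle_ineq4)
    also have "\<dots> \<le> 2 * real n"
      using p q by (simp add: A_def)
    finally have "norm (T (q - p)) \<le> 2 * real n" .
    moreover have "norm (v - (q - p)) < d"
    proof -
      have "norm ((p - a) - (q - (a + v))) \<le> norm (p - a) + norm (q - (a + v))"
        by (rule norm_triangle_ineq4)
      also have "\<dots> < d"
        using p q by (simp add: dist_norm)
      finally show ?thesis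
        by (simp add: algebra_simps)
    qed
    ultimately show ?thesis by blast
  qed
  define M where "M = 4 * real n / e"
  have M: "M \<ge> 0"
    using \<open>e > 0\<close> by (simp add: M_def)
  have near: "\<exists>u. norm (T u) \<le> M * norm v \<and> norm (v - u) < d" if "d > 0" for v d
  proof (cases "v = 0")
    case True
    then show ?thesis
      using that by (intro exI[of _ 0]) (simp add: zero)
  next
    case False
    define s where "s = e / (2 * norm v)"
    have s: "s > 0"
      using False \<open>e > 0\<close> by (simp add: s_def)
    have "norm (s *\<^sub>R v) < e"
      using False \<open>e > 0\<close> by (simp add: s_def)
    moreover have "s * d > 0"
      using s that by simp
    ultimately obtain u where u: "norm (T u) \<le> 2 * real n" "norm (s *\<^sub>R v - u) < s * d"
      using near0 by blast
    have "norm (T (u /\<^sub>R s)) \<le> M * norm v"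
      using u(1) s False \<open>e > 0\<close> by (simp add: scale s_def M_def field_simps)
    moreover have "norm (v - u /\<^sub>R s) < d"
    proof -
      have "v - u /\<^sub>R s = (s *\<^sub>R v - u) /\<^sub>R s"
        using s by (simp add: algebra_simps)
      then have "norm (v - u /\<^sub>R s) = norm (s *\<^sub>R v - u) / s"
        using s by (simp only: norm_scaleR) (simp add: field_simps)
      also have "\<dots> < d"
        using u(2) s by (simp add: pos_divide_less_eq mult.commute)
      finally show ?thesis .
    qed
    ultimately show ?thesis by blast
  qed
  have "norm (T x) \<le> norm x * (2 * M)" for x
  proof (cases "x = 0")
    case True
    then show ?thesis by (simp add: zero)
  next
    case False
    define u where "u v d = (SOME u. norm (T u) \<le> M * norm v \<and> norm (v - u) < d)" for v d
    have u: "norm (T (u v d)) \<le> M * norm v" "norm (v - u v d) < d" if "d > 0" for v d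
      using someI_ex[OF near[OF that, of v]] by (auto simp: u_def)
    \<comment> \<open>\<open>v k\<close> is the remainder after \<open>k\<close> corrections and
      \<open>w k\<close> the next correction. The bound on the remainder halves each time, so the
      images of the corrections are dominated by a geometric series.\<close>
    define v where "v = rec_nat x (\<lambda>k w. w - u w (norm x / 2 ^ Suc k))"
    define w where "w k = u (v k) (norm x / 2 ^ Suc k)" for k
    have v0: "v 0 = x" and vS: "v (Suc k) = v k - w k" for k
      by (simp_all add: v_def w_def)
    have vn: "norm (v k) \<le> norm x / 2 ^ k" for k
    proof (cases k)
      case (Suc j)
      then show ?thesis
        using u(2)[of "norm x / 2 ^ Suc j" "v j"] False by (simp add: vS w_def)
    qed (simp add: v0)
    have Tw: "norm (T (w k)) \<le> M * norm x * (1/2) ^ k" for k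
    proof -
      have "norm (T (w k)) \<le> M * norm (v k)"
        unfolding w_def by (rule u) (use False in simp)
      also have "\<dots> \<le> M * (norm x / 2 ^ k)"
        by (intro mult_left_mono vn M)
      finally show ?thesis
        by (simp add: power_divide)
    qed
    have geo: "(\<lambda>k. M * norm x * (1/2) ^ k) sums (M * norm x * 2)"
      using sums_mult[OF geometric_sums[of "1/2::real"], of "M * norm x"] by simp
    have sm: "summable (\<lambda>k. norm (T (w k)))"
      using Tw by (intro summable_comparison_test'[OF sums_summable[OF geo], of 0]) auto
    have part: "(\<Sum>k<m. w k) = x - v m" for m
      by (induction m) (simp_all add: v0 vS)
    have "v \<longlonglongrightarrow> 0"
    proof (rule Lim_null_comparison)
      show "(\<lambda>k. norm x * (1/2) ^ k) \<longlonglongrightarrow> 0"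
        by (intro tendsto_mult_right_zero LIMSEQ_power_zero) simp
    qed (use vn in \<open>auto simp: power_divide\<close>)
    then have "(\<lambda>m. \<Sum>k<m. w k) \<longlonglongrightarrow> x"
      unfolding part using tendsto_diff[OF tendsto_const[of x]] by force
    moreover have "(\<lambda>m. T (\<Sum>k<m. w k)) \<longlonglongrightarrow> (\<Sum>k. T (w k))"
      using summable_norm_cancel[OF sm] by (simp add: sum summable_LIMSEQ)
    ultimately have "T x = (\<Sum>k. T (w k))"
      by (rule graph)
    also have "norm \<dots> \<le> (\<Sum>k. norm (T (w k)))"
      by (rule summable_norm[OF sm])
    also have "\<dots> \<le> M * norm x * 2"
      using suminf_le[OF Tw sm sums_summable[OF geo]] sums_unique[OF geo] by simp
    finally show ?thesis by (simp add: mult_ac)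
  qed
  then show ?thesis
    by (rule bounded_linear_intro[where f = T, OF add scale])
qed

section \<open>Subalgebras, Neumann series and automatic continuity of characters\<close>

lemma scaleC_zero_left [simp]: "0 *\<^sub>C (x::'a::complex_banach_algebra) = 0"
  using scaleC_add_left[of 0 0 x] by simp

lemma scaleC_minus_one: "(- 1) *\<^sub>C (x::'a::complex_banach_algebra) = - x"
  using scaleC_of_real[of "-1" x] by simp

lemma bounded_linear_scaleC: "bounded_linear (\<lambda>x::'a::complex_banach_algebra. c *\<^sub>C x)"
proof (rule bounded_linear_intro[where K = "norm c"])
  show "c *\<^sub>C (r *\<^sub>R x) = r *\<^sub>R (c *\<^sub>C x)" for r and x :: 'a
    by (simp add: scaleC_scaleC mult.commute flip: scaleC_of_real)
qed (auto simp: scaleC_add_right norm_scaleC mult.commute)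

lemma complex_subalgebra_uminus: "complex_subalgebra B \<Longrightarrow> x \<in> B \<Longrightarrow> - x \<in> B"
  by (metis complex_subalgebra_def scaleC_minus_one)

lemma complex_subalgebra_diff: "complex_subalgebra B \<Longrightarrow> x \<in> B \<Longrightarrow> y \<in> B \<Longrightarrow> x - y \<in> B"
  by (metis complex_subalgebra_def complex_subalgebra_uminus diff_conv_add_uminus)

lemma complex_subalgebra_sum:
  "complex_subalgebra B \<Longrightarrow> (\<And>i. i \<in> I \<Longrightarrow> f i \<in> B) \<Longrightarrow> sum f I \<in> B"
  by (induction I rule: infinite_finite_induct) (auto simp: complex_subalgebra_def)

lemma complex_subalgebra_power:
  "complex_subalgebra B \<Longrightarrow> 1 \<in> B \<Longrightarrow> x \<in> B \<Longrightarrow> x ^ n \<in> B"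
  by (induction n) (auto simp: complex_subalgebra_def)

lemma complex_subalgebra_closure:
  assumes "complex_subalgebra B"
  shows "complex_subalgebra (closure B)"
proof -
  have B: "0 \<in> B" "x \<in> B \<Longrightarrow> y \<in> B \<Longrightarrow> x + y \<in> B" "x \<in> B \<Longrightarrow> c *\<^sub>C x \<in> B"
      "x \<in> B \<Longrightarrow> y \<in> B \<Longrightarrow> x * y \<in> B" for x y c
    using assms by (auto simp: complex_subalgebra_def)
  show ?thesis
    unfolding complex_subalgebra_def
  proof (intro conjI ballI allI)
    show "0 \<in> closure B"
      using B closure_subset by blast
    fix x y c assume "x \<in> closure B" "y \<in> closure B"
    then obtain X Y where "\<And>n::nat. X n \<in> B" "X \<longlonglongrightarrow> x" "\<And>n::nat. Y n \<in> B" "Y \<longlonglongrightarrow> y"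
      by (auto simp: closure_sequential)
    then show "x + y \<in> closure B" "x * y \<in> closure B"
      unfolding closure_sequential
      by (intro exI[of _ "\<lambda>n. X n + Y n"] exI[of _ "\<lambda>n. X n * Y n"] conjI allI B tendsto_intros; simp)+
  next
    fix x c assume "x \<in> closure B"
    then obtain X where "\<And>n::nat. X n \<in> B" "X \<longlonglongrightarrow> x"
      by (auto simp: closure_sequential)
    then show "c *\<^sub>C x \<in> closure B"
      unfolding closure_sequential
      by (intro exI[of _ "\<lambda>n. c *\<^sub>C X n"] conjI allI B
          bounded_linear.tendsto[OF bounded_linear_scaleC]; simp)
  qed
qed

text \<open>The partial sums of the geometric series stay in the closed subalgebra, so the inverse
  is found in \<open>B\<close> itself. The factor \<open>norm 1\<close> in the estimate of the
  powers appears because the norm of the unit is not normalised.\<close>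

lemma neumann_inverse:
  fixes x :: "'a::complex_banach_algebra"
  assumes B: "complex_subalgebra B" "closed B" "1 \<in> B" and x: "x \<in> B" "norm x < 1"
  shows "\<exists>y\<in>B. (1 - x) * y = 1"
proof -
  have npow: "norm (x ^ n) \<le> norm (1::'a) * norm x ^ n" for n
  proof (induction n)
    case (Suc n)
    have "norm (x ^ Suc n) \<le> norm x * norm (x ^ n)"
      by (simp add: norm_mult_ineq)
    also have "\<dots> \<le> norm x * (norm (1::'a) * norm x ^ n)"
      by (intro mult_left_mono Suc) simp
    finally show ?case by (simp add: mult_ac)
  qed simp
  have "summable (\<lambda>n. norm (1::'a) * norm x ^ n)"
    using x by (intro summable_mult summable_geometric) simp
  then have sm: "summable (\<lambda>n. norm (x ^ n))"
    by (rule summable_comparison_test'[of _ 0]) (use npow in simp)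
  define y where "y = (\<Sum>n. x ^ n)"
  have lim: "(\<lambda>m. \<Sum>n<m. x ^ n) \<longlonglongrightarrow> y"
    unfolding y_def using summable_norm_cancel[OF sm] by (rule summable_LIMSEQ)
  have "y \<in> B"
    using closed_sequentially[OF B(2) _ lim] x(1) B
    by (simp add: complex_subalgebra_sum complex_subalgebra_power)
  moreover have "(1 - x) * y = 1"
  proof -
    have eq: "(1 - x) * (\<Sum>n<m. x ^ n) = 1 - x ^ m" for m
    proof (induction m)
      case (Suc m)
      have "(1 - x) * (\<Sum>n<Suc m. x ^ n) = (1 - x) * (\<Sum>n<m. x ^ n) + (1 - x) * x ^ m"
        by (simp add: distrib_left)
      also have "\<dots> = (1 - x ^ m) + (x ^ m - x * x ^ m)"
        by (simp only: Suc) (simp only: left_diff_distrib mult_1_left)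
      finally show ?case
        by (simp only: power_Suc diff_add_cancel add_diff_eq)
    qed simp
    have "(\<lambda>m. (1 - x) * (\<Sum>n<m. x ^ n)) \<longlonglongrightarrow> (1 - x) * y"
      by (rule tendsto_mult_left[OF lim])
    then have lim1: "(\<lambda>m. 1 - x ^ m) \<longlonglongrightarrow> (1 - x) * y"
      unfolding eq .
    have "(\<lambda>m. x ^ m) \<longlonglongrightarrow> 0"
      by (rule tendsto_norm_zero_cancel[OF summable_LIMSEQ_zero[OF sm]])
    then have "(\<lambda>m. 1 - x ^ m) \<longlonglongrightarrow> 1 - 0"
      by (rule tendsto_diff[OF tendsto_const])
    with lim1 have "(1 - x) * y = 1 - 0"
      by (rule LIMSEQ_unique)
    then show ?thesis by simp
  qed
  ultimately show ?thesis by blast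
qed

lemma LIMSEQ_norm_diff_le:
  fixes f :: "nat \<Rightarrow> 'a::real_normed_vector" and g :: "nat \<Rightarrow> 'b::real_normed_vector"
  assumes "\<And>n. norm (f n - l) \<le> norm (g n - m)" "g \<longlonglongrightarrow> m"
  shows "f \<longlonglongrightarrow> l"
proof (rule LIM_zero_cancel, rule Lim_null_comparison)
  show "\<forall>\<^sub>F n in sequentially. norm (f n - l) \<le> norm (g n - m)"
    using assms(1) by simp
  show "(\<lambda>n. norm (g n - m)) \<longlonglongrightarrow> 0"
    by (rule tendsto_norm_zero[OF LIM_zero[OF assms(2)]])
qed

text \<open>Nothing is required off \<open>B\<close>, so a character of the whole algebra restricts
  without change. The condition \<open>\<theta> 1 = 1\<close> excludes the zero functional;
  continuity is not demanded.\<close>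

definition character_on :: "'a::complex_banach_algebra set \<Rightarrow> ('a \<Rightarrow> complex) \<Rightarrow> bool" where
  "character_on B \<theta> \<longleftrightarrow> \<theta> 1 = 1 \<and> (\<forall>x\<in>B. \<forall>y\<in>B. \<theta> (x + y) = \<theta> x + \<theta> y) \<and>
     (\<forall>c. \<forall>x\<in>B. \<theta> (c *\<^sub>C x) = c * \<theta> x) \<and> (\<forall>x\<in>B. \<forall>y\<in>B. \<theta> (x * y) = \<theta> x * \<theta> y)"

lemma character_on_diff:
  assumes "character_on B \<theta>" "complex_subalgebra B" "x \<in> B" "y \<in> B"
  shows "\<theta> (x - y) = \<theta> x - \<theta> y"
proof -
  have "- y \<in> B"
    using assms complex_subalgebra_uminus by blast
  then have "\<theta> (x + - y) = \<theta> x + \<theta> (- y)"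
    using assms(1,3) unfolding character_on_def by blast
  moreover have "\<theta> ((- 1) *\<^sub>C y) = - 1 * \<theta> y"
    using assms(1,4) unfolding character_on_def by blast
  ultimately show ?thesis
    by (simp add: scaleC_minus_one)
qed

lemma character_on_sum:
  assumes "character_on B \<theta>" "complex_subalgebra B" "\<And>i. i \<in> I \<Longrightarrow> f i \<in> B"
  shows "\<theta> (sum f I) = (\<Sum>i\<in>I. \<theta> (f i))"
proof -
  have "\<theta> 0 = 0"
    using character_on_diff[OF assms(1,2), of 0 0] assms(2) by (simp add: complex_subalgebra_def)
  then show ?thesis
    using assms(3)
    by (induction I rule: infinite_finite_induct)
      (use assms(1,2) in \<open>auto simp: character_on_def complex_subalgebra_sum\<close>)
qed

lemma character_on_power:
  assumes "character_on B \<theta>" "complex_subalgebra B" "1 \<in> B" "x \<in> B"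
  shows "\<theta> (x ^ n) = \<theta> x ^ n"
  using assms by (induction n) (auto simp: character_on_def complex_subalgebra_power)

text \<open>If the estimate failed, \<open>1 - x / \<theta> x\<close> would be invertible in
  \<open>B\<close> by the Neumann series, yet \<open>\<theta>\<close> sends it to zero. This is the
  source of continuity for a purely algebraic isomorphism.\<close>

lemma character_on_norm_le:
  assumes \<theta>: "character_on B \<theta>" and B: "complex_subalgebra B" "closed B" "1 \<in> B" and x: "x \<in> B"
  shows "norm (\<theta> x) \<le> norm x"
proof (rule ccontr)
  assume *: "\<not> ?thesis"
  define c where "c = \<theta> x"
  have c: "c \<noteq> 0" "norm x < norm c"
    using * by (auto simp: c_def)
  have xB: "inverse c *\<^sub>C x \<in> B"
    using B x by (simp add: complex_subalgebra_def)
  have "norm (inverse c *\<^sub>C x) < 1"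
    using c by (simp add: norm_scaleC norm_inverse mult.commute flip: divide_inverse)
  then obtain y where y: "y \<in> B" "(1 - inverse c *\<^sub>C x) * y = 1"
    using neumann_inverse[OF B xB] by blast
  have "\<theta> 1 = \<theta> (1 - inverse c *\<^sub>C x) * \<theta> y"
    using \<theta> y complex_subalgebra_diff[OF B(1,3) xB] by (metis character_on_def)
  also have "\<theta> (1 - inverse c *\<^sub>C x) = 0"
    using c(1) \<theta> x by (simp add: character_on_diff[OF \<theta> B(1,3) xB] character_on_def flip: c_def)
  finally show False
    using \<theta> by (simp add: character_on_def)
qed

lemma character_on_eq_closure:
  assumes \<theta>: "character_on B \<theta>" "character_on B \<phi>"
    and B: "complex_subalgebra B" "closed B" "1 \<in> B" and "P \<subseteq> B" "x \<in> B" "x \<in> closure P"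
    and eq: "\<And>p. p \<in> P \<Longrightarrow> \<theta> p = \<phi> p"
  shows "\<theta> x = \<phi> x"
proof -
  obtain X where X: "\<And>n::nat. X n \<in> P" "X \<longlonglongrightarrow> x"
    using \<open>x \<in> closure P\<close> by (auto simp: closure_sequential)
  have lim: "(\<lambda>n. \<psi> (X n)) \<longlonglongrightarrow> \<psi> x" if "character_on B \<psi>" for \<psi>
  proof (rule LIMSEQ_norm_diff_le[OF _ X(2)])
    show "norm (\<psi> (X n) - \<psi> x) \<le> norm (X n - x)" for n
      using character_on_norm_le[OF that B complex_subalgebra_diff[OF B(1), of "X n" x]]
        character_on_diff[OF that B(1), of "X n" x] X \<open>P \<subseteq> B\<close> \<open>x \<in> B\<close> by auto
  qed
  show ?thesis
    using lim[OF \<theta>(1)] lim[OF \<theta>(2)] eq X(1) by (simp add: LIMSEQ_unique)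
qed

section \<open>Cauchy domains and the algebra A(K)\<close>

text \<open>A boundary point of \<open>G\<close> lies on one of the Jordan curves. The connected set
  \<open>G\<close> lies on one side of this curve, and the other side serves as \<open>W\<close>.
  Such a connected set touching the boundary point from outside is what the approximate units below
  are built from.\<close>

lemma class_K_D:
  assumes "K \<in> class_K"
  shows "compact K" "connected (interior K)" "interior K \<noteq> {}" "closure (interior K) = K"
    "\<And>z. z \<in> K \<Longrightarrow> z \<notin> interior K \<Longrightarrow>
       \<exists>W. open W \<and> connected W \<and> W \<inter> K = {} \<and> z \<in> closure W"
proof -
  obtain G \<J> where G: "K = closure G" "G \<noteq> {}" "bounded G" "open G" "connected G"
    and J: "\<And>C. C \<in> \<J> \<Longrightarrow> jordan_curve C" "frontier G = \<Union>\<J>"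
    using assms by (auto simp: class_K_def bounded_cauchy_domain_def)
  have side: "\<exists>W. open W \<and> connected W \<and> W \<inter> K = {} \<and> z \<in> closure W"
    if z: "z \<in> frontier G" for z
  proof -
    obtain C where C: "C \<in> \<J>" "z \<in> C"
      using J(2) z by auto
    then obtain g where g: "simple_path g" "pathfinish g = pathstart g" "path_image g = C"
      using J(1) by (auto simp: jordan_curve_def)
    note IO = Jordan_inside_outside[OF g(1,2), unfolded g(3)]
    have "G \<inter> frontier G = {}"
      using \<open>open G\<close> by (simp add: frontier_def interior_open)
    then have GC: "G \<inter> C = {}"
      using J(2) C by blast
    have "G \<subseteq> inside C \<or> G \<subseteq> outside C"
    proof -
      have "G \<subseteq> inside C \<union> outside C"
        using IO GC by blast
      then show ?thesis
        using connectedD[OF \<open>connected G\<close>, of "inside C" "outside C"] IO by blast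
    qed
    then have "\<exists>W. open W \<and> connected W \<and> W \<inter> G = {} \<and> frontier W = C"
    proof
      assume "G \<subseteq> inside C"
      then show ?thesis
        using inside_Int_outside[of C] IO by (intro exI[of _ "outside C"] conjI) blast+
    next
      assume "G \<subseteq> outside C"
      then show ?thesis
        using inside_Int_outside[of C] IO by (intro exI[of _ "inside C"] conjI) blast+
    qed
    then obtain W where W: "open W" "connected W" "W \<inter> G = {}" "frontier W = C"
      by auto
    then have "W \<inter> K = {}"
      unfolding G(1) using open_Int_closure_eq_empty by blast
    then show ?thesis
      using W C by (auto simp: frontier_def)
  qed
  \<comment> \<open>A boundary point is a limit of points of some \<open>W\<close> off
    \<open>K\<close>. Hence passing to the closure creates no new interior points, and
    \<open>interior K\<close> is \<open>G\<close> again.\<close>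
  have "interior K \<inter> frontier G = {}"
  proof (rule ccontr)
    assume "\<not> ?thesis"
    then obtain z where z: "z \<in> interior K" "z \<in> frontier G" by blast
    then obtain W where "W \<inter> K = {}" "z \<in> closure W"
      using side by blast
    then show False
      using z(1) closure_iff_nhds_not_empty[of z W] interior_subset
      by (metis Int_commute open_interior disjoint_iff subsetD)
  qed
  moreover have "interior K \<subseteq> G \<union> frontier G" "G \<subseteq> interior K"
    using G interior_subset[of K] closure_Un_frontier[of G] interior_maximal[OF closure_subset \<open>open G\<close>]
    by auto
  ultimately have int: "interior K = G"
    by blast
  show "compact K" "connected (interior K)" "interior K \<noteq> {}" "closure (interior K) = K"
    using G unfolding int by auto
  show "\<exists>W. open W \<and> connected W \<and> W \<inter> K = {} \<and> z \<in> closure W"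
    if "z \<in> K" "z \<notin> interior K" for z
    using side[of z] that int G by (simp add: frontier_def interior_open)
qed

section \<open>Closure properties, identity theorem and maximum principle for A(K)\<close>

lemma A_algI: "continuous_on K f \<Longrightarrow> f holomorphic_on interior K \<Longrightarrow> f \<in> A_alg K"
  and A_alg_continuous: "f \<in> A_alg K \<Longrightarrow> continuous_on K f"
  and A_alg_holomorphic: "f \<in> A_alg K \<Longrightarrow> f holomorphic_on interior K"
  by (auto simp: A_alg_def)

lemma A_alg_const [simp]: "(\<lambda>_. c) \<in> A_alg K"
  and A_alg_id [simp]: "(\<lambda>z. z) \<in> A_alg K"
  and A_alg_add: "f \<in> A_alg K \<Longrightarrow> g \<in> A_alg K \<Longrightarrow> (\<lambda>z. f z + g z) \<in> A_alg K"
  and A_alg_diff: "f \<in> A_alg K \<Longrightarrow> g \<in> A_alg K \<Longrightarrow> (\<lambda>z. f z - g z) \<in> A_alg K"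
  and A_alg_mult: "f \<in> A_alg K \<Longrightarrow> g \<in> A_alg K \<Longrightarrow> (\<lambda>z. f z * g z) \<in> A_alg K"
  by (auto simp: A_alg_def intro!: continuous_intros holomorphic_intros)

lemma A_alg_inverse: "f \<in> A_alg K \<Longrightarrow> (\<And>z. z \<in> K \<Longrightarrow> f z \<noteq> 0) \<Longrightarrow> (\<lambda>z. inverse (f z)) \<in> A_alg K"
  using interior_subset[of K] by (auto simp: A_alg_def intro!: continuous_intros holomorphic_intros)

lemma A_alg_sum: "(\<And>i. i \<in> I \<Longrightarrow> f i \<in> A_alg K) \<Longrightarrow> (\<lambda>z. \<Sum>i\<in>I. f i z) \<in> A_alg K"
  by (induction I rule: infinite_finite_induct) (auto simp: A_alg_add)

lemma A_alg_uniform_limit: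
  assumes f: "\<And>n::nat. f n \<in> A_alg K" and lim: "uniform_limit K f g sequentially"
  shows "g \<in> A_alg K"
proof (rule A_algI)
  show "continuous_on K g"
    using f by (intro uniform_limit_theorem[OF _ lim]) (auto simp: A_alg_def)
  show "g holomorphic_on interior K"
  proof (rule holomorphic_uniform_sequence[where f = f])
    fix x assume "x \<in> interior K"
    then obtain d where d: "d > 0" "cball x d \<subseteq> interior K"
      by (meson open_contains_cball open_interior)
    then show "\<exists>d>0. cball x d \<subseteq> interior K \<and> uniform_limit (cball x d) f g sequentially"
      using uniform_limit_on_subset[OF lim] interior_subset by (metis order_trans)
  qed (use f in \<open>auto simp: A_alg_def\<close>)
qed

lemma holomorphic_into_closed_cases:
  assumes f: "f holomorphic_on S" "open S" "connected S" and "f ` S \<subseteq> T"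
  shows "f constant_on S \<or> f ` S \<subseteq> interior T"
  using open_mapping_thm[OF f f(2) order_refl] assms(4) by (meson interior_maximal)

text \<open>Outside the interior of \<open>L\<close> the function \<open>f\<close> is merely
  continuous, so interior points that \<open>g\<close> maps to the boundary need care. By the open
  mapping theorem they occur only if \<open>g\<close> is constant.\<close>

lemma A_alg_compose:
  assumes K: "K \<in> class_K" and g: "g \<in> A_alg K" "g ` K \<subseteq> L" and f: "f \<in> A_alg L"
  shows "(\<lambda>z. f (g z)) \<in> A_alg K"
proof (rule A_algI)
  show "continuous_on K (\<lambda>z. f (g z))"
    using g f by (auto simp: A_alg_def intro: continuous_on_compose2)
  have g': "g ` interior K \<subseteq> L"
    using g(2) interior_subset by blast
  show "(\<lambda>z. f (g z)) holomorphic_on interior K"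
    using holomorphic_into_closed_cases[OF A_alg_holomorphic[OF g(1)] open_interior class_K_D(2)[OF K] g']
  proof
    assume "g constant_on interior K"
    then obtain c where "\<And>z. z \<in> interior K \<Longrightarrow> g z = c"
      by (auto simp: constant_on_def)
    then show ?thesis
      using holomorphic_transform[OF holomorphic_on_const[of "f c"]] by simp
  next
    assume "g ` interior K \<subseteq> interior L"
    then show ?thesis
      using holomorphic_on_compose_gen[OF A_alg_holomorphic[OF g(1)] A_alg_holomorphic[OF f]]
      by (simp add: o_def)
  qed
qed

lemma A_alg_eqI:
  assumes K: "K \<in> class_K" and f: "f \<in> A_alg K" "g \<in> A_alg K"
    and eq: "\<And>z. z \<in> interior K \<Longrightarrow> f z = g z" and z: "z \<in> K"
  shows "f z = g z"
proof -
  have "continuous_on (closure (interior K)) (\<lambda>z. f z - g z)"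
    using f by (auto simp: A_alg_def class_K_D(4)[OF K] intro!: continuous_intros)
  then have "f z - g z = 0"
    using continuous_constant_on_closure[of "interior K" "\<lambda>z. f z - g z" 0 z] eq z class_K_D(4)[OF K]
    by simp
  then show ?thesis by simp
qed

lemma A_alg_eq_on_open:
  assumes K: "K \<in> class_K" and f: "f \<in> A_alg K" "g \<in> A_alg K"
    and S: "open S" "S \<noteq> {}" "S \<subseteq> interior K" and eq: "\<And>z. z \<in> S \<Longrightarrow> f z = g z" and z: "z \<in> K"
  shows "f z = g z"
proof (rule A_alg_eqI[OF K f _ z])
  fix w assume w: "w \<in> interior K"
  show "f w = g w"
    by (rule analytic_continuation_open[OF S(1) open_interior S(2) class_K_D(2)[OF K] S(3)
        A_alg_holomorphic[OF f(1)] A_alg_holomorphic[OF f(2)] eq w])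
qed

text \<open>One factor vanishes on the open set where the other does not, and the identity theorem
  on the connected interior spreads this to \<open>K\<close>. So A(K) is an integral domain.\<close>

lemma A_alg_mult_eq_0:
  assumes K: "K \<in> class_K" and f: "f \<in> A_alg K" "g \<in> A_alg K"
    and eq: "\<And>z. z \<in> K \<Longrightarrow> f z * g z = 0"
  shows "(\<forall>z\<in>K. f z = 0) \<or> (\<forall>z\<in>K. g z = 0)"
proof (rule disjCI)
  assume "\<not> (\<forall>z\<in>K. g z = 0)"
  then obtain z where z: "z \<in> interior K" "g z \<noteq> 0"
    using A_alg_eqI[OF K f(2) A_alg_const[of 0]] by blast
  have cont: "continuous_on (interior K) g"
    using f(2) holomorphic_on_imp_continuous_on by (auto simp: A_alg_def)
  define S where "S = interior K \<inter> g -` (- {0})"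
  have "open S" "z \<in> S" "S \<subseteq> interior K"
    unfolding S_def using z by (auto intro!: continuous_open_preimage cont)
  moreover have "f w = 0" if "w \<in> S" for w
    using eq[of w] that interior_subset[of K] by (auto simp: S_def)
  ultimately show "\<forall>z\<in>K. f z = 0"
    using A_alg_eq_on_open[OF K f(1) A_alg_const[of 0], of S] by blast
qed

lemma A_alg_eq_0_frontier:
  assumes K: "K \<in> class_K" and f: "f \<in> A_alg K"
    and eq: "\<And>z. z \<in> K \<Longrightarrow> z \<notin> interior K \<Longrightarrow> f z = 0" and z: "z \<in> K"
  shows "f z = 0"
proof -
  have cK: "compact K"
    using K by (rule class_K_D)
  have "norm (f z) \<le> 0"
  proof (rule maximum_modulus_frontier[of f K])
    show "continuous_on (closure K) f" "f holomorphic_on interior K"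
      using f cK by (auto simp: A_alg_def compact_imp_closed)
    show "norm (f w) \<le> 0" if "w \<in> frontier K" for w
      using eq[of w] that cK by (simp add: frontier_def compact_imp_closed)
  qed (use cK z in \<open>auto intro: compact_imp_bounded\<close>)
  then show ?thesis by simp
qed

section \<open>Characters of A(K)\<close>

lemma holomorphic_on_square_root:
  assumes S: "open S" and w: "continuous_on S w" and g: "g holomorphic_on S"
    and eq: "\<And>z. z \<in> S \<Longrightarrow> w z ^ 2 = g z" and nz: "\<And>z. z \<in> S \<Longrightarrow> g z \<noteq> 0"
  shows "w holomorphic_on S"
proof -
  have "(w has_field_derivative deriv g z / (w z + w z)) (at z)" if z: "z \<in> S" for z
  proof -
    have wz: "w z + w z \<noteq> 0"
      using eq[OF z] nz[OF z] by auto
    have cont: "(w \<longlongrightarrow> w z) (at z)"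
      using w z S by (simp add: continuous_on_eq_continuous_at isCont_def)
    \<comment> \<open>Since \<open>w ^ 2 = g\<close>, the difference quotient of \<open>w\<close> is
      that of \<open>g\<close> divided by \<open>w y + w z\<close>, whose limit
      \<open>w z + w z\<close> is nonzero.\<close>
    have "((\<lambda>y. (g y - g z) / (y - z)) \<longlongrightarrow> deriv g z) (at z)"
      using holomorphic_derivI[OF g S z] by (simp add: has_field_derivative_iff)
    then have lim: "((\<lambda>y. (g y - g z) / (y - z) / (w y + w z)) \<longlongrightarrow> deriv g z / (w z + w z)) (at z)"
      by (intro tendsto_intros cont wz)
    have "\<forall>\<^sub>F y in at z. w y + w z \<noteq> 0"
      by (intro tendsto_imp_eventually_ne[OF tendsto_add[OF cont tendsto_const] wz])
    moreover have "\<forall>\<^sub>F y in at z. y \<in> S"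
      using eventually_at_in_open'[OF S z] .
    ultimately have "\<forall>\<^sub>F y in at z. (g y - g z) / (y - z) / (w y + w z) = (w y - w z) / (y - z)"
    proof eventually_elim
      case (elim y)
      have "g y - g z = (w y - w z) * (w y + w z)"
        using eq[OF z] eq[OF elim(2)] by (simp add: power2_eq_square algebra_simps)
      then show ?case
        using elim(1) by simp
    qed
    from Lim_transform_eventually[OF lim this] show ?thesis
      by (simp add: has_field_derivative_iff)
  qed
  then show ?thesis
    using S by (auto simp: holomorphic_on_open)
qed

text \<open>For a path that need not be closed,
  \<open>exp (2 * pi * \<i> * winding_number h z)\<close> is the quotient of end point minus
  \<open>z\<close> by start point minus \<open>z\<close>. Half the exponent gives a continuous
  square root, which is then holomorphic.\<close>

lemma square_root_cross_ratio_off_path: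
  fixes h :: "real \<Rightarrow> complex"
  assumes h: "path h"
  obtains w where "w holomorphic_on - path_image h"
    "\<And>z. z \<notin> path_image h \<Longrightarrow> w z ^ 2 = (pathfinish h - z) / (pathstart h - z)"
proof
  let ?w = "\<lambda>z. exp (pi * \<i> * winding_number h z)"
  have ends: "pathfinish h - z \<noteq> 0" "pathstart h - z \<noteq> 0" if "z \<notin> path_image h" for z
    using that pathfinish_in_path_image[of h] pathstart_in_path_image[of h] by auto
  show sq: "?w z ^ 2 = (pathfinish h - z) / (pathstart h - z)" if z: "z \<notin> path_image h" for z
    using winding_number_exp_2pi[OF h z] ends[OF z]
    by (simp add: field_simps flip: exp_double)
  show "?w holomorphic_on - path_image h"
  proof (rule holomorphic_on_square_root[where g = "\<lambda>z. (pathfinish h - z) / (pathstart h - z)"])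
    show "open (- path_image h)"
      using h by (simp add: closed_path_image open_Compl)
    have "continuous_on (- path_image h) (winding_number h)"
      using h by (intro continuous_at_imp_continuous_on ballI continuous_at_winding_number) auto
    then show "continuous_on (- path_image h) ?w"
      by (intro continuous_intros)
    show "(\<lambda>z. (pathfinish h - z) / (pathstart h - z)) holomorphic_on - path_image h"
      using ends by (intro holomorphic_intros) auto
  qed (use sq ends in auto)
qed

lemma connected_nonzero_sign:
  fixes f :: "'a::topological_space \<Rightarrow> real"
  assumes "connected S" "continuous_on S f" "\<And>x. x \<in> S \<Longrightarrow> f x \<noteq> 0"
  shows "(\<forall>x\<in>S. f x > 0) \<or> (\<forall>x\<in>S. f x < 0)"
proof (rule ccontr)
  assume "\<not> ?thesis"
  then obtain x y where "x \<in> S" "y \<in> S" "f x \<le> 0" "0 \<le> f y"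
    by (meson not_less)
  moreover have "connected (f ` S)"
    using assms by (intro connected_continuous_image)
  ultimately have "0 \<in> f ` S"
    using connected_iff_interval by blast
  then show False
    using assms(3) by auto
qed

text \<open>Run inside \<open>W\<close> from a point very close to \<open>z0\<close> towards
  \<open>c\<close>, which lies outside the disc of radius \<open>r\<close>, and stop on the boundary
  of the disc.\<close>

lemma path_to_sphere:
  fixes z0 :: complex
  assumes W: "open W" "connected W" "z0 \<in> closure W" and c: "c \<in> W" and r: "0 < r" "r < dist c z0"
  obtains h where "path h" "path_image h \<subseteq> W" "path_image h \<subseteq> cball z0 r"
    "dist (pathstart h) z0 < r / 16" "dist (pathfinish h) z0 = r"
proof -
  obtain a where a: "a \<in> W" "dist a z0 < r / 16"
    using W(3) r by (meson closure_approachable divide_pos_pos zero_less_numeral)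
  obtain g where g: "path g" "path_image g \<subseteq> W" "pathstart g = a" "pathfinish g = c"
    using connected_open_path_connected[OF W(1,2)] c a unfolding path_connected_def by blast
  obtain h where "path h" "pathstart h = pathstart g" "path_image h \<subseteq> path_image g \<inter> cball z0 r"
      "pathfinish h \<in> frontier (cball z0 r)"
    by (rule exists_path_subpath_to_frontier_closed[of "cball z0 r" g])
      (use g a r in \<open>auto simp: dist_commute\<close>)
  then show ?thesis
    using g a by (intro that[of h]) (auto simp: dist_commute)
qed

text \<open>The quotient minus one is \<open>(b - a) / (a - z)\<close>. Since
  \<open>r / 16 \<le> d / 64\<close>, the denominator is at least \<open>63 / 64 * d\<close> in
  modulus, while the numerator is at most \<open>17 / 16 * r\<close>.\<close>

lemma square_root_far_bound:
  fixes a b z z0 :: complex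
  assumes "dist a z0 < r / 16" "dist b z0 = r" "0 < d" "4 * r \<le> d" "d \<le> dist z z0"
  shows "norm ((b - z) / (a - z) - 1) \<le> 2 * r / d"
proof -
  have r: "r > 0"
    using assms(1) zero_le_dist[of a z0] by linarith
  have az: "norm (a - z) \<ge> 63 / 64 * d"
    using assms dist_triangle2[of z z0 a] by (simp add: dist_norm norm_minus_commute)
  have ba: "norm (b - a) \<le> 17 / 16 * r"
    using assms dist_triangle2[of b a z0] by (simp add: dist_norm)
  have nz: "norm (a - z) > 0"
    using az assms by linarith
  have "(b - z) / (a - z) - 1 = (b - a) / (a - z)"
    using nz by (auto simp: field_simps)
  then have "norm ((b - z) / (a - z) - 1) = norm (b - a) / norm (a - z)"
    by (simp add: norm_divide)
  also have "\<dots> \<le> (17 / 16 * r) / (63 / 64 * d)"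
    using az ba assms r by (intro frac_le) auto
  also have "\<dots> \<le> 2 * r / d"
    using assms r by (simp add: field_simps)
  finally show ?thesis .
qed

text \<open>Here the numerator of \<open>(b - a) / (a - z)\<close> is at least
  \<open>15 / 16 * r\<close> and the denominator at most \<open>(4 + 1 / 16) * r\<close>. The gap
  from \<open>1\<close> later keeps \<open>w + 1\<close> away from zero near
  \<open>z0\<close>.\<close>

lemma square_root_near_bound:
  fixes a b z z0 :: complex
  assumes "dist a z0 < r / 16" "dist b z0 = r" "dist z z0 \<le> 4 * r" "z \<noteq> a"
  shows "norm ((b - z) / (a - z) - 1) \<ge> 3 / 13"
proof -
  have r: "r > 0"
    using assms(1) zero_le_dist[of a z0] by linarith
  have az: "norm (a - z) \<le> 65 / 16 * r"
    using assms dist_triangle2[of a z z0] by (simp add: dist_norm)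
  have ba: "norm (b - a) \<ge> 15 / 16 * r"
    using assms dist_triangle[of b z0 a] by (simp add: dist_norm norm_minus_commute)
  have nz: "norm (a - z) > 0"
    using assms by simp
  have "3 / 13 = (15 / 16 * r) / (65 / 16 * r)"
    using r by simp
  also have "\<dots> \<le> norm (b - a) / norm (a - z)"
    using az ba nz r by (intro frac_le) auto
  also have "\<dots> = norm ((b - z) / (a - z) - 1)"
    using nz by (simp add: field_simps flip: norm_divide)
  finally show ?thesis .
qed

lemma Re_nonzero_of_square:
  fixes w :: complex
  assumes "norm (w ^ 2 - 1) < 1"
  shows "Re w \<noteq> 0"
proof
  assume "Re w = 0"
  then have "Re (w ^ 2 - 1) \<le> - 1"
    by (simp add: power2_eq_square)
  then show False
    using assms abs_Re_le_cmod[of "w ^ 2 - 1"] by linarith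
qed

text \<open>
  Join two points \<open>a\<close> and \<open>b\<close> at distances below \<open>r / 16\<close> and equal to \<open>r\<close> from \<open>z0\<close> by a path off
  \<open>K\<close>, and let \<open>w\<close> be the branch of \<open>\<surd>((b - z) / (a - z))\<close> that is near \<open>1\<close> far from the path. Then
  \<open>p = (w - 1) / (w + 1)\<close> is bounded, small away from \<open>z0\<close>, and not small at \<open>z0\<close>, so that
  \<open>1 - p / p(z0)\<close> is an approximate unit for the functions vanishing at \<open>z0\<close>, divisible by \<open>z - z0\<close>.
\<close>

lemma boundary_factor_at_scale:
  assumes K: "W \<inter> K = {}" "z0 \<in> K" and W: "open W" "connected W" "z0 \<in> closure W"
    and c: "c \<in> W" and r: "0 < r" "r < dist c z0"
  obtains g where "g \<in> A_alg K" "\<And>z. z \<in> K \<Longrightarrow> norm ((z - z0) * g z) \<le> 46"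
    "\<And>z d. z \<in> K \<Longrightarrow> 4 * r \<le> d \<Longrightarrow> d \<le> dist z z0 \<Longrightarrow> norm ((z - z0) * g z - 1) \<le> 4 * r / d"
proof -
  obtain h where h: "path h" "path_image h \<subseteq> W" "path_image h \<subseteq> cball z0 r"
    "dist (pathstart h) z0 < r / 16" "dist (pathfinish h) z0 = r"
    using path_to_sphere[OF W c r] by blast
  define a b where "a = pathstart h" and "b = pathfinish h"
  have ab: "dist a z0 < r / 16" "dist b z0 = r"
    using h by (auto simp: a_def b_def)
  have off: "z \<notin> path_image h" if "z \<in> K" for z
    using h K that by auto
  have ends: "z \<noteq> a" "z \<noteq> b" if "z \<notin> path_image h" for z
    using that by (auto simp: a_def b_def)
  obtain v where v: "v holomorphic_on - path_image h"
    and v2: "\<And>z. z \<notin> path_image h \<Longrightarrow> v z ^ 2 = (b - z) / (a - z)"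
    using square_root_cross_ratio_off_path[OF h(1)] a_def b_def by metis
  \<comment> \<open>On \<open>F\<close> the square is within \<open>1 / 2\<close> of one, so the
    real part of the root never vanishes. As \<open>F\<close> is connected, the sign is constant,
    and the branch with positive real part is chosen.\<close>
  define F where "F = - ball z0 (4 * r)"
  have F: "z \<notin> path_image h" "4 * r \<le> dist z z0" if "z \<in> F" for z
    using that h(3) r by (auto simp: F_def subset_iff dist_commute)
  have far: "norm (v z ^ 2 - 1) \<le> 2 * r / d"
    if "4 * r \<le> d" "d \<le> dist z z0" "z \<notin> path_image h" for z d
    using square_root_far_bound[OF ab, of d z] that r by (simp add: v2)
  have "(\<forall>z\<in>F. Re (v z) > 0) \<or> (\<forall>z\<in>F. Re (v z) < 0)"
  proof (rule connected_nonzero_sign)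
    show "connected F"
      unfolding F_def by (intro connected_complement_bounded_convex) auto
    have "continuous_on F v"
      using holomorphic_on_imp_continuous_on[OF v] F by (auto intro: continuous_on_subset)
    then show "continuous_on F (\<lambda>z. Re (v z))"
      by (intro continuous_intros)
    show "Re (v z) \<noteq> 0" if "z \<in> F" for z
    proof (rule Re_nonzero_of_square)
      have "norm (v z ^ 2 - 1) \<le> 2 * r / (4 * r)"
        using far[of "4 * r" z] F[OF that] by simp
      then show "norm (v z ^ 2 - 1) < 1"
        using r by simp
    qed
  qed
  then obtain w where w: "w holomorphic_on - path_image h"
    and w2: "\<And>z. z \<notin> path_image h \<Longrightarrow> w z ^ 2 = (b - z) / (a - z)"
    and wF: "\<And>z. z \<in> F \<Longrightarrow> Re (w z) > 0"
  proof
    assume "\<forall>z\<in>F. Re (v z) < 0"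
    then show ?thesis
      using v v2 by (intro that[of "\<lambda>z. - v z"]) (auto intro!: holomorphic_intros)
  qed (use v v2 in blast)
  have wfar: "norm (w z + 1) \<ge> 1" if "z \<in> F" for z
    using wF[OF that] complex_Re_le_cmod[of "w z + 1"] by simp
  \<comment> \<open>Inside the disc, \<open>norm (w z + 1) < 1 / 13\<close> would force the product
    of \<open>norm (w z - 1)\<close> and \<open>norm (w z + 1)\<close> down to
    \<open>27 / 169\<close>, below \<open>3 / 13\<close>.\<close>
  have w1: "norm (w z + 1) \<ge> 1 / 13" if z: "z \<notin> path_image h" for z
  proof (cases "z \<in> F")
    case False
    then have "norm (w z ^ 2 - 1) \<ge> 3 / 13"
      using square_root_near_bound[OF ab, of z] w2[OF z] ends[OF z] by (simp add: F_def dist_commute)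
    then have *: "norm (w z - 1) * norm (w z + 1) \<ge> 3 / 13"
      by (simp add: power2_eq_square algebra_simps flip: norm_mult)
    show ?thesis
    proof (rule ccontr)
      assume "\<not> ?thesis"
      moreover have "norm (w z - 1) \<le> norm (w z + 1) + norm (2::complex)"
        using norm_triangle_ineq4[of "w z + 1" 2] by simp
      ultimately have "norm (w z - 1) * norm (w z + 1) \<le> (27 / 13) * (1 / 13)"
        by (intro mult_mono) auto
      then show False
        using * by simp
    qed
  qed (use wfar in force)
  define p where "p z = (w z - 1) / (w z + 1)" for z
  have ne: "w z + 1 \<noteq> 0" if "z \<notin> path_image h" for z
    using w1[OF that] by auto
  have p: "p holomorphic_on - path_image h"
    unfolding p_def using ne by (intro holomorphic_intros w) auto
  have p27: "norm (p z) \<le> 27" if z: "z \<notin> path_image h" for z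
  proof -
    have "p z = 1 - 2 / (w z + 1)"
      using ne[OF z] by (simp add: p_def field_simps)
    then have "norm (p z) \<le> 1 + 2 / norm (w z + 1)"
      using norm_triangle_ineq4[of 1 "2 / (w z + 1)"] by (simp add: norm_divide)
    also have "2 / norm (w z + 1) \<le> 2 / (1 / 13)"
      using w1[OF z] by (intro divide_left_mono) auto
    finally show ?thesis by simp
  qed
  \<comment> \<open>At \<open>z0\<close> the modulus of \<open>w\<close> is at least
    \<open>4\<close>, because \<open>a\<close> is sixteen times closer to \<open>z0\<close> than
    \<open>b\<close>; hence the bound \<open>(4 - 1) / (4 + 1)\<close>.\<close>
  have p0: "norm (p z0) \<ge> 3 / 5"
  proof -
    have z0: "z0 \<notin> path_image h"
      using off K by blast
    have "norm (w z0) ^ 2 = r / dist a z0"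
      using w2[OF z0] ab by (simp add: norm_divide dist_norm flip: norm_power)
    also have "\<dots> \<ge> r / (r / 16)"
      using ab r ends[OF z0] by (intro divide_left_mono) auto
    finally have "norm (w z0) ^ 2 \<ge> 4 ^ 2"
      using r by simp
    then have w4: "norm (w z0) \<ge> 4"
      by (rule power2_le_imp_le) simp
    have "(3 / 5) * norm (w z0 + 1) \<le> (3 / 5) * (norm (w z0) + 1)"
      using norm_triangle_ineq[of "w z0" 1] by simp
    also have "\<dots> \<le> norm (w z0) - 1"
      using w4 by simp
    also have "\<dots> \<le> norm (w z0 - 1)"
      using norm_triangle_ineq2[of "w z0" 1] by simp
    finally show ?thesis
      using ne[OF z0] by (simp add: p_def norm_divide pos_le_divide_eq)
  qed
  \<comment> \<open>The function \<open>q\<close> is the approximate unit; it vanishes at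
    \<open>z0\<close>, and \<open>g\<close> is its quotient by \<open>z - z0\<close>. The bound
    \<open>46\<close> is \<open>1 + 5 / 3 * 27\<close>.\<close>
  define q where "q z = 1 - p z / p z0" for z
  define g where "g z = (if z = z0 then deriv q z0 else (q z - q z0) / (z - z0))" for z
  have "p z0 \<noteq> 0"
    using p0 by auto
  then have q0: "q z0 = 0" and q: "q holomorphic_on - path_image h"
    unfolding q_def by (auto intro!: holomorphic_intros p)
  have qp: "norm (q z - 1) \<le> 5 / 3 * norm (p z)" for z
  proof -
    have "norm (q z - 1) = norm (p z) / norm (p z0)"
      by (simp add: q_def norm_divide)
    also have "\<dots> \<le> norm (p z) / (3 / 5)"
      using p0 by (intro divide_left_mono) (auto simp: mult_pos_pos)
    finally show ?thesis by simp
  qed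
  have "open (- path_image h)"
    using h by (simp add: closed_path_image open_Compl)
  then have g: "g holomorphic_on - path_image h"
    unfolding g_def by (rule pole_lemma_open[OF q])
  have gq: "(z - z0) * g z = q z" for z
    by (simp add: g_def q0)
  show ?thesis
  proof (rule that[of g])
    show "g \<in> A_alg K"
    proof (rule A_algI)
      have "K \<subseteq> - path_image h"
        using off by blast
      then show "continuous_on K g" "g holomorphic_on interior K"
        using g interior_subset[of K]
        by (blast intro: holomorphic_on_imp_continuous_on holomorphic_on_subset)+
    qed
    show "norm ((z - z0) * g z) \<le> 46" if "z \<in> K" for z
      using qp[of z] p27[OF off[OF that]] norm_triangle_sub[of "q z" 1] by (simp add: gq)
    fix z d
    assume z: "z \<in> K" "4 * r \<le> d" "d \<le> dist z z0"
    then have zF: "z \<in> F"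
      by (auto simp: F_def dist_commute)
    have "norm (w z - 1) * 1 \<le> norm (w z - 1) * norm (w z + 1)"
      using wfar[OF zF] by (intro mult_left_mono) auto
    also have "\<dots> = norm (w z ^ 2 - 1)"
      by (simp add: power2_eq_square algebra_simps flip: norm_mult)
    also have "\<dots> \<le> 2 * r / d"
      using square_root_far_bound[OF ab, of d z] w2[OF off[OF z(1)]] z r by simp
    finally have "norm (w z - 1) \<le> 2 * r / d" by simp
    moreover have "norm (p z) \<le> norm (w z - 1) / 1"
      unfolding p_def norm_divide using wfar[OF zF] by (intro divide_left_mono) auto
    ultimately have "norm (p z) \<le> 2 * r / d" by simp
    with qp[of z] have "norm (q z - 1) \<le> 5 / 3 * (2 * r / d)"
      by linarith
    also have "\<dots> \<le> 4 * r / d"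
      using z r by (simp add: field_simps)
    finally show "norm ((z - z0) * g z - 1) \<le> 4 * r / d"
      by (simp add: gq)
  qed
qed

text \<open>The difference quotient has a removable singularity at the interior point
  \<open>z0\<close>; elsewhere on \<open>K\<close> it is a continuous quotient with nonzero
  denominator.\<close>

lemma A_alg_factor_interior:
  assumes f: "f \<in> A_alg K" and z0: "z0 \<in> interior K"
  obtains g where "g \<in> A_alg K" "\<And>z. f z - f z0 = (z - z0) * g z" "g z0 = deriv f z0"
proof -
  define g where "g z = (if z = z0 then deriv f z0 else (f z - f z0) / (z - z0))" for z
  have g: "g holomorphic_on interior K"
    unfolding g_def using A_alg_holomorphic[OF f] by (intro pole_lemma_open) auto
  have "continuous_on K g"
  proof -
    have "continuous_on (K - {z0}) (\<lambda>z. (f z - f z0) / (z - z0))"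
      using A_alg_continuous[OF f] by (intro continuous_intros) (auto intro: continuous_on_subset)
    then have *: "continuous_on (K - {z0}) g"
      by (rule continuous_on_eq) (simp add: g_def)
    have "continuous (at z within K) g" if "z \<in> K" for z
    proof (cases "z = z0")
      case True
      then show ?thesis
        using holomorphic_on_imp_continuous_on[OF g] z0
        by (simp add: continuous_on_eq_continuous_at continuous_at_imp_continuous_at_within)
    next
      case False
      have "at z within K - {z0} = at z within K"
        using False by (intro at_within_nhd[of z "- {z0}"]) auto
      moreover have "continuous (at z within K - {z0}) g"
        using * that False by (simp add: continuous_on_eq_continuous_within)
      ultimately show ?thesis
        by (simp only: continuous_within)
    qed
    then show ?thesis
      by (simp add: continuous_on_eq_continuous_within)
  qed
  with g have "g \<in> A_alg K"
    by (intro A_algI)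
  then show ?thesis
    by (rule that) (auto simp: g_def)
qed

text \<open>Elements of A(K) are represented by functions on the whole plane, and
  \<open>cong\<close> makes \<open>\<phi>\<close> depend only on their values on \<open>K\<close>.
  No continuity is assumed.\<close>

locale A_alg_character =
  fixes K :: "complex set" and \<phi> :: "(complex \<Rightarrow> complex) \<Rightarrow> complex"
  assumes K: "K \<in> class_K"
    and cong: "\<And>f g. f \<in> A_alg K \<Longrightarrow> g \<in> A_alg K \<Longrightarrow> (\<And>z. z \<in> K \<Longrightarrow> f z = g z) \<Longrightarrow> \<phi> f = \<phi> g"
    and const: "\<And>c. \<phi> (\<lambda>_. c) = c"
    and diff: "\<And>f g. f \<in> A_alg K \<Longrightarrow> g \<in> A_alg K \<Longrightarrow> \<phi> (\<lambda>z. f z - g z) = \<phi> f - \<phi> g"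
    and mult: "\<And>f g. f \<in> A_alg K \<Longrightarrow> g \<in> A_alg K \<Longrightarrow> \<phi> (\<lambda>z. f z * g z) = \<phi> f * \<phi> g"
begin

text \<open>If the value \<open>\<phi> f\<close> were not taken by \<open>f\<close> on
  \<open>K\<close>, then \<open>f - \<phi> f\<close> would be invertible in A(K), although
  \<open>\<phi>\<close> maps it to zero.\<close>

lemma mem_image: 
  assumes f: "f \<in> A_alg K"
  shows "\<phi> f \<in> f ` K"
proof (rule ccontr)
  assume *: "\<not> ?thesis"
  let ?g = "\<lambda>z. f z - \<phi> f"
  have g: "?g \<in> A_alg K"
    using f by (intro A_alg_diff) auto
  have nz: "?g z \<noteq> 0" if "z \<in> K" for z
    using * imageI[OF that, of f] by auto
  have "1 = \<phi> (\<lambda>z. ?g z * inverse (?g z))"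
    using cong[of "\<lambda>_. 1" "\<lambda>z. ?g z * inverse (?g z)"] nz g
    by (simp add: const A_alg_mult A_alg_inverse)
  also have "\<dots> = \<phi> ?g * \<phi> (\<lambda>z. inverse (?g z))"
    using g nz by (intro mult A_alg_inverse) auto
  also have "\<phi> ?g = 0"
    using f by (simp add: diff const)
  finally show False by simp
qed

lemma factor_eq_0:
  assumes "f \<in> A_alg K" "g \<in> A_alg K" "\<And>z. z \<in> K \<Longrightarrow> f z = (z - \<phi> (\<lambda>z. z)) * g z"
  shows "\<phi> f = 0"
proof -
  have h: "(\<lambda>z. z - \<phi> (\<lambda>z. z)) \<in> A_alg K"
    by (intro A_alg_diff) auto
  have "\<phi> f = \<phi> (\<lambda>z. (z - \<phi> (\<lambda>z. z)) * g z)"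
    using assms h by (intro cong A_alg_mult) auto
  also have "\<dots> = \<phi> (\<lambda>z. z - \<phi> (\<lambda>z. z)) * \<phi> g"
    using assms h by (intro mult)
  also have "\<phi> (\<lambda>z. z - \<phi> (\<lambda>z. z)) = 0"
    by (simp add: diff const)
  finally show ?thesis by simp
qed

text \<open>With an approximate unit \<open>q\<close> divisible by \<open>z - z0\<close>, the
  product of \<open>f\<close> and \<open>q\<close> is killed by \<open>\<phi>\<close>. Hence
  \<open>\<phi> f\<close> is a value of \<open>f * (1 - q)\<close> on \<open>K\<close>. This is
  small near \<open>z0\<close>, where \<open>f\<close> is small and \<open>q\<close> bounded, and
  small elsewhere, where \<open>q\<close> is near \<open>1\<close>.\<close>

lemma zero_at_boundary:
  assumes f: "f \<in> A_alg K" "f (\<phi> (\<lambda>z. z)) = 0" and z: "\<phi> (\<lambda>z. z) \<notin> interior K"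
  shows "\<phi> f = 0"
proof -
  define z0 where "z0 = \<phi> (\<lambda>z. z)"
  have z0: "z0 \<in> K"
    using mem_image[of "\<lambda>z. z"] by (simp add: z0_def)
  obtain W where W: "open W" "connected W" "W \<inter> K = {}" "z0 \<in> closure W"
    using class_K_D(5)[OF K z0] z by (auto simp: z0_def)
  then have "W \<noteq> {}"
    by auto
  then obtain c where c: "c \<in> W"
    by blast
  then have "c \<noteq> z0"
    using W z0 by blast
  have "norm (\<phi> f) \<le> e" if "e > 0" for e
  proof -
    have "compact (f ` K)"
      using f class_K_D(1)[OF K] by (auto simp: A_alg_def intro: compact_continuous_image)
    then obtain M where M: "M > 0" "\<And>z. z \<in> K \<Longrightarrow> norm (f z) \<le> M"
      using compact_imp_bounded bounded_pos by (metis imageI)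
    have "e / 47 > 0"
      using \<open>e > 0\<close> by simp
    then obtain d where "d > 0" "\<forall>z\<in>K. dist z z0 < d \<longrightarrow> dist (f z) (f z0) < e / 47"
      using A_alg_continuous[OF f(1)] z0 unfolding continuous_on_iff by blast
    then have d: "d > 0" "\<And>z. z \<in> K \<Longrightarrow> dist z z0 < d \<Longrightarrow> norm (f z) < e / 47"
      using f(2) by (auto simp: z0_def)
    \<comment> \<open>The last entry makes the error \<open>4 * r / d\<close> of the approximate
      unit at most \<open>e / M\<close>; the first keeps \<open>c\<close> outside the disc, and the
      second makes the far estimate applicable at distance \<open>d\<close>.\<close>
    define r where "r = Min {dist c z0 / 2, d / 4, d * e / (4 * M)}"
    have r: "0 < r" "r < dist c z0" "4 * r \<le> d" "r \<le> d * e / (4 * M)"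
      using \<open>c \<noteq> z0\<close> d M \<open>e > 0\<close> by (auto simp: r_def min_less_iff_disj)
    obtain g where g: "g \<in> A_alg K" "\<And>z. z \<in> K \<Longrightarrow> norm ((z - z0) * g z) \<le> 46"
      "\<And>z d. z \<in> K \<Longrightarrow> 4 * r \<le> d \<Longrightarrow> d \<le> dist z z0 \<Longrightarrow> norm ((z - z0) * g z - 1) \<le> 4 * r / d"
      using boundary_factor_at_scale[OF W(3) z0 W(1,2,4) c r(1,2)] by blast
    define q where "q z = (z - z0) * g z" for z
    have q: "q \<in> A_alg K"
      unfolding q_def by (intro A_alg_mult A_alg_diff g A_alg_id A_alg_const)
    have fq: "(\<lambda>z. f z * q z) \<in> A_alg K"
      by (intro A_alg_mult f q)
    have "\<phi> (\<lambda>z. f z * q z) = 0"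
      by (rule factor_eq_0[OF fq A_alg_mult[OF f(1) g(1)]]) (simp add: q_def z0_def)
    then have "\<phi> f = \<phi> (\<lambda>z. f z - f z * q z)"
      by (simp add: diff f fq)
    also have "\<dots> \<in> (\<lambda>z. f z - f z * q z) ` K"
      by (intro mem_image A_alg_diff f fq)
    finally obtain z where z: "z \<in> K" "\<phi> f = f z * (1 - q z)"
      by (auto simp: algebra_simps)
    have "norm (f z) * norm (1 - q z) \<le> e"
    proof (cases "dist z z0 < d")
      case True
      have "norm (1 - q z) \<le> 47"
        using g(2)[OF z(1)] norm_triangle_ineq4[of 1 "q z"] by (simp add: q_def)
      then have "norm (f z) * norm (1 - q z) \<le> (e / 47) * 47"
        using d(2)[OF z(1) True] \<open>e > 0\<close> by (intro mult_mono) auto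
      then show ?thesis by simp
    next
      case False
      then have "norm (1 - q z) \<le> 4 * r / d"
        using g(3)[OF z(1) r(3)] by (simp add: q_def norm_minus_commute)
      also have "\<dots> \<le> e / M"
        using r(4) d(1) M(1) by (simp add: field_simps)
      finally have "norm (f z) * norm (1 - q z) \<le> M * (e / M)"
        using M z(1) by (intro mult_mono) auto
      then show ?thesis
        using M(1) by simp
    qed
    then show ?thesis
      by (simp add: z(2) norm_mult)
  qed
  then show ?thesis
    using field_le_epsilon[of "norm (\<phi> f)" 0] by simp
qed

theorem eq_evaluation:
  assumes f: "f \<in> A_alg K"
  shows "\<phi> f = f (\<phi> (\<lambda>z. z))"
proof -
  define z0 where "z0 = \<phi> (\<lambda>z. z)"
  let ?f = "\<lambda>z. f z - f z0"
  have f': "?f \<in> A_alg K"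
    using f by (intro A_alg_diff) auto
  have "\<phi> ?f = 0"
  proof (cases "z0 \<in> interior K")
    case True
    then obtain g where "g \<in> A_alg K" "\<And>z. f z - f z0 = (z - z0) * g z"
      using A_alg_factor_interior[OF f] by metis
    then show ?thesis
      using f' by (intro factor_eq_0[of ?f g]) (auto simp: z0_def)
  next
    case False
    then show ?thesis
      by (intro zero_at_boundary f') (auto simp: z0_def)
  qed
  then show ?thesis
    using f by (simp add: diff const z0_def)
qed

end

section \<open>Coefficient maps and characters of a topological conjugacy algebra\<close>

text \<open>A root test: the growth condition bounds \<open>c n * u n\<close> by
  \<open>s ^ n\<close> eventually, for any \<open>s > 1\<close>, so \<open>c n\<close> is at most
  \<open>(s / R) ^ n\<close>. It remains to choose \<open>s\<close> with
  \<open>s * r < R\<close>.\<close>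

lemma summable_geometric_bound:
  fixes c :: "nat \<Rightarrow> real"
  assumes c: "\<And>n. c n \<ge> 0" and R: "R > 0" "\<And>n. n > 0 \<Longrightarrow> R ^ n \<le> u n"
    and growth: "limsup (\<lambda>n. ereal (root n (c n * u n))) \<le> 1" and r: "0 \<le> r" "r < R"
  shows "summable (\<lambda>n. c n * r ^ n)"
proof -
  \<comment> \<open>The midpoint between \<open>1\<close> and the available ratio; replacing
    \<open>r\<close> by \<open>max r (R / 2)\<close> avoids division by zero.\<close>
  define s where "s = (1 + R / max r (R / 2)) / 2"
  have mx: "max r (R / 2) > 0" "max r (R / 2) < R" "r \<le> max r (R / 2)"
    using r R by auto
  have s: "s > 1" "s * max r (R / 2) < R"
    using mx by (auto simp: s_def field_simps)
  have sr: "s * r < R"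
    using s mx mult_left_mono[of r "max r (R / 2)" s] by linarith
  have "limsup (\<lambda>n. ereal (root n (c n * u n))) < ereal s"
    using growth s(1) by (metis ereal_less(3) less_ereal.simps(1) one_ereal_def order_le_less_trans)
  then have ev: "\<forall>\<^sub>F n in sequentially. ereal (root n (c n * u n)) < ereal s"
    by (rule Limsup_lessD)
  have "\<forall>\<^sub>F n in sequentially. norm (c n * r ^ n) \<le> (s * r / R) ^ n"
    using ev eventually_gt_at_top[of 0]
  proof eventually_elim
    case (elim n)
    have cu: "c n * u n \<ge> 0"
      using c[of n] R(2)[of n] elim(2) R(1) by (intro mult_nonneg_nonneg) (auto intro: order_trans[rotated])
    have "c n * R ^ n \<le> c n * u n"
      using c R elim by (intro mult_left_mono) auto
    also have "\<dots> = root n (c n * u n) ^ n"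
      using elim(2) cu by simp
    also have "\<dots> \<le> s ^ n"
      using elim cu by (intro power_mono) auto
    finally have "c n * R ^ n \<le> s ^ n" .
    then have "c n \<le> (s / R) ^ n"
      using R by (simp add: power_divide field_simps)
    then have "c n * r ^ n \<le> (s / R) ^ n * r ^ n"
      using r by (intro mult_right_mono) auto
    then show ?case
      using c r by (simp add: power_mult_distrib power_divide abs_mult)
  qed
  moreover have "summable (\<lambda>n. (s * r / R) ^ n)"
    using sr s r R by (intro summable_geometric) (simp add: abs_mult)
  ultimately show ?thesis
    by (rule summable_comparison_test_ev)
qed

context topological_conjugacy_algebra
begin

section \<open>Arithmetic of skew polynomials inside the algebra\<close>

abbreviation "T \<equiv> tca_fun \<iota>"
abbreviation "U \<equiv> tca_U \<iota>"

lemma skew_monom_mem: "continuous_on X f \<Longrightarrow> skew_monom f k \<in> skew_polys X"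
proof -
  assume "continuous_on X f"
  then have "continuous_on X (skew_monom f k n)" for n
    by (cases "n = k") (simp_all add: skew_monom_def)
  then show ?thesis
    by (auto simp: skew_polys_def skew_monom_def intro!: exI[of _ k])
qed

lemma funpow_mem: "x \<in> X \<Longrightarrow> (\<eta> ^^ n) x \<in> X"
  using \<eta>_into by (induction n) auto

lemma continuous_compose_\<eta>: "continuous_on X f \<Longrightarrow> continuous_on X (\<lambda>x. f (\<eta> x))"
  using continuous_on_compose2[OF _ cont_\<eta>, of X f] \<eta>_into by blast

lemma T_eq_iff: "continuous_on X f \<Longrightarrow> continuous_on X g \<Longrightarrow> T f = T g \<longleftrightarrow> (\<forall>x\<in>X. f x = g x)"
  by (simp add: tca_fun_def \<iota>_eq_iff skew_monom_mem) (auto simp: skew_monom_def)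

lemma T_add: "continuous_on X f \<Longrightarrow> continuous_on X g \<Longrightarrow> T (\<lambda>x. f x + g x) = T f + T g"
proof -
  assume "continuous_on X f" "continuous_on X g"
  then have "\<iota> (\<lambda>n x. skew_monom f 0 n x + skew_monom g 0 n x) = T f + T g"
    by (simp add: \<iota>_add skew_monom_mem tca_fun_def)
  moreover have "(\<lambda>n x. skew_monom f 0 n x + skew_monom g 0 n x) = skew_monom (\<lambda>x. f x + g x) 0"
    by (intro ext) (simp add: skew_monom_def)
  ultimately show ?thesis
    by (simp only: tca_fun_def)
qed

lemma T_scale: "continuous_on X f \<Longrightarrow> T (\<lambda>x. c * f x) = c *\<^sub>C T f"
proof -
  assume "continuous_on X f"
  then have "\<iota> (\<lambda>n x. c * skew_monom f 0 n x) = c *\<^sub>C T f"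
    by (simp add: \<iota>_scale skew_monom_mem tca_fun_def)
  moreover have "(\<lambda>n x. c * skew_monom f 0 n x) = skew_monom (\<lambda>x. c * f x) 0"
    by (intro ext) (simp add: skew_monom_def)
  ultimately show ?thesis
    by (simp only: tca_fun_def)
qed

lemma skew_mult_monom:
  "skew_mult \<eta> (skew_monom f i) (skew_monom g j) = skew_monom (\<lambda>x. f x * g ((\<eta> ^^ i) x)) (i + j)"
proof (intro ext)
  fix n x
  have "skew_mult \<eta> (skew_monom f i) (skew_monom g j) n x =
      (\<Sum>k\<le>n. if k = i then f x * (if n - i = j then g ((\<eta> ^^ i) x) else 0) else 0)"
    unfolding skew_mult_def skew_monom_def by (intro sum.cong) auto
  also have "\<dots> = skew_monom (\<lambda>x. f x * g ((\<eta> ^^ i) x)) (i + j) n x"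
    by (subst sum.delta) (auto simp: skew_monom_def)
  finally show "skew_mult \<eta> (skew_monom f i) (skew_monom g j) n x =
      skew_monom (\<lambda>x. f x * g ((\<eta> ^^ i) x)) (i + j) n x" .
qed

lemma \<iota>_monom_mult:
  "continuous_on X f \<Longrightarrow> continuous_on X g \<Longrightarrow>
     \<iota> (skew_monom f i) * \<iota> (skew_monom g j) = \<iota> (skew_monom (\<lambda>x. f x * g ((\<eta> ^^ i) x)) (i + j))"
  by (simp add: skew_monom_mem skew_mult_monom flip: \<iota>_mult)

lemma T_mult: "continuous_on X f \<Longrightarrow> continuous_on X g \<Longrightarrow> T (\<lambda>x. f x * g x) = T f * T g"
  by (simp add: tca_fun_def \<iota>_monom_mult)

lemma U_T: "continuous_on X f \<Longrightarrow> U * T f = T (\<lambda>x. f (\<eta> x)) * U"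
  using continuous_compose_\<eta>[of f] by (simp add: tca_fun_def tca_U_def \<iota>_monom_mult)

lemma \<iota>_monom: "continuous_on X f \<Longrightarrow> \<iota> (skew_monom f k) = T f * U ^ k"
proof (induction k)
  case 0
  then show ?case by (simp add: tca_fun_def)
next
  case (Suc k)
  have "T f * U ^ Suc k = \<iota> (skew_monom f k) * U"
    using Suc by (simp add: power_commutes mult.assoc)
  also have "\<dots> = \<iota> (skew_monom f (Suc k))"
    unfolding tca_U_def using Suc.prems by (simp add: \<iota>_monom_mult)
  finally show ?case ..
qed

lemma \<iota>_poly_sum:
  assumes p: "p \<in> skew_polys X" and N: "\<And>n x. n \<ge> N \<Longrightarrow> x \<in> X \<Longrightarrow> p n x = 0"
  shows "\<iota> p = (\<Sum>n<N. T (p n) * U ^ n)"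
proof -
  have cont: "continuous_on X (p n)" for n
    using p by (simp add: skew_polys_def)
  have tr: "(\<lambda>n x. if n < m then p n x else 0) \<in> skew_polys X" for m
  proof -
    have "continuous_on X (\<lambda>x. if n < m then p n x else 0)" for n
      using cont by (cases "n < m") simp_all
    then show ?thesis
      by (auto simp: skew_polys_def intro!: exI[of _ m])
  qed
  have part: "\<iota> (\<lambda>n x. if n < m then p n x else 0) = (\<Sum>n<m. T (p n) * U ^ n)" for m
  proof (induction m)
    case 0
    then show ?case
      using \<iota>_scale[where c = 0, OF p] by simp
  next
    case (Suc m)
    have "(\<lambda>n x. if n < Suc m then p n x else 0) =
        (\<lambda>n x. (if n < m then p n x else 0) + skew_monom (p m) m n x)"
      by (auto simp: skew_monom_def fun_eq_iff less_Suc_eq)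
    then show ?case
      using Suc cont by (simp add: \<iota>_add tr skew_monom_mem \<iota>_monom)
  qed
  have "\<iota> p = \<iota> (\<lambda>n x. if n < N then p n x else 0)"
    using N by (subst \<iota>_eq_iff[OF p tr]) auto
  then show ?thesis
    using part by simp
qed

text \<open>A chosen representative of an element of C(X); only its values on \<open>X\<close> are
  determined.\<close>

definition fn :: "'a \<Rightarrow> 'x \<Rightarrow> complex" where
  "fn a = (SOME f. continuous_on X f \<and> T f = a)"

lemma fn:
  assumes "a \<in> T ` {f. continuous_on X f}"
  shows "continuous_on X (fn a)" "T (fn a) = a"
proof -
  have "\<exists>f. continuous_on X f \<and> T f = a"
    using assms by auto
  from someI_ex[OF this] show "continuous_on X (fn a)" "T (fn a) = a"
    by (auto simp: fn_def)
qed

lemma fn_T: "continuous_on X f \<Longrightarrow> x \<in> X \<Longrightarrow> fn (T f) x = f x"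
  using fn[of "T f"] T_eq_iff[of "fn (T f)" f] by auto

section \<open>Evaluations through \<open>E0\<close> and boundedness of \<open>E0\<close>\<close>

lemma E0_mem: "E0 a \<in> T ` {f. continuous_on X f}"
  using E0_range by auto

lemma E0_add: "E0 (a + b) = E0 a + E0 b"
  and E0_scaleC: "E0 (c *\<^sub>C a) = c *\<^sub>C E0 a"
  and E0_mult: "E0 (a * b) = E0 a * E0 b"
  using E0_hom by (auto simp: complex_algebra_hom_on_def)

lemma E0_E0: "E0 (E0 a) = E0 a"
  using E0_id fn[OF E0_mem[of a]] by metis

lemma E0_U: "E0 (b * U) = 0"
  using E0_kernel by auto

lemma linear_E0: "linear E0"
  by (rule linearI) (simp_all add: E0_add E0_scaleC flip: scaleC_of_real)

lemma E0_diff: "E0 (a - b) = E0 a - E0 b"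
  using linear_E0 by (rule linear_diff)

lemma complex_subalgebra_UNIV: "complex_subalgebra UNIV"
  by (simp add: complex_subalgebra_def)

lemma character_E0:
  assumes "x \<in> X"
  shows "character_on UNIV (\<lambda>a. fn (E0 a) x)"
proof -
  note f = fn[OF E0_mem]
  have "T (\<lambda>x. fn (E0 a) x + fn (E0 b) x) = E0 (a + b)" for a b
    by (simp add: T_add f E0_add)
  then have 1: "fn (E0 (a + b)) x = fn (E0 a) x + fn (E0 b) x" for a b
    using fn_T[of "\<lambda>x. fn (E0 a) x + fn (E0 b) x" x] assms f by (simp add: continuous_on_add)
  have "T (\<lambda>x. fn (E0 a) x * fn (E0 b) x) = E0 (a * b)" for a b
    by (simp add: T_mult f E0_mult)
  then have 2: "fn (E0 (a * b)) x = fn (E0 a) x * fn (E0 b) x" for a b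
    using fn_T[of "\<lambda>x. fn (E0 a) x * fn (E0 b) x" x] assms f by (simp add: continuous_on_mult)
  have "T (\<lambda>x. c * fn (E0 a) x) = E0 (c *\<^sub>C a)" for a c
    by (simp add: T_scale f E0_scaleC)
  then have 3: "fn (E0 (c *\<^sub>C a)) x = c * fn (E0 a) x" for a c
    using fn_T[of "\<lambda>x. c * fn (E0 a) x" x] assms f by (simp add: continuous_on_mult)
  have "E0 1 = T (\<lambda>_. 1)"
    using E0_id[of "\<lambda>_. 1"] \<iota>_one by simp
  then have "fn (E0 1) x = 1"
    using fn_T[of "\<lambda>_. 1" x] assms by simp
  with 1 2 3 show ?thesis
    by (simp add: character_on_def)
qed

lemma norm_fn_E0_le: "x \<in> X \<Longrightarrow> norm (fn (E0 a) x) \<le> norm a"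
  using character_on_norm_le[OF character_E0 complex_subalgebra_UNIV] by simp

text \<open>Evaluation after \<open>E0\<close> is a character and thus contractive, so the algebra
  norm dominates the supremum norm on C(X).\<close>

lemma norm_T_diff_ge:
  assumes "continuous_on X f" "continuous_on X g" "x \<in> X"
  shows "norm (f x - g x) \<le> norm (T f - T g)"
proof -
  have "fn (E0 (T f - T g)) x = f x - g x"
    using character_on_diff[OF character_E0[OF assms(3)] complex_subalgebra_UNIV, of "T f" "T g"]
      assms by (simp add: E0_id fn_T)
  then show ?thesis
    using norm_fn_E0_le[OF assms(3), of "T f - T g"] by simp
qed

text \<open>By the closed graph theorem: the limit of \<open>E0 (A n)\<close> stays in the closed
  subspace C(X), and the contractive evaluations identify it pointwise with
  \<open>E0 a\<close>.\<close>

lemma bounded_linear_E0: "bounded_linear E0"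
proof (rule closed_graph_theorem[OF linear_E0])
  fix A :: "nat \<Rightarrow> 'a" and a b
  assume A: "A \<longlonglongrightarrow> a" "(\<lambda>n. E0 (A n)) \<longlonglongrightarrow> b"
  have "b \<in> T ` {f. continuous_on X f}"
    using closed_sequentially[OF closed_CX _ A(2)] E0_mem by blast
  then obtain g where g: "continuous_on X g" "b = T g"
    by auto
  have "fn (E0 a) x = g x" if x: "x \<in> X" for x
  proof (rule LIMSEQ_unique)
    have "norm (fn (E0 (A n)) x - fn (E0 a) x) \<le> norm (A n - a)" for n
      using norm_fn_E0_le[OF x, of "A n - a"]
        character_on_diff[OF character_E0[OF x] complex_subalgebra_UNIV, of "A n" a] by simp
    then show "(\<lambda>n. fn (E0 (A n)) x) \<longlonglongrightarrow> fn (E0 a) x"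
      using A(1) by (rule LIMSEQ_norm_diff_le)
    have "norm (fn (E0 (A n)) x - g x) \<le> norm (E0 (A n) - b)" for n
      using norm_T_diff_ge[OF fn(1)[OF E0_mem] g(1) x, of "A n"] fn(2)[OF E0_mem] g(2) by simp
    then show "(\<lambda>n. fn (E0 (A n)) x) \<longlonglongrightarrow> g x"
      using A(2) by (rule LIMSEQ_norm_diff_le)
  qed
  then have "T (fn (E0 a)) = T g"
    using T_eq_iff fn(1)[OF E0_mem] g by blast
  then show "E0 a = b"
    using fn(2)[OF E0_mem] g by simp
qed

section \<open>Right division by \<open>U\<close> after removal of the constant term, and the
  calculus of coefficients\<close>

definition Q :: "'a \<Rightarrow> 'a" where
  "Q a = (THE b. a = E0 a + b * U)"

lemma Q_unique: "a * U = b * U \<Longrightarrow> a = b"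
  using U_not_right_zero_divisor[of "a - b"] by (simp add: left_diff_distrib)

lemma Q_eqI: "a = E0 a + b * U \<Longrightarrow> Q a = b"
  unfolding Q_def
proof (rule the_equality)
  fix c assume "a = E0 a + b * U" "a = E0 a + c * U"
  then have "b * U = c * U"
    by (metis add_left_cancel)
  then show "c = b"
    using Q_unique by metis
qed

lemma Q_eq: "a = E0 a + Q a * U"
proof -
  have "E0 (a - E0 a) = 0"
    by (simp add: E0_diff E0_E0)
  then have "a - E0 a \<in> range (\<lambda>b. b * U)"
    using E0_kernel by blast
  then obtain b where "a - E0 a = b * U"
    by blast
  then have "a = E0 a + b * U"
    by (simp add: diff_eq_eq add.commute)
  then show ?thesis
    using Q_eqI by metis
qed

lemma Q_add: "Q (a + b) = Q a + Q b"
proof (rule Q_eqI)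
  have "(E0 a + Q a * U) + (E0 b + Q b * U) = E0 (a + b) + (Q a + Q b) * U"
    by (simp add: E0_add distrib_right)
  then show "a + b = E0 (a + b) + (Q a + Q b) * U"
    by (simp only: Q_eq[symmetric])
qed

lemma Q_scaleC: "Q (c *\<^sub>C a) = c *\<^sub>C Q a"
proof (rule Q_eqI)
  have "c *\<^sub>C (E0 a + Q a * U) = E0 (c *\<^sub>C a) + (c *\<^sub>C Q a) * U"
    by (simp only: E0_scaleC scaleC_add_right mult_scaleC_left)
  then show "c *\<^sub>C a = E0 (c *\<^sub>C a) + (c *\<^sub>C Q a) * U"
    by (simp only: Q_eq[symmetric])
qed

lemma linear_Q: "linear Q"
  by (rule linearI) (simp_all add: Q_add Q_scaleC flip: scaleC_of_real)

text \<open>The decomposition \<open>a = E0 a + Q a * U\<close> passes to limits, and its uniqueness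
  closes the graph of \<open>Q\<close>.\<close>

lemma bounded_linear_Q: "bounded_linear Q"
proof (rule closed_graph_theorem[OF linear_Q])
  fix A :: "nat \<Rightarrow> 'a" and a b
  assume A: "A \<longlonglongrightarrow> a" "(\<lambda>n. Q (A n)) \<longlonglongrightarrow> b"
  have "(\<lambda>n. E0 (A n) + Q (A n) * U) \<longlonglongrightarrow> E0 a + b * U"
    by (intro tendsto_intros bounded_linear.tendsto[OF bounded_linear_E0] A)
  then have "A \<longlonglongrightarrow> E0 a + b * U"
    using Q_eq by simp
  then show "Q a = b"
    using A(1) LIMSEQ_unique Q_eqI by blast
qed

lemma Q_mult_U: "Q (b * U) = b"
  by (rule Q_eqI) (simp add: E0_U)

lemma Q_T: "continuous_on X f \<Longrightarrow> Q (T f) = 0"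
  by (rule Q_eqI) (simp add: E0_id)

definition E :: "nat \<Rightarrow> 'a \<Rightarrow> 'a" where "E = coeff_map E0 U"

lemma E_0: "E 0 = E0" and E_Suc: "E (Suc n) a = E n (Q a)"
  by (simp_all add: E_def Q_def)

lemma bounded_linear_E: "bounded_linear (E n)"
proof (induction n)
  case 0
  then show ?case by (simp add: E_0 bounded_linear_E0)
next
  case (Suc n)
  have "E (Suc n) = (\<lambda>a. E n (Q a))"
    by (simp add: E_Suc fun_eq_iff)
  then show ?case
    using bounded_linear_compose[OF Suc bounded_linear_Q] by simp
qed

lemma E_mem: "E n a \<in> T ` {f. continuous_on X f}"
  by (induction n arbitrary: a) (use E0_mem in \<open>auto simp: E_0 E_Suc\<close>)

definition e :: "nat \<Rightarrow> 'a \<Rightarrow> 'x \<Rightarrow> complex" where "e n a = fn (E n a)"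

lemma e_Suc: "e (Suc n) a x = e n (Q a) x"
  by (simp add: e_def E_Suc)

lemma T_e0: "T (e 0 a) = E0 a"
  by (simp add: e_def E_0 fn[OF E0_mem])

lemma continuous_e: "continuous_on X (e n a)"
  unfolding e_def using E_mem by (rule fn)

lemma e_0_character: "x \<in> X \<Longrightarrow> character_on UNIV (\<lambda>a. e 0 a x)"
  using character_E0 by (simp add: e_def E_0)

lemma e_add: "x \<in> X \<Longrightarrow> e n (a + b) x = e n a x + e n b x"
proof (induction n arbitrary: a b)
  case 0
  then show ?case using e_0_character by (simp add: character_on_def)
qed (simp add: e_Suc Q_add)

lemma e_scaleC: "x \<in> X \<Longrightarrow> e n (c *\<^sub>C a) x = c * e n a x"
proof (induction n arbitrary: a)
  case 0
  then show ?case using e_0_character by (simp add: character_on_def)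
qed (simp add: e_Suc Q_scaleC)

lemma e_zero: "x \<in> X \<Longrightarrow> e n 0 x = 0"
  using e_scaleC[of x n 0 0] by simp

lemma e_T: "continuous_on X f \<Longrightarrow> x \<in> X \<Longrightarrow> e n (T f) x = (if n = 0 then f x else 0)"
  by (cases n) (simp_all add: e_def E_0 E0_id fn_T e_Suc[unfolded e_def] Q_T e_zero[unfolded e_def])

lemma e_mult_U: "x \<in> X \<Longrightarrow> e n (b * U) x = (if n = 0 then 0 else e (n - 1) b x)"
proof (cases n)
  case 0
  assume x: "x \<in> X"
  have "E0 (b * U) = T (\<lambda>_. 0)"
    using T_scale[of "\<lambda>_. 1" 0] by (simp add: E0_U)
  then show ?thesis
    using fn_T[of "\<lambda>_. 0" x] x 0 by (simp add: e_def E_0)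
qed (simp add: e_Suc Q_mult_U)

lemma e_one: "x \<in> X \<Longrightarrow> e n 1 x = (if n = 0 then 1 else 0)"
  using e_T[of "\<lambda>_. 1" x n] \<iota>_one by simp

lemma e_U: "x \<in> X \<Longrightarrow> e n U x = (if n = 1 then 1 else 0)"
  using e_mult_U[of x n 1] by (auto simp: e_one)

text \<open>Moving \<open>U\<close> to the right past the constant term of \<open>b\<close> composes
  this term with \<open>\<eta>\<close>. Iterated, it shows that \<open>Q (U * b)\<close> has the
  coefficients of \<open>b\<close> composed with \<open>\<eta>\<close>.\<close>

lemma Q_U_mult: "Q (U * b) = T (\<lambda>x. e 0 b (\<eta> x)) + U * Q b"
proof (rule Q_eqI)
  have cont: "continuous_on X (\<lambda>x. e 0 b (\<eta> x))"
    by (intro continuous_compose_\<eta> continuous_e)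
  have "U * b = U * T (e 0 b) + U * (Q b * U)"
    using Q_eq[of b] by (simp add: T_e0 flip: distrib_left)
  also have "\<dots> = (T (\<lambda>x. e 0 b (\<eta> x)) + U * Q b) * U"
    by (simp add: U_T continuous_e distrib_right mult.assoc)
  finally have eq: "U * b = (T (\<lambda>x. e 0 b (\<eta> x)) + U * Q b) * U" .
  then have "E0 (U * b) = 0"
    by (simp only: E0_U)
  with eq show "U * b = E0 (U * b) + (T (\<lambda>x. e 0 b (\<eta> x)) + U * Q b) * U"
    by simp
qed

lemma e_Q_U_mult: "x \<in> X \<Longrightarrow> e n (Q (U * b)) x = e n b (\<eta> x)"
proof (induction n arbitrary: b)
  have cont: "continuous_on X (\<lambda>x. e 0 b (\<eta> x))" for b
    by (intro continuous_compose_\<eta> continuous_e)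
  {
    case 0
    have "e 0 (U * Q b) x = e 0 U x * e 0 (Q b) x"
      using e_0_character[OF 0] by (simp add: character_on_def)
    then show ?case
      using 0 cont[of b] by (simp add: Q_U_mult e_add e_T e_U)
  next
    case (Suc n)
    have "Q (Q (U * b)) = Q (U * Q b)"
      by (simp add: Q_U_mult[of b] Q_add Q_T cont)
    then show ?case
      using Suc by (simp add: e_Suc)
  }
qed

text \<open>A twisted Leibniz rule. Expand \<open>a\<close> once and then \<open>b\<close> once;
  \<open>U * b\<close> is itself a multiple of \<open>U\<close>, since \<open>E0\<close> is
  multiplicative and kills \<open>U\<close>.\<close>

lemma Q_mult: "Q (a * b) = E0 a * Q b + Q a * Q (U * b)"
proof (rule Q_eqI)
  have Ub: "U * b = Q (U * b) * U"
    using Q_eq[of "U * b"] by (simp add: E0_mult) (metis E0_U mult_1 mult_zero_left add_0)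
  have "a * b = E0 a * b + Q a * (U * b)"
    by (subst Q_eq[of a]) (simp add: distrib_right mult.assoc)
  also have "E0 a * b = E0 a * E0 b + E0 a * Q b * U"
    by (subst Q_eq[of b]) (simp add: distrib_left mult.assoc)
  also have "Q a * (U * b) = Q a * Q (U * b) * U"
    by (subst Ub) (simp add: mult.assoc)
  also have "E0 a * E0 b + E0 a * Q b * U + Q a * Q (U * b) * U =
      E0 (a * b) + (E0 a * Q b + Q a * Q (U * b)) * U"
    by (simp add: E0_mult distrib_right add.assoc)
  finally show "a * b = E0 (a * b) + (E0 a * Q b + Q a * Q (U * b)) * U" .
qed

text \<open>The multiplication rule of skew polynomials persists for all elements of the algebra, by
  induction on \<open>n\<close> with the twisted Leibniz rule for \<open>Q\<close>.\<close>

lemma e_mult: "x \<in> X \<Longrightarrow> e n (a * b) x = (\<Sum>i\<le>n. e i a x * e (n - i) b ((\<eta> ^^ i) x))"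
proof (induction n arbitrary: a b)
  case 0
  then show ?case
    using e_0_character by (simp add: character_on_def)
next
  case (Suc n)
  have "e n (T (e 0 a) * Q b) x = (\<Sum>i\<le>n. e i (T (e 0 a)) x * e (n - i) (Q b) ((\<eta> ^^ i) x))"
    by (rule Suc.IH[OF Suc.prems])
  also have "\<dots> = (\<Sum>i\<le>n. if i = 0 then e 0 a x * e n (Q b) x else 0)"
    using Suc.prems by (intro sum.cong) (auto simp: e_T continuous_e)
  finally have "e n (E0 a * Q b) x = (\<Sum>i\<le>n. if i = 0 then e 0 a x * e n (Q b) x else 0)"
    by (simp only: T_e0)
  then have "e n (E0 a * Q b) x = e 0 a x * e (Suc n) b x"
    by (simp add: e_Suc)
  moreover have "e n (Q a * Q (U * b)) x = (\<Sum>i\<le>n. e (Suc i) a x * e (n - i) b ((\<eta> ^^ Suc i) x))"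
    by (rule trans[OF Suc.IH[OF Suc.prems]], intro sum.cong)
      (simp_all add: e_Suc e_Q_U_mult funpow_mem Suc.prems)
  ultimately have "e (Suc n) (a * b) x =
      e 0 a x * e (Suc n) b x + (\<Sum>i\<le>n. e (Suc i) a x * e (n - i) b ((\<eta> ^^ Suc i) x))"
    by (simp only: e_Suc[of n "a * b"] Q_mult[of a b] e_add[OF Suc.prems])
  then show ?case
    by (subst sum.atMost_Suc_shift) simp
qed

lemma norm_e_le: "x \<in> X \<Longrightarrow> norm (e n a x) \<le> onorm (E n) * norm a"
proof -
  assume x: "x \<in> X"
  have "E0 (E n a) = E n a"
    using E_mem[of n a] E0_id by auto
  then have "norm (e n a x) \<le> norm (E n a)"
    using norm_fn_E0_le[OF x, of "E n a"] by (simp add: e_def)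
  then show ?thesis
    using onorm[OF bounded_linear_E, of n a] by linarith
qed

section \<open>The spectral radius of \<open>U\<close> and the power series characters\<close>

text \<open>
  The infimum may vanish, since \<open>U\<close> can be quasinilpotent; the discs of characters below are then empty.
\<close>

definition rad :: real where
  "rad = (INF n\<in>{0<..}. root n (norm (U ^ n)))"

lemma rad_le_root: "n > 0 \<Longrightarrow> rad \<le> root n (norm (U ^ n))"
  unfolding rad_def by (intro cINF_lower bdd_belowI[of _ 0]) auto

lemma rad_nonneg: "rad \<ge> 0"
  unfolding rad_def by (intro cINF_greatest) auto

lemma le_rad: "(\<And>n. n > 0 \<Longrightarrow> r \<le> root n (norm (U ^ n))) \<Longrightarrow> r \<le> rad"
  unfolding rad_def by (intro cINF_greatest) auto

lemma summable_onorm_E: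
  assumes "0 \<le> r" "r < rad"
  shows "summable (\<lambda>n. onorm (E n) * r ^ n)"
proof (rule summable_geometric_bound[OF _ _ _ _ assms])
  show "onorm (E n) \<ge> 0" for n
    using bounded_linear_E by (rule onorm_pos_le)
  show "rad > 0"
    using assms by simp
  show "rad ^ n \<le> norm (U ^ n)" if "n > 0" for n
    using power_mono[OF rad_le_root[OF that] rad_nonneg, of n] that by simp
  show "limsup (\<lambda>n. ereal (root n (onorm (E n) * norm (U ^ n)))) \<le> 1"
    using growth by (simp add: E_def)
qed

definition chi :: "'x \<Rightarrow> complex \<Rightarrow> 'a \<Rightarrow> complex" where
  "chi x z a = (\<Sum>n. e n a x * z ^ n)"

lemma norm_chi_term_le:
  "x \<in> X \<Longrightarrow> norm z \<le> r \<Longrightarrow> norm (e n a x * z ^ n) \<le> onorm (E n) * r ^ n * norm a"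
proof -
  assume *: "x \<in> X" "norm z \<le> r"
  have "norm (e n a x) * norm z ^ n \<le> (onorm (E n) * norm a) * r ^ n"
    using * norm_e_le onorm_pos_le[OF bounded_linear_E, of n]
    by (intro mult_mono power_mono) auto
  then show ?thesis
    by (simp add: norm_mult norm_power mult_ac)
qed

lemma summable_chi_norm: "x \<in> X \<Longrightarrow> norm z < rad \<Longrightarrow> summable (\<lambda>n. norm (e n a x * z ^ n))"
  using norm_chi_term_le[of x z "norm z" _ a]
  by (intro summable_comparison_test'[OF summable_mult2[OF summable_onorm_E[of "norm z"], of "norm a"], of 0]) auto

lemma chi_0: "chi x 0 a = e 0 a x"
  using powser_zero[of "\<lambda>n. e n a x"] by (simp add: chi_def)

lemma chi_T:
  assumes "continuous_on X f" "x \<in> X"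
  shows "chi x z (T f) = f x"
proof -
  have "chi x z (T f) = (\<Sum>n\<in>{0}. e n (T f) x * z ^ n)"
    unfolding chi_def using assms by (intro suminf_finite) (auto simp: e_T)
  then show ?thesis
    using assms by (simp add: e_T)
qed

lemma chi_U:
  assumes "x \<in> X"
  shows "chi x z U = z"
proof -
  have "chi x z U = (\<Sum>n\<in>{1}. e n U x * z ^ n)"
    unfolding chi_def using assms by (intro suminf_finite) (auto simp: e_U)
  then show ?thesis
    using assms by (simp add: e_U)
qed

text \<open>The points where \<open>chi\<close> is used: the zero section over all of
  \<open>X\<close>, and an open disc over each fixed point. The circle of radius \<open>rad\<close>
  is left out, as the series need not converge there.\<close>

definition admissible :: "'x \<Rightarrow> complex \<Rightarrow> bool" where
  "admissible x z \<longleftrightarrow> x \<in> X \<and> (z = 0 \<or> \<eta> x = x \<and> norm z < rad)"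

text \<open>Over a fixed point the twist disappears from the product rule of the coefficients, and
  multiplicativity is the Cauchy product of absolutely convergent series.\<close>

lemma character_chi:
  assumes "admissible x z"
  shows "character_on UNIV (chi x z)"
proof (cases "z = 0")
  case True
  moreover have "chi x 0 = (\<lambda>a. e 0 a x)"
    by (intro ext chi_0)
  ultimately show ?thesis
    using assms e_0_character by (simp add: admissible_def)
next
  case False
  then have x: "x \<in> X" "\<eta> x = x" "norm z < rad"
    using assms by (auto simp: admissible_def)
  have fixpow: "(\<eta> ^^ n) x = x" for n
    by (induction n) (simp_all add: x)
  have sm: "summable (\<lambda>n. e n a x * z ^ n)" for a
    using summable_chi_norm[OF x(1,3)] by (rule summable_norm_cancel)
  have 1: "chi x z (a + b) = chi x z a + chi x z b" for a b
    unfolding chi_def suminf_add[OF sm sm] by (simp add: e_add x distrib_right)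
  have 2: "chi x z (c *\<^sub>C a) = c * chi x z a" for c a
    unfolding chi_def suminf_mult[OF sm, symmetric] by (simp add: e_scaleC x mult.assoc)
  have 3: "chi x z (a * b) = chi x z a * chi x z b" for a b
  proof -
    have "chi x z a * chi x z b = (\<Sum>n. \<Sum>i\<le>n. (e i a x * z ^ i) * (e (n - i) b x * z ^ (n - i)))"
      unfolding chi_def by (intro Cauchy_product summable_chi_norm x)
    also have "\<dots> = chi x z (a * b)"
      unfolding chi_def e_mult[OF x(1)] fixpow sum_distrib_right
      by (intro suminf_cong sum.cong refl) (simp flip: power_add)
    finally show ?thesis ..
  qed
  have "chi x z 1 = 1"
    using chi_T[of "\<lambda>_. 1" x z] x \<iota>_one by simp
  with 1 2 3 show ?thesis
    by (simp add: character_on_def)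
qed

lemma uniform_limit_chi:
  assumes "r < rad" "0 \<le> r"
  shows "uniform_limit (X \<times> cball 0 r) (\<lambda>N (x, z). \<Sum>n<N. e n a x * z ^ n) (\<lambda>(x, z). chi x z a) sequentially"
proof -
  have "uniform_limit (X \<times> cball 0 r) (\<lambda>N p. \<Sum>n<N. e n a (fst p) * snd p ^ n)
      (\<lambda>p. \<Sum>n. e n a (fst p) * snd p ^ n) sequentially"
    using norm_chi_term_le
    by (intro Weierstrass_m_test[where M = "\<lambda>n. onorm (E n) * r ^ n * norm a"]
        summable_mult2 summable_onorm_E assms) auto
  then show ?thesis
    by (simp add: chi_def case_prod_unfold)
qed

lemma continuous_chi:
  assumes "r < rad" "0 \<le> r"
  shows "continuous_on (X \<times> cball 0 r) (\<lambda>(x, z). chi x z a)"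
proof (rule uniform_limit_theorem[OF _ uniform_limit_chi[OF assms]])
  have "continuous_on (X \<times> cball 0 r) (\<lambda>p. \<Sum>n<N. e n a (fst p) * snd p ^ n)" for N
    by (intro continuous_intros continuous_on_compose2[OF continuous_e]) auto
  then show "\<forall>\<^sub>F N in sequentially. continuous_on (X \<times> cball 0 r) (\<lambda>(x, z). \<Sum>n<N. e n a x * z ^ n)"
    by (simp add: case_prod_unfold)
qed simp

lemma holomorphic_chi:
  assumes "x \<in> X"
  shows "(\<lambda>z. chi x z a) holomorphic_on ball 0 rad"
  unfolding chi_def
proof (rule power_series_holomorphic)
  fix z :: complex assume "z \<in> ball 0 rad"
  then show "(\<lambda>n. e n a x * (z - 0) ^ n) sums (\<Sum>n. e n a x * z ^ n)"
    using summable_norm_cancel[OF summable_chi_norm[OF assms, of z a]] by (simp add: summable_sums)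
qed

end

section \<open>The subalgebra generated by A(K)\<close>

locale analytic_tca = topological_conjugacy_algebra K \<eta> \<iota> E0
  for K :: "complex set" and \<eta> :: "complex \<Rightarrow> complex"
    and \<iota> :: "(nat \<Rightarrow> complex \<Rightarrow> complex) \<Rightarrow> 'a::complex_banach_algebra" and E0 :: "'a \<Rightarrow> 'a" +
  assumes K: "K \<in> class_K" and holomorphic_\<eta>: "\<eta> holomorphic_on interior K"
begin

abbreviation "B \<equiv> tca_subalgebra K \<iota> (A_alg K)"

abbreviation "P \<equiv> {p \<in> skew_polys K. \<forall>n. p n \<in> A_alg K}"

lemma closed_B: "closed B" and subalgebra_B: "complex_subalgebra B"
proof -
  have "closed B \<and> complex_subalgebra B"
    unfolding tca_subalgebra_def
  proof (rule hull_in[where S = "\<lambda>B. closed B \<and> complex_subalgebra B"])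
    show "closed (\<Inter>\<T>) \<and> complex_subalgebra (\<Inter>\<T>)"
      if "\<forall>S\<in>\<T>. closed S \<and> complex_subalgebra S" for \<T> :: "'a set set"
      using that by (auto simp: complex_subalgebra_def intro: closed_Inter)
  qed
  then show "closed B" "complex_subalgebra B"
    by auto
qed

lemma \<iota>_P: "p \<in> P \<Longrightarrow> \<iota> p \<in> B"
  unfolding tca_subalgebra_def by (intro hull_inc) blast

lemma B_add: "a \<in> B \<Longrightarrow> b \<in> B \<Longrightarrow> a + b \<in> B"
  and B_mult: "a \<in> B \<Longrightarrow> b \<in> B \<Longrightarrow> a * b \<in> B"
  and B_zero: "0 \<in> B"
  using subalgebra_B by (auto simp: complex_subalgebra_def)

lemma skew_monom_P: "f \<in> A_alg K \<Longrightarrow> skew_monom f k \<in> P"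
proof -
  assume f: "f \<in> A_alg K"
  then have "skew_monom f k n \<in> A_alg K" for n
    by (cases "n = k") (simp_all add: skew_monom_def)
  then show ?thesis
    using f by (auto intro: skew_monom_mem A_alg_continuous)
qed

lemma T_B: "f \<in> A_alg K \<Longrightarrow> T f \<in> B"
  unfolding tca_fun_def by (intro \<iota>_P skew_monom_P)

lemma U_B: "U \<in> B"
  unfolding tca_U_def by (intro \<iota>_P skew_monom_P) simp

lemma one_B: "1 \<in> B"
  using T_B[of "\<lambda>_. 1"] \<iota>_one by simp

lemma \<eta>_A: "\<eta> \<in> A_alg K"
  using cont_\<eta> holomorphic_\<eta> by (rule A_algI)

lemma funpow_A: "(\<eta> ^^ n) \<in> A_alg K"
proof (induction n)
  case 0
  then show ?case by (simp add: id_def)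
next
  case (Suc n)
  have "(\<lambda>z. \<eta> ((\<eta> ^^ n) z)) \<in> A_alg K"
    using funpow_mem by (intro A_alg_compose[OF K Suc _ \<eta>_A]) auto
  then show ?case by (simp add: o_def)
qed

lemma P_vanishes:
  assumes "p \<in> P"
  obtains N where "\<And>n x. n > N \<Longrightarrow> x \<in> K \<Longrightarrow> p n x = 0"
  using assms unfolding skew_polys_def by blast

lemma skew_mult_P:
  assumes p: "p \<in> P" and q: "q \<in> P"
  shows "skew_mult \<eta> p q \<in> P"
proof -
  have A: "skew_mult \<eta> p q n \<in> A_alg K" for n
    unfolding skew_mult_def using p q funpow_mem
    by (intro A_alg_sum A_alg_mult A_alg_compose[OF K funpow_A, where L = K]) auto
  obtain M where M: "\<And>n x. n > M \<Longrightarrow> x \<in> K \<Longrightarrow> p n x = 0"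
    using P_vanishes[OF p] by blast
  obtain N where N: "\<And>n x. n > N \<Longrightarrow> x \<in> K \<Longrightarrow> q n x = 0"
    using P_vanishes[OF q] by blast
  have "skew_mult \<eta> p q n x = 0" if n: "n > M + N" and x: "x \<in> K" for n x
    unfolding skew_mult_def
  proof (intro sum.neutral ballI)
    fix i assume "i \<in> {..n}"
    show "p i x * q (n - i) ((\<eta> ^^ i) x) = 0"
    proof (cases "i > M")
      case False
      then have "n - i > N"
        using n by simp
      then show ?thesis
        using N funpow_mem[OF x] by simp
    qed (simp add: M x)
  qed
  then have "\<exists>N. \<forall>n>N. \<forall>x\<in>K. skew_mult \<eta> p q n x = 0"
    by blast
  then show ?thesis
    using A by (auto simp: skew_polys_def intro: A_alg_continuous)
qed

text \<open>The polynomials with coefficients in A(K) already form a subalgebra, because A(K) is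
  stable under composition with iterates of \<open>\<eta>\<close>. So the hull adds nothing beyond
  limits.\<close>

lemma B_subset_closure: "B \<subseteq> closure (\<iota> ` P)"
proof -
  have zero: "(\<lambda>_ _. 0) \<in> P"
    by (auto simp: skew_polys_def)
  have add: "(\<lambda>n x. p n x + q n x) \<in> P" if p: "p \<in> P" and q: "q \<in> P" for p q
  proof -
    obtain M where M: "\<And>n x. n > M \<Longrightarrow> x \<in> K \<Longrightarrow> p n x = 0"
      using P_vanishes[OF p] by blast
    obtain N where N: "\<And>n x. n > N \<Longrightarrow> x \<in> K \<Longrightarrow> q n x = 0"
      using P_vanishes[OF q] by blast
    from M N have "\<exists>N. \<forall>n>N. \<forall>x\<in>K. p n x + q n x = 0"
      by (intro exI[of _ "max M N"]) simp
    moreover have "(\<lambda>x. p n x + q n x) \<in> A_alg K" for n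
      using p q by (intro A_alg_add) auto
    ultimately show ?thesis
      unfolding skew_polys_def by (blast intro: A_alg_continuous)
  qed
  have scale: "(\<lambda>n x. c * p n x) \<in> P" if p: "p \<in> P" for p c
  proof -
    obtain N where N: "\<And>n x. n > N \<Longrightarrow> x \<in> K \<Longrightarrow> p n x = 0"
      using P_vanishes[OF p] by blast
    then have "\<forall>n>N. \<forall>x\<in>K. c * p n x = 0"
      by simp
    moreover have "(\<lambda>x. c * p n x) \<in> A_alg K" for n
      using p A_alg_mult[of "\<lambda>_. c" K "p n"] by simp
    ultimately show ?thesis
      unfolding skew_polys_def by (blast intro: A_alg_continuous)
  qed
  have "complex_subalgebra (\<iota> ` P)"
    unfolding complex_subalgebra_def
  proof (intro conjI ballI allI)
    have "\<iota> (\<lambda>_ _. 0) = 0"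
      using \<iota>_scale[where c = 0, of "\<lambda>_ _. 0"] zero by simp
    then show "0 \<in> \<iota> ` P"
      using zero by force
  next
    fix a b assume "a \<in> \<iota> ` P" "b \<in> \<iota> ` P"
    then obtain p q where pq: "p \<in> P" "a = \<iota> p" "q \<in> P" "b = \<iota> q"
      by blast
    show "a + b \<in> \<iota> ` P"
      using add[OF pq(1,3)] pq by (intro image_eqI[of _ _ "\<lambda>n x. p n x + q n x"]) (simp_all add: \<iota>_add)
    show "a * b \<in> \<iota> ` P"
      using skew_mult_P[OF pq(1,3)] pq by (intro image_eqI[of _ _ "skew_mult \<eta> p q"]) (simp_all add: \<iota>_mult)
  next
    fix c a assume "a \<in> \<iota> ` P"
    then obtain p where p: "p \<in> P" "a = \<iota> p"
      by blast
    show "c *\<^sub>C a \<in> \<iota> ` P"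
      using scale[OF p(1)] p by (intro image_eqI[of _ _ "\<lambda>n x. c * p n x"]) (simp_all add: \<iota>_scale)
  qed
  then show ?thesis
    unfolding tca_subalgebra_def
    by (intro hull_minimal conjI complex_subalgebra_closure closed_closure closure_subset)
qed

lemma B_sequence:
  assumes "a \<in> B"
  obtains p where "\<And>k::nat. p k \<in> P" "(\<lambda>k. \<iota> (p k)) \<longlonglongrightarrow> a"
proof -
  have "a \<in> closure (\<iota> ` P)"
    using assms B_subset_closure by blast
  then obtain s where s: "\<And>k::nat. s k \<in> \<iota> ` P" "s \<longlonglongrightarrow> a"
    by (auto simp: closure_sequential)
  then have "\<exists>p. p \<in> P \<and> s k = \<iota> p" for k
    by auto
  then obtain p where p: "\<And>k. p k \<in> P" "\<And>k. s k = \<iota> (p k)"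
    using choice[of "\<lambda>k p. p \<in> P \<and> s k = \<iota> p"] by blast
  have "s = (\<lambda>k. \<iota> (p k))"
    by (intro ext p(2))
  then have "(\<lambda>k. \<iota> (p k)) \<longlonglongrightarrow> a"
    using s(2) by simp
  then show ?thesis
    using p(1) that by blast
qed

lemma P_sum:
  assumes "p \<in> P"
  obtains N where "\<iota> p = (\<Sum>n<N. T (p n) * U ^ n)" "N > 0"
proof -
  obtain N where N: "\<And>n x. n > N \<Longrightarrow> x \<in> K \<Longrightarrow> p n x = 0"
    using P_vanishes[OF assms] by blast
  then have "\<iota> p = (\<Sum>n<Suc N. T (p n) * U ^ n)"
    using assms by (intro \<iota>_poly_sum) auto
  then show ?thesis
    using that by blast
qed

text \<open>On polynomials \<open>Q\<close> drops the constant term and lowers the powers of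
  \<open>U\<close> by one; continuity carries this to the closure.\<close>

lemma Q_B:
  assumes "a \<in> B"
  shows "Q a \<in> B"
proof -
  obtain p where p: "\<And>k::nat. p k \<in> P" "(\<lambda>k. \<iota> (p k)) \<longlonglongrightarrow> a"
    using B_sequence[OF assms] by blast
  have "Q (\<iota> q) \<in> B" if q: "q \<in> P" for q
  proof -
    obtain N where N: "\<iota> q = (\<Sum>n<N. T (q n) * U ^ n)"
      using P_sum[OF q] by blast
    have "Q (T (q n) * U ^ n) \<in> B" for n
    proof (cases n)
      case 0
      then show ?thesis
        using q by (simp add: Q_T A_alg_continuous B_zero)
    next
      case (Suc m)
      have "Q (T (q n) * U ^ n) = Q ((T (q n) * U ^ m) * U)"
        by (simp add: Suc power_commutes mult.assoc)
      also have "\<dots> = T (q n) * U ^ m"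
        by (rule Q_mult_U)
      finally show ?thesis
        using q by (simp add: B_mult T_B complex_subalgebra_power[OF subalgebra_B one_B U_B])
    qed
    then show ?thesis
      unfolding N linear_sum[OF linear_Q] by (intro complex_subalgebra_sum subalgebra_B)
  qed
  then show ?thesis
    using closed_sequentially[OF closed_B _ bounded_linear.tendsto[OF bounded_linear_Q p(2)]] p(1) by blast
qed

lemma character_on_B_\<iota>:
  assumes \<theta>: "character_on B \<theta>" and N: "\<iota> p = (\<Sum>n<N. T (p n) * U ^ n)" and p: "p \<in> P"
  shows "\<theta> (\<iota> p) = (\<Sum>n<N. \<theta> (T (p n)) * \<theta> U ^ n)"
proof -
  have Un: "U ^ n \<in> B" for n
    by (rule complex_subalgebra_power[OF subalgebra_B one_B U_B])
  have Tn: "T (p n) \<in> B" for n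
    using p by (intro T_B) auto
  have "\<theta> (\<iota> p) = (\<Sum>n<N. \<theta> (T (p n) * U ^ n))"
    unfolding N using Un Tn by (intro character_on_sum[OF \<theta> subalgebra_B] B_mult)
  also have "\<dots> = (\<Sum>n<N. \<theta> (T (p n)) * \<theta> U ^ n)"
    using Un Tn \<theta> character_on_power[OF \<theta> subalgebra_B one_B U_B]
    by (intro sum.cong refl) (simp add: character_on_def)
  finally show ?thesis .
qed

lemma character_on_subset: "character_on UNIV \<theta> \<Longrightarrow> character_on B \<theta>"
  by (simp add: character_on_def)

text \<open>The constant coefficients of approximating polynomials lie in A(K) and converge
  uniformly, because evaluations are contractive. Higher coefficients reduce to this, since
  \<open>Q\<close> preserves \<open>B\<close>.\<close>

lemma e_A:
  assumes "a \<in> B"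
  shows "e n a \<in> A_alg K"
  using assms
proof (induction n arbitrary: a)
  case 0
  obtain p where p: "\<And>k::nat. p k \<in> P" "(\<lambda>k. \<iota> (p k)) \<longlonglongrightarrow> a"
    using B_sequence[OF 0] by blast
  have p0: "e 0 (\<iota> q) x = q 0 x" if q: "q \<in> P" and x: "x \<in> K" for q x
  proof -
    obtain N where N: "\<iota> q = (\<Sum>n<N. T (q n) * U ^ n)" "N > 0"
      using P_sum[OF q] by blast
    have "e 0 (\<iota> q) x = (\<Sum>n<N. e 0 (T (q n)) x * e 0 U x ^ n)"
      by (rule character_on_B_\<iota>[OF character_on_subset[OF e_0_character[OF x]] N(1) q])
    also have "\<dots> = (\<Sum>n<N. if n = 0 then q 0 x else 0)"
      using q x by (intro sum.cong refl) (auto simp: e_T e_U A_alg_continuous)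
    finally show ?thesis
      using N(2) by simp
  qed
  have "uniform_limit K (\<lambda>k. p k 0) (e 0 a) sequentially"
  proof (rule uniform_limitI)
    fix \<epsilon> :: real assume "\<epsilon> > 0"
    then have "\<forall>\<^sub>F k in sequentially. dist (\<iota> (p k)) a < \<epsilon>"
      using p(2) by (rule tendstoD[rotated])
    then show "\<forall>\<^sub>F k in sequentially. \<forall>x\<in>K. dist (p k 0 x) (e 0 a x) < \<epsilon>"
    proof eventually_elim
      case (elim k)
      show ?case
      proof
        fix x assume x: "x \<in> K"
        have "norm (e 0 (\<iota> (p k) - a) x) \<le> norm (\<iota> (p k) - a)"
          using character_on_norm_le[OF e_0_character[OF x] complex_subalgebra_UNIV] by simp
        then show "dist (p k 0 x) (e 0 a x) < \<epsilon>"
          using elim character_on_diff[OF e_0_character[OF x] complex_subalgebra_UNIV, of "\<iota> (p k)" a]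
            p0[OF p(1) x, of k] by (simp add: dist_norm)
      qed
    qed
  qed
  then show ?case
    by (rule A_alg_uniform_limit[rotated]) (use p(1) in blast)
next
  case (Suc n)
  have "e (Suc n) a = e n (Q a)"
    by (simp add: fun_eq_iff e_Suc)
  then show ?case
    using Suc.IH[OF Q_B[OF Suc.prems]] by simp
qed

lemma chi_A:
  assumes "a \<in> B" "norm z < rad"
  shows "(\<lambda>x. chi x z a) \<in> A_alg K"
proof (rule A_alg_uniform_limit)
  show "(\<lambda>x. \<Sum>n<N. e n a x * z ^ n) \<in> A_alg K" for N
    using assms by (intro A_alg_sum A_alg_mult e_A A_alg_const)
  have "uniform_limit (K \<times> cball 0 (norm z)) (\<lambda>N (x, z). \<Sum>n<N. e n a x * z ^ n) (\<lambda>(x, z). chi x z a) sequentially"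
    using assms by (intro uniform_limit_chi) auto
  then show "uniform_limit K (\<lambda>N x. \<Sum>n<N. e n a x * z ^ n) (\<lambda>x. chi x z a) sequentially"
    unfolding uniform_limit_iff by (auto elim!: eventually_mono)
qed

lemma chi_0_A: "a \<in> B \<Longrightarrow> (\<lambda>x. chi x 0 a) \<in> A_alg K"
  using e_A[of a 0] by (simp add: chi_0)

lemma continuous_chi_interior:
  "continuous_on (interior K \<times> ball 0 rad) (\<lambda>(x, z). chi x z a)"
proof -
  have "continuous_on (\<Union>r\<in>{0<..<rad}. interior K \<times> ball 0 r) (\<lambda>(x, z). chi x z a)"
  proof (rule continuous_on_open_UN)
    show "continuous_on (interior K \<times> ball 0 r) (\<lambda>(x, z). chi x z a)" if "r \<in> {0<..<rad}" for r
      using that interior_subset[of K] by (intro continuous_on_subset[OF continuous_chi[of r]]) auto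
  qed (auto intro: open_Times)
  moreover have "(\<Union>r\<in>{0<..<rad}. interior K \<times> ball 0 r) = interior K \<times> ball (0::complex) rad"
  proof -
    have "\<exists>r. 0 < r \<and> r < rad \<and> norm z < r" if "norm z < rad" for z :: complex
      using dense[OF that] norm_ge_zero[of z] by (meson le_less_trans)
    then show ?thesis by force
  qed
  ultimately show ?thesis by simp
qed

section \<open>Characters of the generated subalgebra\<close>

lemma T_diff: "continuous_on K f \<Longrightarrow> continuous_on K g \<Longrightarrow> T (\<lambda>x. f x - g x) = T f - T g"
  using T_add[of f "\<lambda>x. - 1 * g x"] T_scale[of g "- 1"]
  by (simp add: scaleC_minus_one continuous_on_minus)

lemma T_const: "T (\<lambda>_. c) = c *\<^sub>C 1"
  using T_scale[of "\<lambda>_. 1" c] \<iota>_one by simp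

lemma character_on_B_T:
  assumes \<theta>: "character_on B \<theta>" and f: "f \<in> A_alg K"
  shows "\<theta> (T (\<lambda>z. z)) \<in> K" "\<theta> (T f) = f (\<theta> (T (\<lambda>z. z)))"
proof -
  interpret A_alg_character K "\<lambda>f. \<theta> (T f)"
  proof
    show "\<theta> (T f) = \<theta> (T g)" if "f \<in> A_alg K" "g \<in> A_alg K" "\<And>z. z \<in> K \<Longrightarrow> f z = g z" for f g
      using T_eq_iff[of f g] that by (simp add: A_alg_continuous)
    show "\<theta> (T (\<lambda>_. c)) = c" for c
      using \<theta> one_B by (simp add: T_const character_on_def)
    show "\<theta> (T (\<lambda>z. f z - g z)) = \<theta> (T f) - \<theta> (T g)" if "f \<in> A_alg K" "g \<in> A_alg K" for f g
      using that by (simp add: T_diff A_alg_continuous character_on_diff[OF \<theta> subalgebra_B] T_B)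
    show "\<theta> (T (\<lambda>z. f z * g z)) = \<theta> (T f) * \<theta> (T g)" if "f \<in> A_alg K" "g \<in> A_alg K" for f g
      using that \<theta> by (simp add: T_mult A_alg_continuous T_B character_on_def)
  qed (rule K)
  show "\<theta> (T (\<lambda>z. z)) \<in> K"
    using mem_image[of "\<lambda>z. z"] by simp
  show "\<theta> (T f) = f (\<theta> (T (\<lambda>z. z)))"
    using f by (rule eq_evaluation)
qed

text \<open>The first bound is contractivity on all powers of \<open>U\<close>. The second follows
  from \<open>U * T f = T (f \<circ> \<eta>) * U\<close> for the coordinate function, after
  cancelling \<open>\<theta> U\<close>.\<close>

lemma character_on_B_U:
  assumes \<theta>: "character_on B \<theta>"
  shows "norm (\<theta> U) \<le> rad" "\<theta> U \<noteq> 0 \<Longrightarrow> \<eta> (\<theta> (T (\<lambda>z. z))) = \<theta> (T (\<lambda>z. z))"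
proof -
  show "norm (\<theta> U) \<le> rad"
  proof (rule le_rad)
    fix n :: nat assume n: "n > 0"
    have "norm (\<theta> U) ^ n = norm (\<theta> (U ^ n))"
      by (simp add: character_on_power[OF \<theta> subalgebra_B one_B U_B] norm_power)
    also have "\<dots> \<le> norm (U ^ n)"
      by (intro character_on_norm_le[OF \<theta> subalgebra_B closed_B one_B]
          complex_subalgebra_power[OF subalgebra_B one_B U_B])
    finally show "norm (\<theta> U) \<le> root n (norm (U ^ n))"
      using n by (metis norm_ge_zero real_root_le_mono real_root_power_cancel)
  qed
  have "\<theta> (U * T (\<lambda>z. z)) = \<theta> (T \<eta> * U)"
    by (simp add: U_T)
  then have "\<theta> U * \<theta> (T (\<lambda>z. z)) = \<theta> (T \<eta>) * \<theta> U"
    using \<theta> U_B T_B[OF \<eta>_A] T_B[of "\<lambda>z. z"] by (simp add: character_on_def)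
  then show "\<theta> U \<noteq> 0 \<Longrightarrow> \<eta> (\<theta> (T (\<lambda>z. z))) = \<theta> (T (\<lambda>z. z))"
    using character_on_B_T(2)[OF \<theta> \<eta>_A] by simp
qed

lemma character_on_B_eqI:
  assumes \<theta>: "character_on B \<theta>" "character_on B \<phi>"
    and eq: "\<theta> (T (\<lambda>z. z)) = \<phi> (T (\<lambda>z. z))" "\<theta> U = \<phi> U" and a: "a \<in> B"
  shows "\<theta> a = \<phi> a"
proof (rule character_on_eq_closure[OF \<theta> subalgebra_B closed_B one_B])
  show "\<iota> ` P \<subseteq> B"
    using \<iota>_P by blast
  show "a \<in> B" "a \<in> closure (\<iota> ` P)"
    using a B_subset_closure by auto
  fix b assume "b \<in> \<iota> ` P"
  then obtain p where p: "p \<in> P" "b = \<iota> p"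
    by blast
  obtain N where N: "\<iota> p = (\<Sum>n<N. T (p n) * U ^ n)"
    using P_sum[OF p(1)] by blast
  have "\<theta> (T (p n)) = \<phi> (T (p n))" for n
    using p(1) eq(1) character_on_B_T(2)[OF \<theta>(1), of "p n"] character_on_B_T(2)[OF \<theta>(2), of "p n"] by simp
  then show "\<theta> b = \<phi> b"
    using character_on_B_\<iota>[OF \<theta>(1) N p(1)] character_on_B_\<iota>[OF \<theta>(2) N p(1)] eq(2) p(2) by simp
qed

lemma character_chi_B: "admissible x z \<Longrightarrow> character_on B (chi x z)"
  by (intro character_on_subset character_chi)

lemma B_decompose: "a \<in> B \<Longrightarrow> a = T (e 0 a) + Q a * U"
  using Q_eq[of a] by (simp add: T_e0)

end

section \<open>Isomorphisms and the induced maps of character spaces\<close>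

text \<open>For the identity map skew polynomials multiply like ordinary ones, and the density of
  the polynomials extends commutativity to the whole algebra.\<close>

lemma (in topological_conjugacy_algebra) commute_of_id:
  fixes a b :: 'a
  assumes "\<And>x. x \<in> X \<Longrightarrow> \<eta> x = x"
  shows "a * b = b * a"
proof -
  have pow: "(\<eta> ^^ n) x = x" if "x \<in> X" for n x
    by (induction n) (simp_all add: assms that)
  have comm: "\<iota> p * \<iota> q = \<iota> q * \<iota> p" if p: "p \<in> skew_polys X" and q: "q \<in> skew_polys X" for p q
  proof -
    have sum: "\<exists>N. \<iota> r = (\<Sum>n<Suc N. \<iota> (skew_monom (r n) n))" if r: "r \<in> skew_polys X" for r
    proof -
      obtain N where N: "\<forall>n>N. \<forall>x\<in>X. r n x = 0" and c: "\<And>n. continuous_on X (r n)"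
        using r unfolding skew_polys_def by blast
      have "\<iota> r = (\<Sum>n<Suc N. T (r n) * U ^ n)"
        using N by (intro \<iota>_poly_sum r) auto
      then show ?thesis
        using c by (auto simp: \<iota>_monom)
    qed
    obtain M where M: "\<iota> p = (\<Sum>n<Suc M. \<iota> (skew_monom (p n) n))"
      using sum[OF p] by blast
    obtain N where N: "\<iota> q = (\<Sum>n<Suc N. \<iota> (skew_monom (q n) n))"
      using sum[OF q] by blast
    have "\<iota> (skew_monom (p i) i) * \<iota> (skew_monom (q j) j) =
        \<iota> (skew_monom (q j) j) * \<iota> (skew_monom (p i) i)" for i j
    proof -
      have c: "continuous_on X (p i)" "continuous_on X (q j)"
        using p q by (auto simp: skew_polys_def)
      have "continuous_on X (\<lambda>x. p i x * q j ((\<eta> ^^ i) x))"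
        using continuous_on_mult[OF c] by (rule continuous_on_eq) (simp add: pow)
      moreover have "continuous_on X (\<lambda>x. q j x * p i ((\<eta> ^^ j) x))"
        using continuous_on_mult[OF c(2,1)] by (rule continuous_on_eq) (simp add: pow)
      ultimately show ?thesis
        using c by (simp add: \<iota>_monom_mult \<iota>_eq_iff skew_monom_mem) (auto simp: skew_monom_def pow)
    qed
    then show ?thesis
      unfolding M N sum_product by (subst sum.swap) (intro sum.cong refl, simp)
  qed
  have "(a, b) \<in> closure ((\<iota> ` skew_polys X) \<times> (\<iota> ` skew_polys X))"
    using \<iota>_dense by (simp add: closure_Times)
  moreover have "closed {(a, b). a * b = b * (a::'a)}"
    by (simp add: case_prod_unfold) (intro closed_Collect_eq continuous_intros)
  ultimately show ?thesis
    using comm closure_minimal[of "(\<iota> ` skew_polys X) \<times> (\<iota> ` skew_polys X)" "{(a, b). a * b = b * a}"]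
    by auto
qed

lemma disc_chart:
  assumes K: "compact K" and f: "f \<in> A_alg K" "inj_on f K" "f ` K = cball 0 r"
  obtains g where "homeomorphism K (cball 0 r) f g" "g holomorphic_on ball 0 r"
    "g ` ball 0 r \<subseteq> interior K" "f ` interior K \<subseteq> ball 0 r"
proof -
  obtain g where g: "homeomorphism K (cball 0 r) f g"
    using homeomorphism_compact[OF K A_alg_continuous[OF f(1)] f(3,2)] by blast
  have inj: "inj_on f (interior K)"
    using f(2) interior_subset inj_on_subset by blast
  have "open (f ` interior K)"
    by (rule open_mapping_thm3[OF A_alg_holomorphic[OF f(1)] open_interior inj])
  then have sub: "f ` interior K \<subseteq> ball 0 r"
    using interior_maximal[of "f ` interior K" "cball 0 r"] f(3) interior_subset[of K] by auto
  \<comment> \<open>Invariance of domain places the image of the open disc in the interior of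
    \<open>K\<close>, where \<open>g\<close> agrees with the holomorphic inverse of
    \<open>f\<close>.\<close>
  have "open (g ` ball 0 r)"
  proof (rule invariance_of_domain)
    show "continuous_on (ball 0 r) g"
      using g by (auto simp: homeomorphism_def intro: continuous_on_subset[OF _ ball_subset_cball])
    show "inj_on g (ball 0 r)"
      using g by (intro inj_on_inverseI[of _ f]) (auto simp: homeomorphism_def)
  qed simp
  moreover have "g ` ball 0 r \<subseteq> K"
    using g by (auto simp: homeomorphism_def)
  ultimately have gi: "g ` ball 0 r \<subseteq> interior K"
    by (rule interior_maximal[rotated])
  obtain h where h: "h holomorphic_on f ` interior K" "\<And>z. z \<in> interior K \<Longrightarrow> h (f z) = z"
    using holomorphic_has_inverse[OF A_alg_holomorphic[OF f(1)] open_interior inj] by metis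
  have fg: "f (g w) = w" if "w \<in> ball 0 r" for w
    using g that by (auto simp: homeomorphism_def)
  have "ball 0 r \<subseteq> f ` interior K"
    using gi fg by (metis image_eqI image_subset_iff subsetI)
  moreover have "h w = g w" if "w \<in> ball 0 r" for w
    using h(2)[of "g w"] subsetD[OF gi imageI[OF that]] fg[OF that] by simp
  ultimately have "g holomorphic_on ball 0 r"
    using holomorphic_transform[OF holomorphic_on_subset[OF h(1)]] by blast
  with g gi sub show ?thesis
    using that by blast
qed

text \<open>In the disc charts both maps become multiplication by the same \<open>c\<close>, which
  commutes with the dilation between the two discs.\<close>

lemma analytically_conjugate_discs:
  assumes K: "compact K1" "compact K2"
    and f1: "f1 \<in> A_alg K1" "inj_on f1 K1" "f1 ` K1 = cball 0 r1" "r1 > 0"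
    and f2: "f2 \<in> A_alg K2" "inj_on f2 K2" "f2 ` K2 = cball 0 r2" "r2 > 0"
    and eta: "\<And>z. z \<in> K1 \<Longrightarrow> \<eta>1 z \<in> K1" "\<And>z. z \<in> K2 \<Longrightarrow> \<eta>2 z \<in> K2"
    and conj: "\<And>z. z \<in> K1 \<Longrightarrow> f1 (\<eta>1 z) = c * f1 z" "\<And>z. z \<in> K2 \<Longrightarrow> f2 (\<eta>2 z) = c * f2 z"
  shows "analytically_conjugate K1 \<eta>1 K2 \<eta>2"
proof -
  obtain g1 where g1: "homeomorphism K1 (cball 0 r1) f1 g1" "f1 ` interior K1 \<subseteq> ball 0 r1"
    by (rule disc_chart[OF K(1) f1(1-3)])
  obtain g2 where g2: "homeomorphism K2 (cball 0 r2) f2 g2" "g2 holomorphic_on ball 0 r2"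
    by (rule disc_chart[OF K(2) f2(1-3)])
  define s where "s = complex_of_real (r2 / r1)"
  have s: "s \<noteq> 0" "norm s * r1 = r2"
    using f1(4) f2(4) by (auto simp: s_def norm_divide)
  have "homeomorphism (cball 0 r1) (cball 0 r2) (\<lambda>z. s * z) (\<lambda>z. z / s)"
  proof (rule homeomorphismI)
    show "(\<lambda>z. s * z) ` cball 0 r1 \<subseteq> cball 0 r2"
      using s f1(4) by (auto simp: norm_mult intro!: mult_left_mono simp flip: s(2))
    show "(\<lambda>z. z / s) ` cball 0 r2 \<subseteq> cball 0 r1"
      using s f1(4) by (auto simp: norm_divide divide_le_eq mult.commute simp flip: s(2))
  qed (use s in \<open>auto intro!: continuous_intros\<close>)
  then have hom: "homeomorphism K1 K2 (g2 \<circ> ((\<lambda>z. s * z) \<circ> f1)) ((g1 \<circ> (\<lambda>z. z / s)) \<circ> f2)"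
    using homeomorphism_compose[OF homeomorphism_compose[OF g1(1)] homeomorphism_symD[OF g2(1)]]
    by (simp add: o_assoc)
  have hol: "(g2 \<circ> ((\<lambda>z. s * z) \<circ> f1)) holomorphic_on interior K1"
  proof (rule holomorphic_on_compose_gen[OF _ g2(2)])
    show "(\<lambda>z. s * z) \<circ> f1 holomorphic_on interior K1"
      using A_alg_holomorphic[OF f1(1)] by (auto simp: o_def intro!: holomorphic_intros)
    show "((\<lambda>z. s * z) \<circ> f1) ` interior K1 \<subseteq> ball 0 r2"
      using g1(2) s(1) by (force simp: norm_mult simp flip: s(2) intro!: mult_strict_left_mono)
  qed
  have "(g2 \<circ> ((\<lambda>z. s * z) \<circ> f1)) (\<eta>1 z) = \<eta>2 ((g2 \<circ> ((\<lambda>z. s * z) \<circ> f1)) z)" if z: "z \<in> K1" for z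
  proof -
    let ?w = "g2 (s * f1 z)" and ?v = "g2 (s * f1 (\<eta>1 z))"
    have mem: "s * f1 y \<in> cball 0 r2" if "y \<in> K1" for y
    proof -
      have "f1 y \<in> cball 0 r1"
        using f1(3) that by blast
      then show ?thesis
        using s(1) by (auto simp: norm_mult simp flip: s(2) intro!: mult_left_mono)
    qed
    have g2D: "g2 y \<in> K2" "f2 (g2 y) = y" if "y \<in> cball 0 r2" for y
      using g2(1) that by (auto simp: homeomorphism_def)
    have w: "?w \<in> K2" "f2 ?w = s * f1 z" and v: "?v \<in> K2" "f2 ?v = s * f1 (\<eta>1 z)"
      using g2D mem[OF z] mem[OF eta(1)[OF z]] by blast+
    have "f2 ?v = f2 (\<eta>2 ?w)"
      using v w conj(1)[OF z] conj(2)[OF w(1)] by simp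
    then have "?v = \<eta>2 ?w"
      using inj_onD[OF f2(2)] v(1) eta(2)[OF w(1)] by blast
    then show ?thesis by simp
  qed
  with hom hol show ?thesis
    unfolding analytically_conjugate_def by blast
qed

lemma holomorphic_max_modulus_constant:
  assumes f: "f holomorphic_on S" "open S" "connected S" and w: "w \<in> S" and le: "\<And>z. z \<in> S \<Longrightarrow> norm (f z) \<le> norm (f w)"
    and z: "z \<in> S"
  shows "f z = f w"
  using maximum_modulus_principle[OF f f(2) order_refl w le] w z by (auto simp: constant_on_def)

text \<open>Both directions are parameters, so that every lemma can be used again with the two sides
  exchanged.\<close>

locale tca_isomorphism =
  one: analytic_tca K1 \<eta>1 \<iota>1 E1 + two: analytic_tca K2 \<eta>2 \<iota>2 E2
  for K1 K2 :: "complex set" and \<eta>1 \<eta>2 :: "complex \<Rightarrow> complex"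
    and \<iota>1 :: "(nat \<Rightarrow> complex \<Rightarrow> complex) \<Rightarrow> 'a::complex_banach_algebra"
    and \<iota>2 :: "(nat \<Rightarrow> complex \<Rightarrow> complex) \<Rightarrow> 'b::complex_banach_algebra"
    and E1 :: "'a \<Rightarrow> 'a" and E2 :: "'b \<Rightarrow> 'b" +
  fixes \<Phi> :: "'a \<Rightarrow> 'b" and \<Psi> :: "'b \<Rightarrow> 'a"
  assumes \<Phi>_hom: "complex_algebra_hom_on one.B \<Phi>" and \<Psi>_hom: "complex_algebra_hom_on two.B \<Psi>"
    and \<Phi>_B: "a \<in> one.B \<Longrightarrow> \<Phi> a \<in> two.B" and \<Psi>_B: "b \<in> two.B \<Longrightarrow> \<Psi> b \<in> one.B"
    and \<Psi>_\<Phi>: "a \<in> one.B \<Longrightarrow> \<Psi> (\<Phi> a) = a" and \<Phi>_\<Psi>: "b \<in> two.B \<Longrightarrow> \<Phi> (\<Psi> b) = b"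
begin

lemma swapped: "tca_isomorphism K2 K1 \<eta>2 \<eta>1 \<iota>2 \<iota>1 E2 E1 \<Psi> \<Phi>"
  by unfold_locales (fact \<Phi>_hom \<Psi>_hom \<Phi>_B \<Psi>_B \<Psi>_\<Phi> \<Phi>_\<Psi>)+

lemma \<Phi>_add: "a \<in> one.B \<Longrightarrow> b \<in> one.B \<Longrightarrow> \<Phi> (a + b) = \<Phi> a + \<Phi> b"
  and \<Phi>_scaleC: "a \<in> one.B \<Longrightarrow> \<Phi> (c *\<^sub>C a) = c *\<^sub>C \<Phi> a"
  and \<Phi>_mult: "a \<in> one.B \<Longrightarrow> b \<in> one.B \<Longrightarrow> \<Phi> (a * b) = \<Phi> a * \<Phi> b"
  using \<Phi>_hom by (auto simp: complex_algebra_hom_on_def)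

lemma \<Phi>_one: "\<Phi> 1 = 1"
proof -
  have "\<Phi> (\<Psi> 1 * 1) = \<Phi> (\<Psi> 1) * \<Phi> 1"
    by (intro \<Phi>_mult \<Psi>_B one.one_B two.one_B)
  then show ?thesis
    by (simp add: \<Phi>_\<Psi> two.one_B)
qed

lemma character_on_compose_\<Phi>:
  "character_on two.B \<theta> \<Longrightarrow> character_on one.B (\<lambda>a. \<theta> (\<Phi> a))"
  by (simp add: character_on_def \<Phi>_one \<Phi>_add \<Phi>_mult \<Phi>_scaleC \<Phi>_B)

lemma character_chi_\<Phi>: "two.admissible x z \<Longrightarrow> character_on one.B (\<lambda>a. two.chi x z (\<Phi> a))"
  by (intro character_on_compose_\<Phi> two.character_chi_B)

definition \<gamma> :: "complex \<Rightarrow> complex \<Rightarrow> complex" where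
  "\<gamma> x z = two.chi x z (\<Phi> (one.T (\<lambda>z. z)))"

definition \<mu> :: "complex \<Rightarrow> complex \<Rightarrow> complex" where
  "\<mu> x z = two.chi x z (\<Phi> one.U)"

lemma id_B: "one.T (\<lambda>z. z) \<in> one.B"
  by (intro one.T_B A_alg_id)

lemma \<gamma>_mem: "two.admissible x z \<Longrightarrow> \<gamma> x z \<in> K1"
  unfolding \<gamma>_def by (rule one.character_on_B_T(1)[OF character_chi_\<Phi>]) (auto intro: A_alg_id)

lemma \<mu>_le: "two.admissible x z \<Longrightarrow> norm (\<mu> x z) \<le> one.rad"
  unfolding \<mu>_def by (rule one.character_on_B_U(1)[OF character_chi_\<Phi>])

lemma \<mu>_nonzero: "two.admissible x z \<Longrightarrow> \<mu> x z \<noteq> 0 \<Longrightarrow> \<eta>1 (\<gamma> x z) = \<gamma> x z"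
  unfolding \<mu>_def \<gamma>_def by (rule one.character_on_B_U(2)[OF character_chi_\<Phi>])

lemma chi_\<Phi>_T: "two.admissible x z \<Longrightarrow> f \<in> A_alg K1 \<Longrightarrow> two.chi x z (\<Phi> (one.T f)) = f (\<gamma> x z)"
  unfolding \<gamma>_def by (rule one.character_on_B_T(2)[OF character_chi_\<Phi>])

text \<open>The pulled-back character agrees with \<open>one.chi\<close> on the coordinate function
  and on \<open>U\<close>, hence on \<open>one.B\<close>. Admissibility of the image point is a
  separate hypothesis because \<open>\<mu>\<close> might reach the circle of radius
  \<open>one.rad\<close>.\<close>

lemma chi_\<Phi>:
  assumes x: "two.admissible x z" and y: "one.admissible (\<gamma> x z) (\<mu> x z)" and a: "a \<in> one.B"
  shows "two.chi x z (\<Phi> a) = one.chi (\<gamma> x z) (\<mu> x z) a"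
proof (rule one.character_on_B_eqI[OF character_chi_\<Phi>[OF x] one.character_chi_B[OF y] _ _ a])
  have "\<gamma> x z \<in> K1"
    using y by (simp add: one.admissible_def)
  then show "two.chi x z (\<Phi> (one.T (\<lambda>z. z))) = one.chi (\<gamma> x z) (\<mu> x z) (one.T (\<lambda>z. z))"
    "two.chi x z (\<Phi> one.U) = one.chi (\<gamma> x z) (\<mu> x z) one.U"
    by (simp_all add: one.chi_T one.chi_U \<gamma>_def \<mu>_def)
qed

text \<open>Characters of \<open>one.B\<close> are separated by their values on the coordinate
  function and on \<open>U\<close>. As \<open>\<Phi>\<close> is onto \<open>two.B\<close>, equal
  images come from equal characters, without admissibility of the image point.\<close>

lemma \<gamma>_\<mu>_inject:
  assumes x: "two.admissible x z" and x': "two.admissible x' z'"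
    and eq: "\<gamma> x z = \<gamma> x' z'" "\<mu> x z = \<mu> x' z'"
  shows "x = x'" "z = z'"
proof -
  have "two.chi x z b = two.chi x' z' b" if b: "b \<in> two.B" for b
  proof -
    have "two.chi x z (\<Phi> (\<Psi> b)) = two.chi x' z' (\<Phi> (\<Psi> b))"
      by (rule one.character_on_B_eqI[OF character_chi_\<Phi>[OF x] character_chi_\<Phi>[OF x']])
        (use eq \<Psi>_B[OF b] in \<open>simp_all add: \<gamma>_def \<mu>_def\<close>)
    then show ?thesis
      using b by (simp add: \<Phi>_\<Psi>)
  qed
  from this[OF two.T_B[OF A_alg_id]] this[OF two.U_B] show "x = x'" "z = z'"
    using x x' by (simp_all add: two.admissible_def two.chi_T two.chi_U)
qed

lemma admissible_zero: "x \<in> K2 \<Longrightarrow> two.admissible x 0"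
  by (simp add: two.admissible_def)

lemma \<gamma>_A: "(\<lambda>x. \<gamma> x 0) \<in> A_alg K2" and \<mu>_A: "(\<lambda>x. \<mu> x 0) \<in> A_alg K2"
  unfolding \<gamma>_def \<mu>_def by (intro two.chi_0_A \<Phi>_B id_B one.U_B)+

lemma \<gamma>_A': "norm z < two.rad \<Longrightarrow> (\<lambda>x. \<gamma> x z) \<in> A_alg K2"
  and \<mu>_A': "norm z < two.rad \<Longrightarrow> (\<lambda>x. \<mu> x z) \<in> A_alg K2"
  unfolding \<gamma>_def \<mu>_def by (intro two.chi_A \<Phi>_B id_B one.U_B; assumption)+

lemma \<gamma>_holomorphic: "x \<in> K2 \<Longrightarrow> (\<lambda>z. \<gamma> x z) holomorphic_on ball 0 two.rad"
  and \<mu>_holomorphic: "x \<in> K2 \<Longrightarrow> (\<lambda>z. \<mu> x z) holomorphic_on ball 0 two.rad"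
  unfolding \<gamma>_def \<mu>_def by (intro two.holomorphic_chi; assumption)+

lemma e0_\<Phi>_U: "two.e 0 (\<Phi> one.U) x = \<mu> x 0"
  and e0_\<Phi>_T: "x \<in> K2 \<Longrightarrow> f \<in> A_alg K1 \<Longrightarrow> two.e 0 (\<Phi> (one.T f)) x = f (\<gamma> x 0)"
  using chi_\<Phi>_T[OF admissible_zero] by (simp_all add: \<mu>_def flip: two.chi_0)

lemma e1_mult:
  "x \<in> K2 \<Longrightarrow> two.e 1 (a * b) x = two.e 0 a x * two.e 1 b x + two.e 1 a x * two.e 0 b (\<eta>2 x)"
  by (simp add: two.e_mult)

end

context tca_isomorphism
begin

interpretation swap: tca_isomorphism K2 K1 \<eta>2 \<eta>1 \<iota>2 \<iota>1 E2 E1 \<Psi> \<Phi>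
  by (rule swapped)

lemma inverse_point:
  assumes x: "two.admissible x z" and y: "one.admissible (\<gamma> x z) (\<mu> x z)"
  shows "swap.\<gamma> (\<gamma> x z) (\<mu> x z) = x" "swap.\<mu> (\<gamma> x z) (\<mu> x z) = z"
proof -
  have "x \<in> K2"
    using x by (simp add: two.admissible_def)
  then show "swap.\<gamma> (\<gamma> x z) (\<mu> x z) = x" "swap.\<mu> (\<gamma> x z) (\<mu> x z) = z"
    unfolding swap.\<gamma>_def swap.\<mu>_def
    by (simp_all add: \<Phi>_\<Psi> \<Psi>_B two.U_B two.T_B two.chi_T two.chi_U flip: chi_\<Phi>[OF x y])
qed

end

section \<open>Preserved zero sections, and constancy of \<open>\<gamma>\<close> otherwise\<close>

context tca_isomorphism
begin

interpretation swap: tca_isomorphism K2 K1 \<eta>2 \<eta>1 \<iota>2 \<iota>1 E2 E1 \<Psi> \<Phi>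
  by (rule swapped)

text \<open>The two maps \<open>\<gamma>\<close> on the zero sections are mutually inverse. For the
  conjugacy, compare first coefficients in the image under \<open>\<Psi>\<close> of the relation
  between \<open>two.U\<close> and the coordinate function: as the constant coefficient of
  \<open>\<Psi> two.U\<close> vanishes, its first coefficient can be factored out. That coefficient
  has no zero because \<open>one.U\<close> is a left multiple of
  \<open>\<Psi> two.U\<close>.\<close>

lemma conjugate_of_\<mu>_zero:
  assumes \<mu>0: "\<And>x. x \<in> K2 \<Longrightarrow> \<mu> x 0 = 0" and \<mu>0': "\<And>y. y \<in> K1 \<Longrightarrow> swap.\<mu> y 0 = 0"
  shows "analytically_conjugate K1 \<eta>1 K2 \<eta>2"
proof -
  let ?g = "\<lambda>y. swap.\<gamma> y 0"
  have inv1: "?g (\<gamma> x 0) = x" if "x \<in> K2" for x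
    using inverse_point(1)[OF admissible_zero[OF that]] \<mu>0[OF that]
      swap.admissible_zero[OF \<gamma>_mem[OF admissible_zero[OF that]]] by simp
  have inv2: "\<gamma> (?g y) 0 = y" if "y \<in> K1" for y
    using swap.inverse_point(1)[OF swap.admissible_zero[OF that]] \<mu>0'[OF that]
      admissible_zero[OF swap.\<gamma>_mem[OF swap.admissible_zero[OF that]]] by simp
  have hom: "homeomorphism K1 K2 ?g (\<lambda>x. \<gamma> x 0)"
    using inv1 inv2 \<gamma>_mem[OF admissible_zero] swap.\<gamma>_mem[OF swap.admissible_zero]
    by (intro homeomorphismI A_alg_continuous \<gamma>_A swap.\<gamma>_A) auto
  define b where "b = two.Q (\<Phi> one.U)"
  have b: "b \<in> two.B"
    unfolding b_def by (intro two.Q_B \<Phi>_B one.U_B)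
  have "\<Phi> one.U = b * two.U"
  proof -
    have "\<forall>x\<in>K2. two.e 0 (\<Phi> one.U) x = 0"
      using \<mu>0 by (simp add: e0_\<Phi>_U)
    then have "two.T (two.e 0 (\<Phi> one.U)) = two.T (\<lambda>_. 0)"
      by (subst two.T_eq_iff) (auto intro: two.continuous_e)
    then show ?thesis
      using two.B_decompose[OF \<Phi>_B[OF one.U_B]] by (simp add: two.T_const b_def)
  qed
  then have U: "one.U = \<Psi> b * \<Psi> two.U"
    using swap.\<Phi>_mult[OF b two.U_B] \<Psi>_\<Phi>[OF one.U_B] by simp
  have "?g (\<eta>1 y) = \<eta>2 (?g y)" if y: "y \<in> K1" for y
  proof -
    have \<eta>y: "\<eta>1 y \<in> K1"
      using one.\<eta>_into y by auto
    have "1 = one.e 1 (\<Psi> b * \<Psi> two.U) y"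
      using y by (simp add: one.e_U flip: U)
    also have "\<dots> = one.e 0 (\<Psi> b) y * one.e 1 (\<Psi> two.U) y"
      using \<mu>0'[OF \<eta>y] by (simp only: swap.e1_mult[OF y] swap.e0_\<Phi>_U) simp
    finally have nz: "one.e 1 (\<Psi> two.U) y \<noteq> 0"
      by auto
    have "\<Psi> two.U * \<Psi> (two.T (\<lambda>z. z)) = \<Psi> (two.T \<eta>2) * \<Psi> two.U"
      using swap.\<Phi>_mult[OF two.U_B swap.id_B] swap.\<Phi>_mult[OF two.T_B[OF two.\<eta>_A] two.U_B]
      by (simp add: two.U_T)
    then have "one.e 1 (\<Psi> two.U * \<Psi> (two.T (\<lambda>z. z))) y = one.e 1 (\<Psi> (two.T \<eta>2) * \<Psi> two.U) y"
      by simp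
    then have "one.e 1 (\<Psi> two.U) y * ?g (\<eta>1 y) = \<eta>2 (?g y) * one.e 1 (\<Psi> two.U) y"
      unfolding swap.e1_mult[OF y]
      using y \<eta>y \<mu>0' by (simp add: swap.e0_\<Phi>_U swap.e0_\<Phi>_T two.\<eta>_A)
    then show ?thesis
      using nz by simp
  qed
  with hom A_alg_holomorphic[OF swap.\<gamma>_A] show ?thesis
    unfolding analytically_conjugate_def by blast
qed

text \<open>Where \<open>\<mu>\<close> is nonzero, \<open>\<gamma>\<close> takes values in the fixed
  points of \<open>\<eta>1\<close>; the identity theorem extends this to \<open>K2\<close>. If
  \<open>\<gamma>\<close> is not constant, its image contains an open set of fixed points, so
  \<open>\<eta>1\<close> is the identity.\<close>

lemma \<gamma>_constant_or_id:
  assumes "x \<in> K2" "\<mu> x 0 \<noteq> 0"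
  shows "(\<forall>y\<in>K1. \<eta>1 y = y) \<or> (\<exists>x0\<in>K1. \<eta>1 x0 = x0 \<and> (\<forall>x\<in>K2. \<gamma> x 0 = x0))"
proof -
  obtain w where w: "w \<in> interior K2" "\<mu> w 0 \<noteq> 0"
    using A_alg_eqI[OF two.K \<mu>_A A_alg_const[of 0]] assms by blast
  have "continuous_on (interior K2) (\<lambda>x. \<mu> x 0)"
    using A_alg_holomorphic[OF \<mu>_A] by (rule holomorphic_on_imp_continuous_on)
  then have S: "open (interior K2 \<inter> (\<lambda>x. \<mu> x 0) -` (- {0}))" (is "open ?S")
    by (intro continuous_open_preimage) auto
  have fixed: "\<eta>1 (\<gamma> x 0) = \<gamma> x 0" if "x \<in> K2" for x
  proof (rule A_alg_eq_on_open[OF two.K _ \<gamma>_A S])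
    show "(\<lambda>x. \<eta>1 (\<gamma> x 0)) \<in> A_alg K2"
      using \<gamma>_mem[OF admissible_zero] by (intro A_alg_compose[OF two.K \<gamma>_A _ one.\<eta>_A]) auto
    show "\<eta>1 (\<gamma> x 0) = \<gamma> x 0" if "x \<in> ?S" for x
      using that interior_subset[of K2] by (intro \<mu>_nonzero admissible_zero) auto
  qed (use w that in auto)
  note K2 = class_K_D[OF two.K]
  have img: "(\<lambda>x. \<gamma> x 0) ` interior K2 \<subseteq> K1"
    using \<gamma>_mem[OF admissible_zero] interior_subset[of K2] by auto
  show ?thesis
  proof (cases "(\<lambda>x. \<gamma> x 0) constant_on interior K2")
    case True
    then obtain x0 where x0: "\<And>x. x \<in> interior K2 \<Longrightarrow> \<gamma> x 0 = x0"
      by (auto simp: constant_on_def)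
    then have const: "\<gamma> x 0 = x0" if "x \<in> K2" for x
      using A_alg_eqI[OF two.K \<gamma>_A A_alg_const[of x0]] that by blast
    have "w \<in> K2"
      using w interior_subset by blast
    then have "x0 \<in> K1 \<and> \<eta>1 x0 = x0"
      using const fixed \<gamma>_mem[OF admissible_zero] by metis
    with const show ?thesis by blast
  next
    case False
    let ?V = "(\<lambda>x. \<gamma> x 0) ` interior K2"
    have "open ?V"
      by (rule open_mapping_thm[OF A_alg_holomorphic[OF \<gamma>_A] open_interior K2(2) open_interior order_refl False])
    moreover have "?V \<subseteq> interior K1"
      using img \<open>open ?V\<close> by (rule interior_maximal)
    moreover have "\<eta>1 y = y" if "y \<in> ?V" for y
      using that fixed interior_subset[of K2] by auto
    ultimately have "\<eta>1 y = y" if "y \<in> K1" for y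
      using A_alg_eq_on_open[OF one.K one.\<eta>_A A_alg_id, of ?V y] K2(3) that by blast
    then show ?thesis by blast
  qed
qed

text \<open>The identity map makes the first algebra commutative. Commutativity passes through the
  isomorphism, and cancelling \<open>two.U\<close> on the right forces \<open>\<eta>2\<close> to fix
  every point.\<close>

lemma id_of_id:
  assumes "\<And>y. y \<in> K1 \<Longrightarrow> \<eta>1 y = y" and x: "x \<in> K2"
  shows "\<eta>2 x = x"
proof -
  have "\<Psi> two.U * \<Psi> (two.T (\<lambda>z. z)) = \<Psi> (two.T (\<lambda>z. z)) * \<Psi> two.U"
    by (rule one.commute_of_id) (rule assms)
  then have "\<Psi> (two.U * two.T (\<lambda>z. z)) = \<Psi> (two.T (\<lambda>z. z) * two.U)"
    by (simp add: swap.\<Phi>_mult two.U_B swap.id_B)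
  then have "two.U * two.T (\<lambda>z. z) = two.T (\<lambda>z. z) * two.U"
    using \<Phi>_\<Psi> two.B_mult two.U_B swap.id_B by metis
  then have "two.T \<eta>2 * two.U = two.T (\<lambda>z. z) * two.U"
    by (simp add: two.U_T)
  then have "two.T \<eta>2 = two.T (\<lambda>z. z)"
    by (rule two.Q_unique)
  then show ?thesis
    using two.T_eq_iff[of \<eta>2 "\<lambda>z. z"] two.cont_\<eta> x by simp
qed

end

section \<open>The case of identity maps\<close>

locale tca_isomorphism_id = tca_isomorphism +
  assumes \<eta>1_id: "\<And>y. y \<in> K1 \<Longrightarrow> \<eta>1 y = y" and \<eta>2_id: "\<And>x. x \<in> K2 \<Longrightarrow> \<eta>2 x = x"
begin

lemma swapped_id: "tca_isomorphism_id K2 K1 \<eta>2 \<eta>1 \<iota>2 \<iota>1 E2 E1 \<Psi> \<Phi>"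
  by (intro tca_isomorphism_id.intro swapped tca_isomorphism_id_axioms.intro \<eta>1_id \<eta>2_id)

lemma admissible_ball: "x \<in> K2 \<Longrightarrow> norm z < two.rad \<Longrightarrow> two.admissible x z"
  by (simp add: two.admissible_def \<eta>2_id)

text \<open>The map into the product of \<open>K1\<close> and the closed disc is continuous and
  injective in two complex variables, so invariance of domain makes its image open.\<close>

lemma image_interior:
  assumes x: "x \<in> interior K2" "norm z < two.rad"
  shows "\<gamma> x z \<in> interior K1" "norm (\<mu> x z) < one.rad"
proof -
  define F where "F = (\<lambda>p. (\<gamma> (fst p) (snd p), \<mu> (fst p) (snd p)))"
  let ?S = "interior K2 \<times> ball 0 two.rad"
  have adm: "two.admissible (fst p) (snd p)" if "p \<in> ?S" for p
    using that interior_subset[of K2] by (intro admissible_ball) auto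
  have "open (F ` ?S)"
  proof (rule invariance_of_domain)
    show "continuous_on ?S F"
      unfolding F_def \<gamma>_def \<mu>_def
      using two.continuous_chi_interior by (intro continuous_on_Pair) (simp_all add: case_prod_unfold)
    show "open ?S"
      by (intro open_Times) auto
    show "inj_on F ?S"
      using \<gamma>_\<mu>_inject[OF adm adm] by (intro inj_onI) (auto simp: F_def prod_eq_iff)
  qed
  moreover have "F ` ?S \<subseteq> K1 \<times> cball 0 one.rad"
    using \<gamma>_mem[OF adm] \<mu>_le[OF adm] by (auto simp: F_def)
  ultimately have "F ` ?S \<subseteq> interior (K1 \<times> cball 0 one.rad)"
    by (rule interior_maximal[rotated])
  then have "F ` ?S \<subseteq> interior K1 \<times> ball 0 one.rad"
    by (simp add: interior_Times)
  moreover have "(x, z) \<in> ?S"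
    using x by simp
  ultimately have "F (x, z) \<in> interior K1 \<times> ball 0 one.rad"
    by blast
  then show "\<gamma> x z \<in> interior K1" "norm (\<mu> x z) < one.rad"
    by (auto simp: F_def)
qed

lemma rad_pos:
  assumes "two.rad > 0"
  shows "one.rad > 0"
proof -
  obtain x where "x \<in> interior K2"
    using class_K_D(3)[OF two.K] by blast
  then have "norm (\<mu> x 0) < one.rad"
    using assms by (intro image_interior) auto
  then show ?thesis
    using norm_ge_zero[of "\<mu> x 0"] by linarith
qed

end

context tca_isomorphism_id
begin

interpretation swap: tca_isomorphism_id K2 K1 \<eta>2 \<eta>1 \<iota>2 \<iota>1 E2 E1 \<Psi> \<Phi>
  by (rule swapped_id)

lemma inverse_point_interior:
  assumes x: "x \<in> interior K2" "norm z < two.rad"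
  shows "swap.\<gamma> (\<gamma> x z) (\<mu> x z) = x" "swap.\<mu> (\<gamma> x z) (\<mu> x z) = z"
proof -
  have "two.admissible x z" "one.admissible (\<gamma> x z) (\<mu> x z)"
    using x image_interior[OF x] interior_subset
    by (blast intro: admissible_ball swap.admissible_ball)+
  then show "swap.\<gamma> (\<gamma> x z) (\<mu> x z) = x" "swap.\<mu> (\<gamma> x z) (\<mu> x z) = z"
    by (rule inverse_point)+
qed

text \<open>Otherwise the inverse map, which preserves interiors, would carry the image back to an
  interior point of \<open>K2\<close>.\<close>

lemma boundary_image:
  assumes x: "x \<in> K2" "x \<notin> interior K2" and z: "norm z < two.rad"
  shows "\<gamma> x z \<notin> interior K1 \<or> norm (\<mu> x z) \<ge> one.rad"
proof (rule ccontr)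
  assume "\<not> ?thesis"
  then have y: "\<gamma> x z \<in> interior K1" "norm (\<mu> x z) < one.rad"
    by auto
  then have "one.admissible (\<gamma> x z) (\<mu> x z)"
    using interior_subset by (blast intro: swap.admissible_ball)
  then have "swap.\<gamma> (\<gamma> x z) (\<mu> x z) = x"
    by (rule inverse_point(1)[OF admissible_ball[OF x(1) z]])
  then show False
    using swap.image_interior(1)[OF y] x(2) by simp
qed

text \<open>If \<open>\<mu>\<close> reaches modulus \<open>one.rad\<close>, it has an interior
  maximum on the disc and is constant. If not, \<open>\<gamma> x 0\<close> must be a boundary point
  of \<open>K1\<close>, and the open mapping theorem makes \<open>\<gamma>\<close> constant in
  \<open>z\<close>.\<close>

lemma boundary_constant:
  assumes x: "x \<in> K2" "x \<notin> interior K2"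
  shows "(\<forall>z. norm z < two.rad \<longrightarrow> \<gamma> x z = \<gamma> x 0) \<or> (\<forall>z. norm z < two.rad \<longrightarrow> \<mu> x z = \<mu> x 0)"
proof (cases "\<exists>w. norm w < two.rad \<and> norm (\<mu> x w) \<ge> one.rad")
  case True
  then obtain w where w: "norm w < two.rad" "norm (\<mu> x w) \<ge> one.rad"
    by blast
  have "\<mu> x z = \<mu> x w" if "norm z < two.rad" for z
  proof (rule holomorphic_max_modulus_constant[OF \<mu>_holomorphic[OF x(1)]])
    show "norm (\<mu> x v) \<le> norm (\<mu> x w)" if "v \<in> ball 0 two.rad" for v
      using \<mu>_le[OF admissible_ball[OF x(1), of v]] that w by simp
  qed (use w that in auto)
  moreover have "norm (0::complex) < two.rad"
    using w(1) norm_ge_zero[of w] by (simp only: norm_zero)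
  ultimately show ?thesis
    by metis
next
  case False
  show ?thesis
  proof (cases "two.rad > 0")
    case True
    have "(\<lambda>z. \<gamma> x z) ` ball 0 two.rad \<subseteq> K1"
      using \<gamma>_mem[OF admissible_ball[OF x(1)]] by auto
    then have "(\<lambda>z. \<gamma> x z) constant_on ball 0 two.rad \<or> (\<lambda>z. \<gamma> x z) ` ball 0 two.rad \<subseteq> interior K1"
      by (intro holomorphic_into_closed_cases \<gamma>_holomorphic x) auto
    moreover have "\<gamma> x 0 \<notin> interior K1"
      using boundary_image[OF x, of 0] False True by auto
    moreover have "(0::complex) \<in> ball 0 two.rad"
      using True by simp
    ultimately have "(\<lambda>z. \<gamma> x z) constant_on ball 0 two.rad"
      by blast
    then show ?thesis
      using True unfolding constant_on_def by (metis mem_ball_0 norm_zero)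
  next
    case False
    then show ?thesis
      using norm_ge_zero by (metis le_less_trans)
  qed
qed

lemma \<gamma>_or_\<mu>_constant:
  "(\<forall>x\<in>K2. \<forall>z. norm z < two.rad \<longrightarrow> \<gamma> x z = \<gamma> x 0) \<or>
   (\<forall>x\<in>K2. \<forall>z. norm z < two.rad \<longrightarrow> \<mu> x z = \<mu> x 0)"
proof -
  \<comment> \<open>Independent fibre points \<open>z\<close> and \<open>w\<close> let the
    alternative be pulled out of the quantifiers. For each pair the product of the two increments
    vanishes on the boundary of \<open>K2\<close>, hence on \<open>K2\<close>, and A(K) has no zero
    divisors.\<close>
  have "(\<forall>x\<in>K2. \<gamma> x z - \<gamma> x 0 = 0) \<or> (\<forall>x\<in>K2. \<mu> x w - \<mu> x 0 = 0)"
    if zw: "norm z < two.rad" "norm w < two.rad" for z w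
  proof -
    have A: "(\<lambda>x. \<gamma> x z - \<gamma> x 0) \<in> A_alg K2" "(\<lambda>x. \<mu> x w - \<mu> x 0) \<in> A_alg K2"
      using zw by (simp_all add: A_alg_diff \<gamma>_A \<mu>_A \<gamma>_A' \<mu>_A')
    show ?thesis
    proof (rule A_alg_mult_eq_0[OF two.K A])
      show "(\<gamma> x z - \<gamma> x 0) * (\<mu> x w - \<mu> x 0) = 0" if "x \<in> K2" for x
      proof (rule A_alg_eq_0_frontier[OF two.K A_alg_mult[OF A] _ that])
        show "(\<gamma> x z - \<gamma> x 0) * (\<mu> x w - \<mu> x 0) = 0" if "x \<in> K2" "x \<notin> interior K2" for x
          using boundary_constant[OF that] zw by auto
      qed
    qed
  qed
  then show ?thesis
    by auto
qed

text \<open>The fibre coordinate \<open>z\<close> would be recovered from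
  \<open>\<gamma> x z\<close> alone, which does not depend on \<open>z\<close>.\<close>

lemma not_\<gamma>_constant_\<mu>_constant:
  assumes "two.rad > 0"
    and \<gamma>: "\<And>x z. x \<in> K2 \<Longrightarrow> norm z < two.rad \<Longrightarrow> \<gamma> x z = \<gamma> x 0"
    and \<mu>: "\<And>y w. y \<in> K1 \<Longrightarrow> norm w < one.rad \<Longrightarrow> swap.\<mu> y w = swap.\<mu> y 0"
  shows False
proof -
  obtain x where x: "x \<in> interior K2"
    using class_K_D(3)[OF two.K] by blast
  then have xK: "x \<in> K2"
    using interior_subset by blast
  have "swap.\<mu> (\<gamma> x 0) 0 = z" if z: "norm z < two.rad" for z
  proof -
    have "\<gamma> x z \<in> K1"
      using image_interior(1)[OF x z] interior_subset by blast
    then have "swap.\<mu> (\<gamma> x z) (\<mu> x z) = swap.\<mu> (\<gamma> x z) 0"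
      by (intro \<mu> image_interior x z)
    then show ?thesis
      using inverse_point_interior(2)[OF x z] \<gamma>[OF xK z] by simp
  qed
  from this[of 0] this[of "of_real (two.rad / 2)"] show False
    using assms(1) by simp
qed

lemma conjugate_of_\<gamma>_constant:
  assumes rad: "one.rad > 0" "two.rad > 0"
    and \<gamma>: "\<And>x z. x \<in> K2 \<Longrightarrow> norm z < two.rad \<Longrightarrow> \<gamma> x z = \<gamma> x 0"
    and \<gamma>': "\<And>y w. y \<in> K1 \<Longrightarrow> norm w < one.rad \<Longrightarrow> swap.\<gamma> y w = swap.\<gamma> y 0"
  shows "analytically_conjugate K1 \<eta>1 K2 \<eta>2"
proof -
  have inv1: "swap.\<gamma> (\<gamma> x 0) 0 = x" if "x \<in> K2" for x
  proof (rule A_alg_eqI[OF two.K _ A_alg_id _ that])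
    show "(\<lambda>x. swap.\<gamma> (\<gamma> x 0) 0) \<in> A_alg K2"
      using \<gamma>_mem[OF admissible_zero] by (intro A_alg_compose[OF two.K \<gamma>_A _ swap.\<gamma>_A]) auto
    show "swap.\<gamma> (\<gamma> x 0) 0 = x" if x: "x \<in> interior K2" for x
    proof -
      have "\<gamma> x 0 \<in> K1"
        using image_interior(1)[OF x, of 0] rad interior_subset by auto
      then show ?thesis
        using \<gamma>'[of "\<gamma> x 0" "\<mu> x 0"] image_interior(2)[OF x, of 0] inverse_point_interior(1)[OF x, of 0] rad
        by simp
    qed
  qed
  have inv2: "\<gamma> (swap.\<gamma> y 0) 0 = y" if "y \<in> K1" for y
  proof (rule A_alg_eqI[OF one.K _ A_alg_id _ that])
    show "(\<lambda>y. \<gamma> (swap.\<gamma> y 0) 0) \<in> A_alg K1"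
      using swap.\<gamma>_mem[OF swap.admissible_zero] by (intro A_alg_compose[OF one.K swap.\<gamma>_A _ \<gamma>_A]) auto
    show "\<gamma> (swap.\<gamma> y 0) 0 = y" if y: "y \<in> interior K1" for y
    proof -
      note i = swap.image_interior[OF y, of 0]
      have "swap.\<gamma> y 0 \<in> K2"
        using i(1) rad interior_subset by auto
      moreover from this have "two.admissible (swap.\<gamma> y 0) (swap.\<mu> y 0)"
        using i(2) rad by (intro admissible_ball) auto
      moreover have "y \<in> K1"
        using y interior_subset by blast
      ultimately show ?thesis
        using \<gamma>[of "swap.\<gamma> y 0" "swap.\<mu> y 0"] i(2) swap.inverse_point(1)[OF swap.admissible_zero[of y]] rad
        by simp
    qed
  qed
  have "homeomorphism K1 K2 (\<lambda>y. swap.\<gamma> y 0) (\<lambda>x. \<gamma> x 0)"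
    using inv1 inv2 \<gamma>_mem[OF admissible_zero] swap.\<gamma>_mem[OF swap.admissible_zero]
    by (intro homeomorphismI A_alg_continuous \<gamma>_A swap.\<gamma>_A) auto
  moreover have "swap.\<gamma> (\<eta>1 y) 0 = \<eta>2 (swap.\<gamma> y 0)" if "y \<in> K1" for y
    using that swap.\<gamma>_mem[OF swap.admissible_zero[OF that]] by (simp add: \<eta>1_id \<eta>2_id)
  ultimately show ?thesis
    using A_alg_holomorphic[OF swap.\<gamma>_A] unfolding analytically_conjugate_def by blast
qed

text \<open>Here the two factors are interchanged: \<open>\<gamma>\<close> is constant on the zero
  section, so injectivity rests on \<open>\<mu>\<close> alone, and the inverse map on the fibre over
  that constant shows that every value in the open disc is attained.\<close>

lemma chart_of_\<mu>_constant:
  assumes rad: "one.rad > 0" "two.rad > 0"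
    and \<mu>: "\<And>x z. x \<in> K2 \<Longrightarrow> norm z < two.rad \<Longrightarrow> \<mu> x z = \<mu> x 0"
    and \<mu>': "\<And>y w. y \<in> K1 \<Longrightarrow> norm w < one.rad \<Longrightarrow> swap.\<mu> y w = swap.\<mu> y 0"
  shows "inj_on (\<lambda>x. \<mu> x 0) K2" "(\<lambda>x. \<mu> x 0) ` K2 = cball 0 one.rad"
proof -
  note K2 = class_K_D[OF two.K]
  have r0: "norm (0::complex) < two.rad"
    using rad by simp
  have sec: "swap.\<mu> (\<gamma> x z) 0 = z" if x: "x \<in> interior K2" and z: "norm z < two.rad" for x z
  proof -
    have "\<gamma> x z \<in> K1"
      using image_interior(1)[OF x z] interior_subset by blast
    then show ?thesis
      using \<mu>'[OF _ image_interior(2)[OF x z]] inverse_point_interior(2)[OF x z] by simp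
  qed
  \<comment> \<open>A nonconstant \<open>\<gamma>\<close> would make \<open>swap.\<mu>\<close>
    vanish on an open set and hence on \<open>K1\<close>, against \<open>sec\<close> at a nonzero
    fibre point.\<close>
  have "(\<lambda>x. \<gamma> x 0) constant_on interior K2"
  proof (rule ccontr)
    let ?V = "(\<lambda>x. \<gamma> x 0) ` interior K2"
    assume "\<not> ?thesis"
    then have "open ?V"
      by (rule open_mapping_thm[OF A_alg_holomorphic[OF \<gamma>_A] open_interior K2(2) open_interior order_refl])
    moreover have "?V \<subseteq> interior K1" "?V \<noteq> {}"
      using image_interior(1) r0 K2(3) by auto
    moreover have "swap.\<mu> y 0 = 0" if "y \<in> ?V" for y
      using that sec r0 by auto
    ultimately have zero: "swap.\<mu> y 0 = 0" if "y \<in> K1" for y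
      using A_alg_eq_on_open[OF one.K swap.\<mu>_A A_alg_const[of 0], of ?V y] that by blast
    obtain x where x: "x \<in> interior K2"
      using K2(3) by blast
    let ?z = "of_real (two.rad / 2) :: complex"
    have z: "norm ?z < two.rad"
      using rad by simp
    have "\<gamma> x ?z \<in> K1"
      using image_interior(1)[OF x z] interior_subset by blast
    then show False
      using sec[OF x z] zero[of "\<gamma> x ?z"] rad by simp
  qed
  then obtain y0 where "\<And>x. x \<in> interior K2 \<Longrightarrow> \<gamma> x 0 = y0"
    by (auto simp: constant_on_def)
  then have y0: "\<gamma> x 0 = y0" if "x \<in> K2" for x
    using A_alg_eqI[OF two.K \<gamma>_A A_alg_const[of y0] _ that] by blast
  show "inj_on (\<lambda>x. \<mu> x 0) K2"
    using \<gamma>_\<mu>_inject(1)[OF admissible_zero admissible_zero] y0 by (intro inj_onI) auto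
  have "y0 \<in> interior K1"
    using y0 K2(3) image_interior(1)[OF _ r0] interior_subset[of K2] by fastforce
  then have y0K: "y0 \<in> interior K1" "y0 \<in> K1"
    using interior_subset by blast+
  have sub: "ball 0 one.rad \<subseteq> (\<lambda>x. \<mu> x 0) ` K2"
  proof
    fix w :: complex assume "w \<in> ball 0 one.rad"
    then have w: "norm w < one.rad" by simp
    let ?x = "swap.\<gamma> y0 w" and ?z = "swap.\<mu> y0 w"
    have i: "?x \<in> interior K2" "norm ?z < two.rad"
      using swap.image_interior[OF y0K(1) w] by auto
    then have "?x \<in> K2"
      using interior_subset by blast
    moreover have "\<mu> ?x ?z = w"
      by (rule swap.inverse_point(2)[OF swap.admissible_ball[OF y0K(2) w] admissible_ball[OF \<open>?x \<in> K2\<close> i(2)]])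
    ultimately show "w \<in> (\<lambda>x. \<mu> x 0) ` K2"
      using \<mu>[OF _ i(2)] by (metis imageI)
  qed
  have "compact ((\<lambda>x. \<mu> x 0) ` K2)"
    by (intro compact_continuous_image A_alg_continuous \<mu>_A K2(1))
  then have "closure (ball 0 one.rad) \<subseteq> (\<lambda>x. \<mu> x 0) ` K2"
    using sub by (intro closure_minimal compact_imp_closed)
  moreover have "(\<lambda>x. \<mu> x 0) ` K2 \<subseteq> cball 0 one.rad"
    using \<mu>_le[OF admissible_zero] by auto
  ultimately show "(\<lambda>x. \<mu> x 0) ` K2 = cball 0 one.rad"
    using rad by (simp add: closure_ball)
qed

end

context tca_isomorphism_id
begin

interpretation swap: tca_isomorphism_id K2 K1 \<eta>2 \<eta>1 \<iota>2 \<iota>1 E2 E1 \<Psi> \<Phi>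
  by (rule swapped_id)

text \<open>Without discs both functions \<open>\<mu>\<close> vanish. With discs each side has one
  coordinate independent of the fibre: the mixed alternatives are contradictory, and the other two
  give the map \<open>\<gamma>\<close> or a pair of disc charts.\<close>

theorem conjugate: "analytically_conjugate K1 \<eta>1 K2 \<eta>2"
proof (cases "two.rad > 0")
  case False
  then have zero: "\<not> one.rad > 0"
    using swap.rad_pos by blast
  have "\<mu> x 0 = 0" if "x \<in> K2" for x
    using \<mu>_le[OF admissible_zero[OF that]] zero norm_ge_zero[of "\<mu> x 0"]
    by (metis norm_le_zero_iff order_trans linorder_not_less)
  moreover have "swap.\<mu> y 0 = 0" if "y \<in> K1" for y
    using swap.\<mu>_le[OF swap.admissible_zero[OF that]] False norm_ge_zero[of "swap.\<mu> y 0"]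
    by (metis norm_le_zero_iff order_trans linorder_not_less)
  ultimately show ?thesis
    by (rule conjugate_of_\<mu>_zero)
next
  case r2: True
  then have r1: "one.rad > 0"
    by (rule rad_pos)
  from \<gamma>_or_\<mu>_constant swap.\<gamma>_or_\<mu>_constant show ?thesis
  proof (elim disjE)
    assume "\<forall>x\<in>K2. \<forall>z. norm z < two.rad \<longrightarrow> \<mu> x z = \<mu> x 0"
      "\<forall>y\<in>K1. \<forall>w. norm w < one.rad \<longrightarrow> swap.\<mu> y w = swap.\<mu> y 0"
    then have *: "\<And>x z. x \<in> K2 \<Longrightarrow> norm z < two.rad \<Longrightarrow> \<mu> x z = \<mu> x 0"
      "\<And>y w. y \<in> K1 \<Longrightarrow> norm w < one.rad \<Longrightarrow> swap.\<mu> y w = swap.\<mu> y 0"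
      by blast+
    show ?thesis
    proof (rule analytically_conjugate_discs[where c = 1])
      show "inj_on (\<lambda>x. \<mu> x 0) K2" "(\<lambda>x. \<mu> x 0) ` K2 = cball 0 one.rad"
        using chart_of_\<mu>_constant[OF r1 r2] * by auto
      show "inj_on (\<lambda>x. swap.\<mu> x 0) K1" "(\<lambda>x. swap.\<mu> x 0) ` K1 = cball 0 two.rad"
        using swap.chart_of_\<mu>_constant[OF r2 r1] * by auto
    qed (use r1 r2 \<eta>1_id \<eta>2_id class_K_D(1)[OF one.K] class_K_D(1)[OF two.K] \<mu>_A swap.\<mu>_A in auto)
  qed (use conjugate_of_\<gamma>_constant[OF r1 r2] not_\<gamma>_constant_\<mu>_constant[OF r2]
      swap.not_\<gamma>_constant_\<mu>_constant[OF r1] in blast)+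
qed

end

section \<open>The case of a fixed point with a full disc of characters\<close>

text \<open>The two constancy assumptions are written with \<open>chi\<close> because the
  counterpart of \<open>\<gamma>\<close> for the inverse isomorphism has no name at this
  level.\<close>

locale tca_isomorphism_points = tca_isomorphism +
  fixes x0 y0 :: complex
  assumes x0: "x0 \<in> K1" "\<eta>1 x0 = x0" and \<gamma>_const: "x \<in> K2 \<Longrightarrow> two.chi x 0 (\<Phi> (one.T (\<lambda>z. z))) = x0"
    and y0: "y0 \<in> K2" "\<eta>2 y0 = y0" and \<gamma>_const': "y \<in> K1 \<Longrightarrow> one.chi y 0 (\<Psi> (two.T (\<lambda>z. z))) = y0"
begin

lemma swapped_points: "tca_isomorphism_points K2 K1 \<eta>2 \<eta>1 \<iota>2 \<iota>1 E2 E1 \<Psi> \<Phi> y0 x0"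
  by (intro tca_isomorphism_points.intro swapped tca_isomorphism_points_axioms.intro
      x0 y0 \<gamma>_const \<gamma>_const')

abbreviation "h \<equiv> \<lambda>x. \<mu> x 0"

lemma \<gamma>_x0: "x \<in> K2 \<Longrightarrow> \<gamma> x 0 = x0"
  unfolding \<gamma>_def by (rule \<gamma>_const)

lemma h_inj: "inj_on h K2"
  using \<gamma>_\<mu>_inject(1)[OF admissible_zero admissible_zero] \<gamma>_x0 by (intro inj_onI) auto

lemma norm_h_le: "x \<in> K2 \<Longrightarrow> norm (h x) \<le> one.rad"
  by (intro \<mu>_le admissible_zero)

lemma h_interior: "x \<in> interior K2 \<Longrightarrow> norm (h x) < one.rad"
proof -
  have "inj_on h (interior K2)"
    using h_inj interior_subset inj_on_subset by blast
  then have "open (h ` interior K2)"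
    by (rule open_mapping_thm3[OF A_alg_holomorphic[OF \<mu>_A] open_interior])
  moreover have "h ` interior K2 \<subseteq> cball 0 one.rad"
    using norm_h_le interior_subset[of K2] by auto
  ultimately have "h ` interior K2 \<subseteq> interior (cball 0 one.rad)"
    by (rule interior_maximal[rotated])
  then show "x \<in> interior K2 \<Longrightarrow> norm (h x) < one.rad"
    by auto
qed

lemma rad_pos: "one.rad > 0"
proof -
  obtain x where "x \<in> interior K2"
    using class_K_D(3)[OF two.K] by blast
  from h_interior[OF this] show ?thesis
    using norm_ge_zero[of "h x"] by linarith
qed

lemma admissible_x0: "norm w < one.rad \<Longrightarrow> one.admissible x0 w"
  by (simp add: one.admissible_def x0)

end

context tca_isomorphism_points
begin

interpretation swap: tca_isomorphism_points K2 K1 \<eta>2 \<eta>1 \<iota>2 \<iota>1 E2 E1 \<Psi> \<Phi> y0 x0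
  by (rule swapped_points)

lemma swap_\<mu>_x0:
  assumes w: "norm w < one.rad"
  shows "swap.\<mu> x0 w = 0"
proof (rule analytic_continuation_open[where f = "\<lambda>w. swap.\<mu> x0 w" and g = "\<lambda>_. 0"])
  have inj: "inj_on h (interior K2)"
    using h_inj interior_subset inj_on_subset by blast
  show "open (h ` interior K2)"
    by (rule open_mapping_thm3[OF A_alg_holomorphic[OF \<mu>_A] open_interior inj])
  show "h ` interior K2 \<subseteq> ball 0 one.rad"
    using h_interior by auto
  show "swap.\<mu> x0 w = 0" if w: "w \<in> h ` interior K2" for w
  proof -
    obtain x where x: "x \<in> interior K2" "w = h x"
      using w by blast
    then have "x \<in> K2"
      using interior_subset by blast
    then show ?thesis
      using inverse_point(2)[OF admissible_zero, of x] x \<gamma>_x0 admissible_x0[OF h_interior[OF x(1)]] by simp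
  qed
qed (use w class_K_D(3)[OF two.K] swap.\<mu>_holomorphic[OF x0(1)] in auto)

lemma h_section:
  assumes w: "norm w < one.rad"
  shows "swap.\<gamma> x0 w \<in> K2" "h (swap.\<gamma> x0 w) = w"
proof -
  show K2: "swap.\<gamma> x0 w \<in> K2"
    by (rule swap.\<gamma>_mem[OF admissible_x0[OF w]])
  show "h (swap.\<gamma> x0 w) = w"
    using swap.inverse_point(2)[OF admissible_x0[OF w]] swap_\<mu>_x0[OF w] admissible_zero[OF K2] by simp
qed

lemma h_y0: "h y0 = 0"
  using h_section(2)[of 0] rad_pos swap.\<gamma>_x0[OF x0(1)] by simp

lemma h_image: "h ` K2 = cball 0 one.rad"
proof -
  have "ball 0 one.rad \<subseteq> h ` K2"
    using h_section by (metis image_eqI mem_ball_0 subsetI)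
  moreover have "compact (h ` K2)"
    by (intro compact_continuous_image A_alg_continuous \<mu>_A class_K_D(1)[OF two.K])
  ultimately have "closure (ball 0 one.rad) \<subseteq> h ` K2"
    by (intro closure_minimal compact_imp_closed)
  then show ?thesis
    using norm_h_le rad_pos by (auto simp: closure_ball)
qed

text \<open>In the disc chart \<open>h\<close> the point \<open>y0\<close> is the centre, and the
  inverse chart maps the open disc into the interior.\<close>

lemma y0_interior: "y0 \<in> interior K2"
proof -
  obtain g where g: "homeomorphism K2 (cball 0 one.rad) h g" "g ` ball 0 one.rad \<subseteq> interior K2"
    using disc_chart[OF class_K_D(1)[OF two.K] \<mu>_A h_inj h_image] by metis
  have "g (h y0) = y0"
    using g(1) y0(1) by (auto simp: homeomorphism_def)
  then show ?thesis
    using g(2) h_y0 rad_pos by (auto simp: image_subset_iff dest!: bspec[of _ _ 0])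
qed

end

section \<open>The point derivation and the multipliers at the fixed points\<close>

context tca_isomorphism_points
begin

interpretation swap: tca_isomorphism_points K2 K1 \<eta>2 \<eta>1 \<iota>2 \<iota>1 E2 E1 \<Psi> \<Phi> y0 x0
  by (rule swapped_points)

lemmas x0_interior = swap.y0_interior

definition d :: "complex \<Rightarrow> complex" where
  "d x = two.e 1 (\<Phi> (one.T (\<lambda>z. z))) x"

text \<open>The map \<open>f \<mapsto> E\<^sub>1 (\<Phi> f)\<close> is a point derivation of \<open>A(K1)\<close> at \<open>x0\<close>.\<close>

lemma e1_\<Phi>_T:
  assumes f: "f \<in> A_alg K1" and x: "x \<in> K2"
  shows "two.e 1 (\<Phi> (one.T f)) x = d x * deriv f x0"
proof -
  \<comment> \<open>After splitting off \<open>z - x0\<close>, the term of the product rule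
    containing \<open>e 0\<close> of the image of \<open>z - x0\<close> drops out, since
    \<open>\<gamma>\<close> is constantly \<open>x0\<close>.\<close>
  obtain k where k: "k \<in> A_alg K1" "\<And>z. f z - f x0 = (z - x0) * k z" "k x0 = deriv f x0"
    using A_alg_factor_interior[OF f x0_interior] by metis
  let ?a = "\<lambda>z. z - x0"
  have a: "?a \<in> A_alg K1"
    by (intro A_alg_diff) auto
  have \<eta>x: "\<eta>2 x \<in> K2"
    using two.\<eta>_into x by auto
  have "one.T ?a = one.T (\<lambda>z. z) + (- x0) *\<^sub>C 1"
    using one.T_add[of "\<lambda>z. z" "\<lambda>_. - x0"] by (simp add: one.T_const)
  then have Ta: "\<Phi> (one.T ?a) = \<Phi> (one.T (\<lambda>z. z)) + (- x0) *\<^sub>C 1"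
    using \<Phi>_add[OF id_B one.T_B[OF A_alg_const, of "- x0"]] by (simp add: one.T_const \<Phi>_scaleC \<Phi>_one one.one_B)
  have "f = (\<lambda>z. ?a z * k z + f x0)"
    by (rule ext) (simp flip: k(2))
  then have "one.T f = one.T (\<lambda>z. ?a z * k z + f x0)"
    by (rule arg_cong)
  also have "\<dots> = one.T ?a * one.T k + f x0 *\<^sub>C 1"
    using a k(1) by (simp add: one.T_add one.T_mult one.T_const A_alg_continuous A_alg_mult)
  finally have "one.T f = one.T ?a * one.T k + one.T (\<lambda>_. f x0)"
    by (simp add: one.T_const)
  then have "\<Phi> (one.T f) = \<Phi> (one.T ?a) * \<Phi> (one.T k) + f x0 *\<^sub>C 1"
    using a k(1) by (simp add: \<Phi>_add \<Phi>_mult one.T_B one.B_mult) (simp add: one.T_const \<Phi>_scaleC \<Phi>_one one.one_B)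
  then have "two.e 1 (\<Phi> (one.T f)) x = two.e 1 (\<Phi> (one.T ?a) * \<Phi> (one.T k)) x"
    using x by (simp add: two.e_add two.e_scaleC two.e_one)
  also have "\<dots> = two.e 1 (\<Phi> (one.T ?a)) x * k x0"
    unfolding e1_mult[OF x] using a k(1) x \<eta>x by (simp add: e0_\<Phi>_T \<gamma>_x0)
  also have "two.e 1 (\<Phi> (one.T ?a)) x = d x"
    unfolding Ta using x by (simp add: two.e_add two.e_scaleC two.e_one d_def)
  finally show ?thesis
    using k(3) by simp
qed

lemma d_A: "d \<in> A_alg K2"
  unfolding d_def by (intro two.e_A \<Phi>_B id_B)

text \<open>Compare first coefficients in the image of \<open>U * T id = T \<eta>1 * U\<close>. The
  derivation formula turns the coefficient of \<open>\<eta>1\<close> into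
  \<open>d x * deriv \<eta>1 x0\<close>, and the remaining terms cancel because \<open>x0\<close> is
  fixed.\<close>

lemma d_h:
  assumes x: "x \<in> K2"
  shows "d x * (h x - deriv \<eta>1 x0 * h (\<eta>2 x)) = 0"
proof -
  have \<eta>x: "\<eta>2 x \<in> K2"
    using two.\<eta>_into x by auto
  have "\<Phi> one.U * \<Phi> (one.T (\<lambda>z. z)) = \<Phi> (one.T \<eta>1) * \<Phi> one.U"
    using \<Phi>_mult[OF one.U_B id_B] \<Phi>_mult[OF one.T_B[OF one.\<eta>_A] one.U_B] by (simp add: one.U_T)
  then have "two.e 1 (\<Phi> one.U * \<Phi> (one.T (\<lambda>z. z))) x = two.e 1 (\<Phi> (one.T \<eta>1) * \<Phi> one.U) x"
    by simp
  then have "h x * d x + two.e 1 (\<Phi> one.U) x * x0 =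
      \<eta>1 x0 * two.e 1 (\<Phi> one.U) x + d x * deriv \<eta>1 x0 * h (\<eta>2 x)"
    unfolding e1_mult[OF x] e1_\<Phi>_T[OF one.\<eta>_A x] d_def[symmetric]
    using x \<eta>x by (simp add: e0_\<Phi>_U e0_\<Phi>_T one.\<eta>_A \<gamma>_x0)
  then show ?thesis
    by (simp add: x0 algebra_simps)
qed

lemma h_nonzero: "\<exists>x\<in>K2. h x \<noteq> 0"
proof -
  have "of_real one.rad \<in> h ` K2"
    using rad_pos by (simp add: h_image)
  then show ?thesis
    using rad_pos by force
qed

text \<open>If \<open>d\<close> vanished at \<open>y0\<close>, so would the first coefficient of
  every \<open>\<Phi> (one.T f)\<close>. Splitting \<open>\<Psi> two.U\<close> into constant term
  and multiple of \<open>one.U\<close> and mapping back would give \<open>two.U\<close> first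
  coefficient zero there, instead of one.\<close>

lemma d_y0: "d y0 \<noteq> 0"
proof
  assume d0: "d y0 = 0"
  define f where "f = one.e 0 (\<Psi> two.U)"
  define b where "b = one.Q (\<Psi> two.U)"
  have f: "f \<in> A_alg K1" and b: "b \<in> one.B"
    unfolding f_def b_def by (intro one.e_A one.Q_B \<Psi>_B two.U_B)+
  have "\<Psi> two.U = one.T f + b * one.U"
    unfolding f_def b_def by (intro one.B_decompose \<Psi>_B two.U_B)
  then have "\<Phi> (\<Psi> two.U) = \<Phi> (one.T f) + \<Phi> b * \<Phi> one.U"
    using f b by (simp add: \<Phi>_add \<Phi>_mult one.T_B one.B_mult one.U_B)
  then have U: "two.U = \<Phi> (one.T f) + \<Phi> b * \<Phi> one.U"
    by (simp add: \<Phi>_\<Psi> two.U_B)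
  have f0: "f x0 = 0"
    using swap.h_y0 by (simp add: f_def swap.e0_\<Phi>_U)
  have "two.e 0 (\<Phi> b) x * h x = 0" if x: "x \<in> K2" for x
  proof -
    have "0 = two.e 0 two.U x"
      using x by (simp add: two.e_U)
    also have "\<dots> = f x0 + two.e 0 (\<Phi> b) x * h x"
      unfolding U using x f two.e_mult[OF x, of 0]
      by (simp add: two.e_add e0_\<Phi>_T \<gamma>_x0 e0_\<Phi>_U)
    finally show ?thesis
      using f0 by simp
  qed
  then have b0: "two.e 0 (\<Phi> b) y0 = 0"
    using A_alg_mult_eq_0[OF two.K two.e_A[OF \<Phi>_B[OF b]] \<mu>_A] h_nonzero y0 by blast
  have "1 = two.e 1 two.U y0"
    using y0 by (simp add: two.e_U)
  also have "\<dots> = two.e 1 (\<Phi> (one.T f)) y0 + two.e 1 (\<Phi> b * \<Phi> one.U) y0"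
    by (subst U) (rule two.e_add[OF y0(1)])
  also have "\<dots> = 0"
    unfolding e1_\<Phi>_T[OF f y0(1)] e1_mult[OF y0(1)] using d0 b0 h_y0 by (simp add: y0 e0_\<Phi>_U)
  finally show False by simp
qed

text \<open>The factor \<open>d\<close> can be cancelled because it is not identically zero and A(K)
  is an integral domain.\<close>

lemma h_\<eta>: "x \<in> K2 \<Longrightarrow> h x = deriv \<eta>1 x0 * h (\<eta>2 x)"
proof -
  have "(\<lambda>x. h x - deriv \<eta>1 x0 * h (\<eta>2 x)) \<in> A_alg K2"
    using two.\<eta>_into
    by (intro A_alg_diff A_alg_mult A_alg_const \<mu>_A A_alg_compose[OF two.K two.\<eta>_A _ \<mu>_A]) auto
  then show "x \<in> K2 \<Longrightarrow> h x = deriv \<eta>1 x0 * h (\<eta>2 x)"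
    using A_alg_mult_eq_0[OF two.K d_A _ d_h] d_y0 y0 by fastforce
qed

text \<open>Take a point where the modulus of \<open>h\<close> is maximal; the value of
  \<open>h\<close> at its image under \<open>\<eta>2\<close> cannot be larger.\<close>

lemma deriv_\<eta>_ge: "norm (deriv \<eta>1 x0) \<ge> 1"
proof -
  have "of_real one.rad \<in> h ` K2"
    using rad_pos by (simp add: h_image)
  then obtain x where x: "x \<in> K2" "h x = of_real one.rad"
    by force
  have "one.rad = norm (h x)"
    using x rad_pos by simp
  also have "\<dots> = norm (deriv \<eta>1 x0) * norm (h (\<eta>2 x))"
    using h_\<eta>[OF x(1)] by (metis norm_mult)
  also have "\<dots> \<le> norm (deriv \<eta>1 x0) * one.rad"
    using norm_h_le[of "\<eta>2 x"] two.\<eta>_into x(1) by (intro mult_left_mono) auto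
  finally show ?thesis
    using rad_pos by simp
qed

end

section \<open>Both maps as rotations in the disc charts\<close>

context tca_isomorphism_points
begin

interpretation swap: tca_isomorphism_points K2 K1 \<eta>2 \<eta>1 \<iota>2 \<iota>1 E2 E1 \<Psi> \<Phi> y0 x0
  by (rule swapped_points)

text \<open>Differentiate the functional equation of \<open>swap.h\<close> at the fixed point
  \<open>x0\<close>; the derivative of the injective chart is nonzero and cancels.\<close>

lemma deriv_mult_eq_1: "deriv \<eta>1 x0 * deriv \<eta>2 y0 = 1"
proof -
  have inj: "inj_on swap.h (interior K1)"
    using swap.h_inj interior_subset inj_on_subset by blast
  have dh: "deriv swap.h x0 \<noteq> 0"
    by (rule holomorphic_injective_imp_regular[OF A_alg_holomorphic[OF swap.\<mu>_A] open_interior inj x0_interior])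
  have D: "(swap.h has_field_derivative deriv swap.h x0) (at x0)"
    by (rule holomorphic_derivI[OF A_alg_holomorphic[OF swap.\<mu>_A] open_interior x0_interior])
  have "(\<eta>1 has_field_derivative deriv \<eta>1 x0) (at x0)"
    by (rule holomorphic_derivI[OF one.holomorphic_\<eta> open_interior x0_interior])
  then have "((\<lambda>z. deriv \<eta>2 y0 * swap.h (\<eta>1 z)) has_field_derivative
      deriv \<eta>2 y0 * (deriv swap.h x0 * deriv \<eta>1 x0)) (at x0)"
    using D x0(2) by (intro DERIV_cmult DERIV_chain2[where f = swap.h]) auto
  then have "(swap.h has_field_derivative deriv \<eta>2 y0 * (deriv swap.h x0 * deriv \<eta>1 x0)) (at x0)"
  proof (rule has_field_derivative_transform_within_open[OF _ open_interior x0_interior])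
    show "deriv \<eta>2 y0 * swap.h (\<eta>1 z) = swap.h z" if "z \<in> interior K1" for z
      using swap.h_\<eta>[OF subsetD[OF interior_subset that]] by (rule sym)
  qed
  then have "deriv swap.h x0 = deriv \<eta>2 y0 * (deriv swap.h x0 * deriv \<eta>1 x0)"
    using D by (rule DERIV_unique[rotated])
  then show ?thesis
    using dh by (simp add: mult_ac)
qed

lemma norm_deriv: "norm (deriv \<eta>1 x0) = 1"
proof -
  have "norm (deriv \<eta>1 x0) * norm (deriv \<eta>2 y0) = 1"
    using deriv_mult_eq_1 by (metis norm_mult norm_one)
  moreover have "norm (deriv \<eta>1 x0) * 1 \<le> norm (deriv \<eta>1 x0) * norm (deriv \<eta>2 y0)"
    using swap.deriv_\<eta>_ge by (intro mult_left_mono) auto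
  ultimately show ?thesis
    using deriv_\<eta>_ge by simp
qed

lemma h_rotation: "x \<in> K2 \<Longrightarrow> h (\<eta>2 x) = deriv \<eta>2 y0 * h x"
proof -
  assume "x \<in> K2"
  then have "deriv \<eta>2 y0 * h x = (deriv \<eta>1 x0 * deriv \<eta>2 y0) * h (\<eta>2 x)"
    using h_\<eta> by (simp add: mult_ac)
  then show ?thesis
    by (simp add: deriv_mult_eq_1)
qed

lemma \<eta>2_inj: "inj_on \<eta>2 K2"
proof (rule inj_onI)
  fix x y assume xy: "x \<in> K2" "y \<in> K2" "\<eta>2 x = \<eta>2 y"
  then have "h x = h y"
    using h_\<eta> by metis
  then show "x = y"
    using inj_onD[OF h_inj] xy by blast
qed

lemma \<eta>2_surj: "\<eta>2 ` K2 = K2"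
proof
  show "\<eta>2 ` K2 \<subseteq> K2"
    using two.\<eta>_into by auto
  show "K2 \<subseteq> \<eta>2 ` K2"
  proof
    fix y assume y: "y \<in> K2"
    have "deriv \<eta>1 x0 * h y \<in> h ` K2"
      using norm_h_le[OF y] by (simp add: h_image norm_mult norm_deriv)
    then obtain x where x: "x \<in> K2" "h x = deriv \<eta>1 x0 * h y"
      by force
    have "deriv \<eta>1 x0 \<noteq> 0"
      using norm_deriv by auto
    then have "h (\<eta>2 x) = h y"
      using h_\<eta>[OF x(1)] x(2) by simp
    moreover have "\<eta>2 x \<in> K2"
      using two.\<eta>_into x by auto
    ultimately show "y \<in> \<eta>2 ` K2"
      using inj_onD[OF h_inj] y x by blast
  qed
qed

lemma \<eta>2_homeomorphism: "\<exists>\<theta>. homeomorphism K2 K2 \<eta>2 \<theta>"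
  using homeomorphism_compact[OF two.compact_X two.cont_\<eta> \<eta>2_surj \<eta>2_inj] by blast

lemma simply_connected_K2: "simply_connected K2"
proof -
  have "K2 homeomorphic cball (0::complex) one.rad"
    using homeomorphism_compact[OF two.compact_X A_alg_continuous[OF \<mu>_A] h_image h_inj]
    unfolding homeomorphic_def by blast
  then show ?thesis
    using homeomorphic_simply_connected_eq convex_imp_simply_connected[OF convex_cball] by blast
qed

text \<open>In the chart \<open>\<eta>2\<close> is multiplication by a number, which differs from
  \<open>1\<close> as \<open>\<eta>2\<close> is not the identity; so only the centre is
  fixed.\<close>

lemma unique_fixed_point:
  assumes "\<exists>x\<in>K2. \<eta>2 x \<noteq> x"
  shows "\<exists>!z. z \<in> interior K2 \<and> \<eta>2 z = z"
proof (rule ex1I[of _ y0])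
  show "y0 \<in> interior K2 \<and> \<eta>2 y0 = y0"
    using y0_interior y0 by blast
  obtain x where x: "x \<in> K2" "\<eta>2 x \<noteq> x"
    using assms by blast
  have ne: "deriv \<eta>2 y0 \<noteq> 1"
  proof
    assume "deriv \<eta>2 y0 = 1"
    then have "h (\<eta>2 x) = h x"
      using h_rotation[OF x(1)] by simp
    then show False
      using inj_onD[OF h_inj] x two.\<eta>_into by blast
  qed
  fix z assume z: "z \<in> interior K2 \<and> \<eta>2 z = z"
  then have zK: "z \<in> K2"
    using interior_subset by blast
  then have "h z = deriv \<eta>2 y0 * h z"
    using h_rotation z by force
  then have "h z = h y0"
    using ne h_y0 by simp
  then show "z = y0"
    using inj_onD[OF h_inj] zK y0(1) by blast
qed

end

context tca_isomorphism_points
begin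

interpretation swap: tca_isomorphism_points K2 K1 \<eta>2 \<eta>1 \<iota>2 \<iota>1 E2 E1 \<Psi> \<Phi> y0 x0
  by (rule swapped_points)

theorem conjugate_inverse:
  assumes ne: "\<exists>x\<in>K1. \<eta>1 x \<noteq> x" "\<exists>x\<in>K2. \<eta>2 x \<noteq> x"
  shows "simply_connected K1 \<and> simply_connected K2 \<and>
     (\<exists>\<theta>. homeomorphism K1 K1 \<eta>1 \<theta>) \<and> (\<exists>\<theta>. homeomorphism K2 K2 \<eta>2 \<theta>) \<and>
     (\<exists>!z. z \<in> interior K1 \<and> \<eta>1 z = z) \<and> (\<exists>!z. z \<in> interior K2 \<and> \<eta>2 z = z) \<and>
     analytically_conjugate K1 (inv_into K1 \<eta>1) K2 \<eta>2"
proof (intro conjI)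
  let ?\<theta> = "inv_into K1 \<eta>1"
  have \<theta>: "?\<theta> y \<in> K1" "\<eta>1 (?\<theta> y) = y" if "y \<in> K1" for y
    using that swap.\<eta>2_surj inv_into_into[of y \<eta>1 K1] f_inv_into_f[of y \<eta>1 K1] by auto
  show "analytically_conjugate K1 ?\<theta> K2 \<eta>2"
  proof (rule analytically_conjugate_discs[OF one.compact_X two.compact_X
        swap.\<mu>_A swap.h_inj swap.h_image swap.rad_pos \<mu>_A h_inj h_image rad_pos])
    \<comment> \<open>In its chart the inverse of \<open>\<eta>1\<close> has multiplier
      \<open>deriv \<eta>2 y0\<close>, the same as \<open>\<eta>2\<close> has in the chart
      \<open>h\<close>.\<close>
    show "swap.h (?\<theta> y) = deriv \<eta>2 y0 * swap.h y" if "y \<in> K1" for y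
      using swap.h_\<eta>[OF \<theta>(1)[OF that]] \<theta>(2)[OF that] by simp
  qed (use \<theta> two.\<eta>_into h_rotation in auto)
qed (fact simply_connected_K2 swap.simply_connected_K2 \<eta>2_homeomorphism swap.\<eta>2_homeomorphism
    unique_fixed_point[OF ne(2)] swap.unique_fixed_point[OF ne(1)])+

end

section \<open>Assembling the cases\<close>

context tca_isomorphism
begin

interpretation swap: tca_isomorphism K2 K1 \<eta>2 \<eta>1 \<iota>2 \<iota>1 E2 E1 \<Psi> \<Phi>
  by (rule swapped)

text \<open>If the zero section of \<open>K1\<close> were mapped into that of \<open>K2\<close>,
  every point of \<open>K1\<close> would be recovered as a value of the constant
  \<open>\<gamma>\<close>, so \<open>K1\<close> would be a single point and its interior
  empty.\<close>

lemma \<mu>_nonzero_swap: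
  assumes ne: "\<exists>y\<in>K1. \<eta>1 y \<noteq> y" and x: "x \<in> K2" "\<mu> x 0 \<noteq> 0"
  shows "\<exists>y\<in>K1. swap.\<mu> y 0 \<noteq> 0"
proof (rule ccontr)
  assume "\<not> ?thesis"
  then have zero: "swap.\<mu> y 0 = 0" if "y \<in> K1" for y
    using that by blast
  obtain x0 where x0: "\<And>x. x \<in> K2 \<Longrightarrow> \<gamma> x 0 = x0"
    using \<gamma>_constant_or_id[OF x] ne by blast
  have "y = x0" if y: "y \<in> K1" for y
  proof -
    have K2: "swap.\<gamma> y 0 \<in> K2"
      by (rule swap.\<gamma>_mem[OF swap.admissible_zero[OF y]])
    then have "\<gamma> (swap.\<gamma> y 0) 0 = y"
      using swap.inverse_point(1)[OF swap.admissible_zero[OF y]] zero[OF y] admissible_zero by simp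
    then show ?thesis
      using x0[OF K2] by simp
  qed
  then have "interior K1 \<subseteq> {x0}"
    using interior_subset by blast
  then have "interior K1 = {x0}"
    using class_K_D(3)[OF one.K] by blast
  then show False
    using not_open_singleton[of x0] open_interior[of K1] by simp
qed

end

context tca_isomorphism
begin

interpretation swap: tca_isomorphism K2 K1 \<eta>2 \<eta>1 \<iota>2 \<iota>1 E2 E1 \<Psi> \<Phi>
  by (rule swapped)

theorem conjugate_or_conjugate_inverse:
  "analytically_conjugate K1 \<eta>1 K2 \<eta>2 \<or>
    (simply_connected K1 \<and> simply_connected K2 \<and>
     (\<exists>\<theta>. homeomorphism K1 K1 \<eta>1 \<theta>) \<and> (\<exists>\<theta>. homeomorphism K2 K2 \<eta>2 \<theta>) \<and>
     (\<exists>!z. z \<in> interior K1 \<and> \<eta>1 z = z) \<and> (\<exists>!z. z \<in> interior K2 \<and> \<eta>2 z = z) \<and>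
     analytically_conjugate K1 (inv_into K1 \<eta>1) K2 \<eta>2)"
proof (cases "(\<forall>y\<in>K1. \<eta>1 y = y) \<or> (\<forall>x\<in>K2. \<eta>2 x = x)")
  case True
  then have "\<eta>1 y = y" if "y \<in> K1" for y
    using that swap.id_of_id by blast
  moreover have "\<eta>2 x = x" if "x \<in> K2" for x
    using True that id_of_id by blast
  ultimately have "tca_isomorphism_id K1 K2 \<eta>1 \<eta>2 \<iota>1 \<iota>2 E1 E2 \<Phi> \<Psi>"
    by (intro tca_isomorphism_id.intro tca_isomorphism_id_axioms.intro tca_isomorphism_axioms)
  then show ?thesis
    using tca_isomorphism_id.conjugate by blast
next
  case False
  then have ne: "\<exists>y\<in>K1. \<eta>1 y \<noteq> y" "\<exists>x\<in>K2. \<eta>2 x \<noteq> x"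
    by auto
  show ?thesis
  proof (cases "(\<forall>x\<in>K2. \<mu> x 0 = 0) \<and> (\<forall>y\<in>K1. swap.\<mu> y 0 = 0)")
    case True
    then show ?thesis
      using conjugate_of_\<mu>_zero by blast
  next
    case False
    then obtain x y where x: "x \<in> K2" "\<mu> x 0 \<noteq> 0" and y: "y \<in> K1" "swap.\<mu> y 0 \<noteq> 0"
      using \<mu>_nonzero_swap[OF ne(1)] swap.\<mu>_nonzero_swap[OF ne(2)] by blast
    obtain x0 where x0: "x0 \<in> K1" "\<eta>1 x0 = x0" "\<And>x. x \<in> K2 \<Longrightarrow> \<gamma> x 0 = x0"
      using \<gamma>_constant_or_id[OF x] ne(1) by blast
    obtain y0 where y0: "y0 \<in> K2" "\<eta>2 y0 = y0" "\<And>y. y \<in> K1 \<Longrightarrow> swap.\<gamma> y 0 = y0"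
      using swap.\<gamma>_constant_or_id[OF y] ne(2) by blast
    have "tca_isomorphism_points K1 K2 \<eta>1 \<eta>2 \<iota>1 \<iota>2 E1 E2 \<Phi> \<Psi> x0 y0"
      using x0 y0 unfolding \<gamma>_def swap.\<gamma>_def
      by (intro tca_isomorphism_points.intro tca_isomorphism_points_axioms.intro tca_isomorphism_axioms)
    then show ?thesis
      using tca_isomorphism_points.conjugate_inverse[OF _ ne] by blast
  qed
qed

end

theorem theorem5p1:
  fixes K1 K2 :: "complex set"
    and \<eta>1 \<eta>2 :: "complex \<Rightarrow> complex"
    and \<iota>1 :: "(nat \<Rightarrow> complex \<Rightarrow> complex) \<Rightarrow> 'a::complex_banach_algebra"
    and \<iota>2 :: "(nat \<Rightarrow> complex \<Rightarrow> complex) \<Rightarrow> 'b::complex_banach_algebra"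
    and E1 :: "'a \<Rightarrow> 'a" and E2 :: "'b \<Rightarrow> 'b"
  assumes "K1 \<in> class_K" and "K2 \<in> class_K"
    and "\<eta>1 \<in> K1 \<rightarrow> K1" and "continuous_on K1 \<eta>1" and "\<eta>1 holomorphic_on interior K1"
    and "\<eta>2 \<in> K2 \<rightarrow> K2" and "continuous_on K2 \<eta>2" and "\<eta>2 holomorphic_on interior K2"
    and "topological_conjugacy_algebra K1 \<eta>1 \<iota>1 E1"
    and "topological_conjugacy_algebra K2 \<eta>2 \<iota>2 E2"
    and "algebras_isomorphic (tca_subalgebra K1 \<iota>1 (A_alg K1)) (tca_subalgebra K2 \<iota>2 (A_alg K2))"
  shows "analytically_conjugate K1 \<eta>1 K2 \<eta>2 \<or>
    (simply_connected K1 \<and> simply_connected K2 \<and>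
     (\<exists>\<theta>. homeomorphism K1 K1 \<eta>1 \<theta>) \<and> (\<exists>\<theta>. homeomorphism K2 K2 \<eta>2 \<theta>) \<and>
     (\<exists>!z. z \<in> interior K1 \<and> \<eta>1 z = z) \<and> (\<exists>!z. z \<in> interior K2 \<and> \<eta>2 z = z) \<and>
     analytically_conjugate K1 (inv_into K1 \<eta>1) K2 \<eta>2)"
proof -
  interpret one: analytic_tca K1 \<eta>1 \<iota>1 E1
    by (intro analytic_tca.intro analytic_tca_axioms.intro assms)
  interpret two: analytic_tca K2 \<eta>2 \<iota>2 E2
    by (intro analytic_tca.intro analytic_tca_axioms.intro assms)
  obtain \<Phi> where bij: "bij_betw \<Phi> one.B two.B" and hom: "complex_algebra_hom_on one.B \<Phi>"
    using assms(11) by (auto simp: algebras_isomorphic_def)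
  define \<Psi> where "\<Psi> = inv_into one.B \<Phi>"
  have \<Phi>: "\<Phi> a \<in> two.B" "\<Psi> (\<Phi> a) = a" if "a \<in> one.B" for a
    using bij that by (auto simp: \<Psi>_def bij_betw_def)
  have \<Psi>: "\<Psi> b \<in> one.B" "\<Phi> (\<Psi> b) = b" if "b \<in> two.B" for b
    using bij that by (auto simp: \<Psi>_def bij_betw_def inv_into_into f_inv_into_f)
  have \<Psi>_eqI: "\<Psi> b = a" if "a \<in> one.B" "\<Phi> a = b" for a b
    using \<Phi>(2)[OF that(1)] that(2) by simp
  \<comment> \<open>Each identity holds because its right-hand side lies in \<open>one.B\<close> and
    \<open>\<Phi>\<close> maps it to the argument of \<open>\<Psi>\<close> on the left.\<close>
  have "complex_algebra_hom_on two.B \<Psi>"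
    unfolding complex_algebra_hom_on_def
  proof (intro conjI ballI allI)
    fix x y c assume xy: "x \<in> two.B" "y \<in> two.B"
    show "\<Psi> (x + y) = \<Psi> x + \<Psi> y"
      using hom \<Psi>[OF xy(1)] \<Psi>[OF xy(2)]
      by (intro \<Psi>_eqI one.B_add) (auto simp: complex_algebra_hom_on_def)
    show "\<Psi> (x * y) = \<Psi> x * \<Psi> y"
      using hom \<Psi>[OF xy(1)] \<Psi>[OF xy(2)]
      by (intro \<Psi>_eqI one.B_mult) (auto simp: complex_algebra_hom_on_def)
  next
    fix x c assume x: "x \<in> two.B"
    show "\<Psi> (c *\<^sub>C x) = c *\<^sub>C \<Psi> x"
      using hom \<Psi>[OF x] one.subalgebra_B
      by (intro \<Psi>_eqI) (auto simp: complex_algebra_hom_on_def complex_subalgebra_def)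
  qed
  with hom \<Phi> \<Psi> have "tca_isomorphism K1 K2 \<eta>1 \<eta>2 \<iota>1 \<iota>2 E1 E2 \<Phi> \<Psi>"
    by unfold_locales
  then show ?thesis
    by (rule tca_isomorphism.conjugate_or_conjugate_inverse)
qed

end
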